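(* Each of the following two graphs can be embedded $3$-linklessly in $\mathbb{R}P^3$, i.e. admits an embedding into $\mathbb{R}P^3$ that contains no non-split three-component link: (i) the graph consisting of two vertex-disjoint copies of $K_6$ together with six edges between the two copies that form a $6$-cycle whose vertices alternate between the two copies; (ii) the graph formed by identifying an edge of $K_7$ with an edge from another copy of $K_7$.
   Context: $\mathbb{R}P^3$ is real projective $3$-space, i.e. the $3$-ball $D^3$ with antipodal points of its boundary sphere identified. Embeddings of graphs are tame (e.g. piecewise linear or smooth). A link in $\mathbb{R}P^3$ is splittable if its components can be divided into two nonempty collections such that one collection is contained in a $3$-ball embedded in $\mathbb{R}P^3$ and the other lies in the complement of that ball; otherwise the link is non-split. The three-component links contained in an embedded graph are those formed by the images of three pairwise disjoint cycles of the graph. Explicitly, the graph in (i) has vertices $1,\dots,6,A,\dots,F$, with $\{1,\dots,6\}$ and $\{A,\dots,F\}$ each inducing $K_6$ and exactly the edges $(4,A),(4,C),(5,A),(5,B),(6,B),(6,C)$ between them. The graph in (ii) has $12$ vertices $1,\dots,7,A,B,C,D,E$, where $\{1,\dots,7\}$ and $\{6,7,A,B,C,D,E\}$ each induce $K_7$, these share exactly the edge $(6,7)$, and there are no other edges. *)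

theory Defs
  imports "HOL-Analysis.Analysis" "HOL-Library.Ramsey"
begin

abbreviation D3 :: "(real ^ 3) set" where
  "D3 \<equiv> cball 0 1"

definition antipodal :: "((real ^ 3) \<times> (real ^ 3)) set" where
  "antipodal = {(x, y). x \<in> D3 \<and> y \<in> D3 \<and> (x = y \<or> (norm x = 1 \<and> y = - x))}"

lemma equiv_antipodal: "equiv D3 antipodal"
  by (rule equivI) (auto simp: antipodal_def refl_on_def intro!: symI transI)

definition proj :: "real ^ 3 \<Rightarrow> (real ^ 3) set" where
  "proj x = antipodal `` {x}"

definition RP3 :: "(real ^ 3) set topology" where
  "RP3 = topology (\<lambda>U. U \<subseteq> D3 // antipodal \<and>
                       openin (top_of_set D3) {x \<in> D3. proj x \<in> U})"

lemma openin_RP3: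
  "openin RP3 U \<longleftrightarrow>
     U \<subseteq> D3 // antipodal \<and> openin (top_of_set D3) {x \<in> D3. proj x \<in> U}"
proof -
  have "istopology (\<lambda>U. U \<subseteq> D3 // antipodal \<and>
                       openin (top_of_set D3) {x \<in> D3. proj x \<in> U})"
    unfolding istopology_def
  proof (intro conjI allI impI; (elim conjE)?)
    fix S T
    assume "openin (top_of_set D3) {x \<in> D3. proj x \<in> S}"
      and "openin (top_of_set D3) {x \<in> D3. proj x \<in> T}"
    then have "openin (top_of_set D3) ({x \<in> D3. proj x \<in> S} \<inter> {x \<in> D3. proj x \<in> T})"
      by (rule openin_Int)
    moreover have "{x \<in> D3. proj x \<in> S} \<inter> {x \<in> D3. proj x \<in> T} = {x \<in> D3. proj x \<in> S \<inter> T}"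
      by auto
    ultimately show "openin (top_of_set D3) {x \<in> D3. proj x \<in> S \<inter> T}"
      by metis
  next
    fix K
    assume *: "\<forall>k\<in>K. k \<subseteq> D3 // antipodal \<and> openin (top_of_set D3) {x \<in> D3. proj x \<in> k}"
    have "openin (top_of_set D3) (\<Union>k\<in>K. {x \<in> D3. proj x \<in> k})"
      using * by (intro openin_Union) auto
    moreover have "(\<Union>k\<in>K. {x \<in> D3. proj x \<in> k}) = {x \<in> D3. proj x \<in> \<Union>K}"
      by auto
    ultimately show "openin (top_of_set D3) {x \<in> D3. proj x \<in> \<Union>K}"
      by metis
  qed auto
  then show ?thesis
    unfolding RP3_def by (simp add: topology_inverse')
qed

lemma topspace_RP3: "topspace RP3 = D3 // antipodal"
proof -
  have "{x \<in> D3. proj x \<in> D3 // antipodal} = D3"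
    by (auto simp: proj_def quotientI)
  then have "openin RP3 (D3 // antipodal)"
    using openin_RP3 openin_subtopology_self by auto
  then show ?thesis
    by (auto simp: topspace_def openin_RP3)
qed

lemma quotient_map_proj: "quotient_map (top_of_set D3) RP3 proj"
proof -
  have "proj ` D3 = D3 // antipodal"
    by (auto simp: proj_def quotient_def)
  then show ?thesis
    by (auto simp: quotient_map_def topspace_RP3 openin_RP3)
qed


text \<open>A graph is a pair of its vertex set and its set of (two-element) edges.\<close>

type_synonym 'v graph = "'v set \<times> 'v set set"

definition finite_simple_graph :: "'v graph \<Rightarrow> bool" where
  "finite_simple_graph G \<longleftrightarrow>
     finite (fst G) \<and> (\<forall>e \<in> snd G. e \<subseteq> fst G \<and> card e = 2)"

definition cycle_edges :: "'v list \<Rightarrow> 'v set set" where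
  "cycle_edges c = {{c ! i, c ! (Suc i mod length c)} | i. i < length c}"

definition is_cycle :: "'v graph \<Rightarrow> 'v list \<Rightarrow> bool" where
  "is_cycle G c \<longleftrightarrow>
     3 \<le> length c \<and> distinct c \<and> set c \<subseteq> fst G \<and> cycle_edges c \<subseteq> snd G"

text \<open>The geometric realization in barycentric coordinates: a point is a convex
  combination of vertices whose support lies in a single vertex or edge.  Its topology
  is the one inherited from the product topology on functions, which for finite graphs
  is the usual one.\<close>

definition realization :: "'v graph \<Rightarrow> ('v \<Rightarrow> real) set" where
  "realization G =
     {x. \<exists>s \<in> (\<lambda>v. {v}) ` fst G \<union> snd G.
           (\<forall>v. 0 \<le> x v) \<and> (\<forall>v. v \<notin> s \<longrightarrow> x v = 0) \<and> sum x s = 1}"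


text \<open>A subset of projective space is polygonal if it comes from finitely many straight
  segments in the ball; segments may end on the boundary sphere and
  continue at the antipodal point.\<close>

definition polygonal :: "(real ^ 3) set set \<Rightarrow> bool" where
  "polygonal P \<longleftrightarrow>
     (\<exists>S. finite S \<and> S \<subseteq> D3 \<times> D3 \<and>
          P = proj ` (\<Union>(a, b) \<in> S. closed_segment a b))"

text \<open>Tameness is the usual one: some self-homeomorphism of the ambient space makes the
  image polygonal.\<close>

definition tame_embedding :: "'v graph \<Rightarrow> (('v \<Rightarrow> real) \<Rightarrow> (real ^ 3) set) \<Rightarrow> bool" where
  "tame_embedding G f \<longleftrightarrow>
     embedding_map (top_of_set (realization G)) RP3 f \<and>
     (\<exists>h. homeomorphic_map RP3 RP3 h \<and> polygonal (h ` f ` realization G))"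

text \<open>Balls are tame as well, which is expressed by a collar: the embedding of the
  ball extends over a larger open ball.  Every piecewise linear or smooth ball
  is of this form, whereas wild balls (such as a closed Alexander horned ball) are not.\<close>

definition embedded_ball :: "(real ^ 3) set set \<Rightarrow> bool" where
  "embedded_ball B \<longleftrightarrow>
     (\<exists>g. embedding_map (top_of_set (ball (0 :: real ^ 3) 2)) RP3 g \<and> B = g ` cball 0 1)"

text \<open>A link is represented by the set of its components (each a subset of projective
  space), so that cycles traversed differently give the same link.\<close>

definition splittable :: "(real ^ 3) set set set \<Rightarrow> bool" where
  "splittable L \<longleftrightarrow>
     (\<exists>L1 L2 B. L1 \<noteq> {} \<and> L2 \<noteq> {} \<and> L1 \<inter> L2 = {} \<and> L1 \<union> L2 = L \<and>
                embedded_ball B \<and> \<Union>L1 \<subseteq> B \<and> \<Union>L2 \<inter> B = {})"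

definition three_component_links ::
  "'v graph \<Rightarrow> (('v \<Rightarrow> real) \<Rightarrow> (real ^ 3) set) \<Rightarrow> (real ^ 3) set set set set" where
  "three_component_links G f =
     {(\<lambda>c. f ` realization (set c, cycle_edges c)) ` {c1, c2, c3} | c1 c2 c3.
        is_cycle G c1 \<and> is_cycle G c2 \<and> is_cycle G c3 \<and>
        set c1 \<inter> set c2 = {} \<and> set c1 \<inter> set c3 = {} \<and> set c2 \<inter> set c3 = {}}"

definition three_linklessly_embeddable :: "'v graph \<Rightarrow> bool" where
  "three_linklessly_embeddable G \<longleftrightarrow>
     (\<exists>f. tame_embedding G f \<and> (\<forall>L \<in> three_component_links G f. splittable L))"


datatype vertex = Num nat | VA | VB | VC | VD | VE | VF

definition K6_K6_hexagon :: "vertex graph" where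
  "K6_K6_hexagon =
     (Num ` {1..6} \<union> {VA, VB, VC, VD, VE, VF},
      nsets (Num ` {1..6}) 2 \<union> nsets {VA, VB, VC, VD, VE, VF} 2 \<union>
      {{Num 4, VA}, {Num 4, VC}, {Num 5, VA}, {Num 5, VB}, {Num 6, VB}, {Num 6, VC}})"

definition K7_K7_edge :: "vertex graph" where
  "K7_K7_edge =
     (Num ` {1..7} \<union> {VA, VB, VC, VD, VE},
      nsets (Num ` {1..7}) 2 \<union>
      nsets {Num 6, Num 7, VA, VB, VC, VD, VE} 2)"

lemma finite_simple_graph_K6_K6_hexagon: "finite_simple_graph K6_K6_hexagon"
  by (auto simp: finite_simple_graph_def K6_K6_hexagon_def nsets_def)

lemma finite_simple_graph_K7_K7_edge: "finite_simple_graph K7_K7_edge"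
  by (auto simp: finite_simple_graph_def K7_K7_edge_def nsets_def)

end

theory Submission
  imports Defs
begin

text \<open>
  Projective space is the space of lines in \<open>\<real>\<^sup>3 \<times> \<real>\<close>, so a graph can be drawn by lifting its
  vertices to vectors with integer coordinates and its edges to segments.  Affine charts,
  the plane at infinity and changes of sign then all disappear into linear algebra.

  Both drawings start from the same \<open>K\<^sub>6\<close> on \<open>1, \<dots>, 6\<close>.  It lies in the projective plane where the
  third coordinate vanishes and triangulates that plane: \<open>1, \<dots>, 5\<close> form a pentagon around \<open>6\<close>,
  and the five diagonals of the pentagon leave the picture through infinity.  In this
  triangulation exactly one triangle of any two complementary triangles is a face.  A face
  bounds a disc that misses the rest of the graph, and a part of the graph lying off the plane
  can be enclosed in a ball together with a face, because a convex body above the plane touches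
  it in the face only.
  For the first graph the second \<open>K\<^sub>6\<close> is placed above the plane, with \<open>A, B, C\<close> below
  \<open>D, E, F\<close>.  For the second graph \<open>7\<close> is placed above \<open>6\<close>, and \<open>A, \<dots>, E\<close> are placed inside the
  tetrahedron spanned by \<open>1, 2, 6, 7\<close>.

  A link is split by a ball that contains the part of the graph spanned by a vertex set \<open>S\<close> and
  misses the part spanned by the complement of \<open>S\<close>, as soon as every component lies on one side
  and both sides occur.  All balls that are needed are projective tetrahedra, that is, images of
  cones in \<open>\<real>\<^sup>3 \<times> \<real>\<close> on which four independent linear forms are positive.  An edge lies inside if
  the forms are positive on its lift, and it lies outside if for each sign of the lift one
  of the forms is nonpositive on it.  These are finitely many integer inequalities; the lemma
  \<open>separating_ball\<close> turns them into balls and \<open>three_linkless_criterion\<close> into splittings.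

  It remains to see that finitely many sets \<open>S\<close> serve all triples of disjoint cycles
  (\<open>hex_sorted\<close>, \<open>glued_sorted\<close>).  In the first graph a cycle that uses both copies meets each copy
  in a single vertex or in at least two of its three vertices on the hexagon, since it has no
  cut vertex.  If there is one such cycle \<open>X\<close>, and \<open>Y\<close> and \<open>Z\<close> lie in the left and the right copy,
  then \<open>S\<close> is the right copy with the left part of \<open>X\<close>, unless that part is a triangle
  which is no face; in that case the complementary triangle \<open>Y\<close> is a face and is itself cut off.
  If there are two, they exhaust the hexagon vertices of the copy that contains the third cycle.
  In the second graph the vertices \<open>6, 7\<close> separate \<open>1, \<dots>, 5\<close> from \<open>A, \<dots>, E\<close>, and the same
  alternative between an edge of the pentagon and a face cut off from everything else decides
  the only delicate case, in which some of the vertices \<open>1, \<dots>, 5\<close> lie on cycles through \<open>6\<close> or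
  \<open>7\<close> while another cycle stays within \<open>1, \<dots>, 5\<close>.
\<close>

section \<open>Homogeneous coordinates on projective space\<close>


type_synonym hvec = "(real ^ 3) \<times> real"

text \<open>
  The unit sphere of this norm is cut out by the planes at height \<open>\<plusminus>1\<close> and a double cone over the
  unit sphere at height \<open>0\<close>.  On the flat part the central projection onto it is the usual affine
  chart, so short segments stay straight; on the conical part rays through the origin stay
  straight.  Thus both kinds of segments are polygonal in the ball model.
\<close>

definition hnorm :: "hvec \<Rightarrow> real" where
  "hnorm v = max \<bar>snd v\<bar> (norm (fst v) + \<bar>snd v\<bar> / 2)"

definition hproj :: "hvec \<Rightarrow> (real ^ 3) set" where
  "hproj v = proj (((if 0 \<le> snd v then 1 else -1) / hnorm v) *\<^sub>R fst v)"

lemma proj_eq_iff: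
  assumes "x \<in> D3" "y \<in> D3"
  shows "proj x = proj y \<longleftrightarrow> x = y \<or> (norm x = 1 \<and> y = - x)"
proof -
  have "proj x = proj y \<longleftrightarrow> (x, y) \<in> antipodal"
    unfolding proj_def using eq_equiv_class_iff[OF equiv_antipodal assms] .
  then show ?thesis
    using assms by (auto simp: antipodal_def)
qed

lemma hnorm_pos: "v \<noteq> 0 \<Longrightarrow> 0 < hnorm v"
  by (cases v) (auto simp: hnorm_def zero_prod_def less_max_iff_disj add_pos_nonneg)

lemma hnorm_scaleR: "hnorm (c *\<^sub>R v) = \<bar>c\<bar> * hnorm v"
proof -
  have "norm (c *\<^sub>R fst v) + \<bar>c * snd v\<bar> / 2 = \<bar>c\<bar> * (norm (fst v) + \<bar>snd v\<bar> / 2)"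
    by (simp add: abs_mult algebra_simps)
  then show ?thesis
    by (simp add: hnorm_def abs_mult max_mult_distrib_left)
qed

lemma norm_fst_le_hnorm: "norm (fst v) \<le> hnorm v"
  unfolding hnorm_def by (rule max.coboundedI2) simp

lemma hnorm_at_infinity: "snd v = 0 \<Longrightarrow> hnorm v = norm (fst v)"
  by (simp add: hnorm_def)

lemma norm_scale_le_1:
  assumes "v \<noteq> 0"
  shows "norm (fst v /\<^sub>R hnorm v) \<le> 1"
  using hnorm_pos[OF assms] norm_fst_le_hnorm[of v] by (simp add: divide_simps)

lemma continuous_on_hnorm: "continuous_on S hnorm"
  unfolding hnorm_def by (intro continuous_intros) simp

lemma hproj_nonneg: "0 \<le> snd v \<Longrightarrow> hproj v = proj (fst v /\<^sub>R hnorm v)"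
  by (simp add: hproj_def divide_inverse)

lemma hproj_nonpos:
  assumes "v \<noteq> 0" "snd v \<le> 0"
  shows "hproj v = proj (- (fst v /\<^sub>R hnorm v))"
proof (cases "snd v = 0")
  case True
  then have "norm (fst v) \<noteq> 0"
    using assms by (cases v) (auto simp: zero_prod_def)
  then have "norm (fst v /\<^sub>R hnorm v) = 1"
    using True by (simp add: hnorm_at_infinity)
  then show ?thesis
    using True by (subst hproj_nonneg) (auto simp: proj_eq_iff)
next
  case False
  then show ?thesis
    using assms by (simp add: hproj_def divide_inverse)
qed

lemma hproj_uminus: "v \<noteq> 0 \<Longrightarrow> hproj (- v) = hproj v"
proof -
  assume "v \<noteq> 0"
  moreover have "hnorm (- v) = hnorm v"
    using hnorm_scaleR[of "-1" v] by simp
  ultimately show ?thesis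
    by (cases "0 \<le> snd v") (simp_all add: hproj_nonneg hproj_nonpos)
qed

lemma hproj_scaleR:
  assumes "c \<noteq> 0" "v \<noteq> 0"
  shows "hproj (c *\<^sub>R v) = hproj v"
proof -
  have pos: "hproj (k *\<^sub>R v) = hproj v" if "0 < k" for k
  proof -
    have "inverse k * (inverse (hnorm v) * k) = inverse (hnorm v)"
      using that by simp
    then have eq: "fst (k *\<^sub>R v) /\<^sub>R hnorm (k *\<^sub>R v) = fst v /\<^sub>R hnorm v"
      using that by (simp only: hnorm_scaleR fst_scaleR scaleR_scaleR abs_of_pos inverse_mult_distrib mult.assoc)
    show ?thesis
    proof (cases "0 \<le> snd v")
      case True
      then show ?thesis
        using that hproj_nonneg[of "k *\<^sub>R v"] hproj_nonneg[of v] by (simp add: eq del: fst_scaleR)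
    next
      case False
      then show ?thesis
        using that assms hproj_nonpos[of "k *\<^sub>R v"] hproj_nonpos[of v]
        by (simp add: eq mult_nonneg_nonpos del: fst_scaleR)
    qed
  qed
  show ?thesis
  proof (cases "0 < c")
    case True then show ?thesis by (rule pos)
  next
    case False
    then have "hproj (- (c *\<^sub>R v)) = hproj v"
      using pos[of "- c"] assms by simp
    then show ?thesis
      using assms hproj_uminus[of "c *\<^sub>R v"] by simp
  qed
qed

text \<open>
  A section of \<open>hproj\<close> with values in the upper half of the unit sphere of \<open>hnorm\<close>.  Antipodal
  boundary points of the ball have opposite lifts, which makes the fibres of \<open>hproj\<close> lines.
\<close>

definition lift :: "real ^ 3 \<Rightarrow> hvec" where
  "lift x = (x, min 1 (2 * (1 - norm x)))"

lemma lift_hnorm: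
  assumes "v \<noteq> 0" "0 \<le> snd v"
  shows "v = hnorm v *\<^sub>R lift (fst v /\<^sub>R hnorm v)"
proof -
  have g: "0 < hnorm v" using assms hnorm_pos by blast
  have "snd v = min (hnorm v) (2 * (hnorm v - norm (fst v)))"
    using assms(2) by (auto simp: hnorm_def max_def min_def split: if_splits)
  also have "\<dots> = hnorm v * min 1 (2 * (1 - norm (fst v) / hnorm v))"
  proof -
    have "hnorm v * (norm (fst v) / hnorm v) = norm (fst v)" using g by simp
    then show ?thesis
      using g by (simp add: min_mult_distrib_left right_diff_distrib mult.left_commute)
  qed
  finally show ?thesis
    using g by (cases v) (simp add: lift_def divide_inverse_commute)
qed

lemma obtain_lift:
  assumes "v \<noteq> 0"
  obtains c x where "c \<noteq> 0" "x \<in> D3" "v = c *\<^sub>R lift x" "hproj v = proj x"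
proof (cases "0 \<le> snd v")
  case True
  then show ?thesis
    using that[of "hnorm v" "fst v /\<^sub>R hnorm v"] assms lift_hnorm[OF assms True]
      hnorm_pos[OF assms] norm_scale_le_1[OF assms] hproj_nonneg[OF True] by simp
next
  case False
  define w where "w = - v"
  have w: "w \<noteq> 0" "0 \<le> snd w" using assms False by (auto simp: w_def)
  have "hproj v = hproj w" using hproj_uminus[OF assms] by (simp add: w_def)
  moreover have "v = (- hnorm w) *\<^sub>R lift (fst w /\<^sub>R hnorm w)"
    using lift_hnorm[OF w] by (simp add: w_def)
  ultimately show ?thesis
    using that[of "- hnorm w" "fst w /\<^sub>R hnorm w"] hnorm_pos[OF w(1)] norm_scale_le_1[OF w(1)]
      hproj_nonneg[OF w(2)] by simp
qed

lemma hproj_eqD: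
  assumes "v \<noteq> 0" "w \<noteq> 0" "hproj v = hproj w"
  obtains c where "c \<noteq> 0" "v = c *\<^sub>R w"
proof -
  obtain a x where a: "a \<noteq> 0" "x \<in> D3" "v = a *\<^sub>R lift x" "hproj v = proj x"
    using obtain_lift[OF assms(1)] .
  obtain b y where b: "b \<noteq> 0" "y \<in> D3" "w = b *\<^sub>R lift y" "hproj w = proj y"
    using obtain_lift[OF assms(2)] .
  have "x = y \<or> (norm x = 1 \<and> y = - x)"
    using a b assms(3) proj_eq_iff by metis
  then have "lift x = lift y \<or> lift x = - lift y"
    by (auto simp: lift_def)
  then show ?thesis
  proof
    assume "lift x = lift y"
    then show ?thesis using that[of "a / b"] a b by simp
  next
    assume "lift x = - lift y"
    then show ?thesis using that[of "- (a / b)"] a b by simp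
  qed
qed

lemma continuous_map_proj: "continuous_map (top_of_set D3) RP3 proj"
  by (rule quotient_imp_continuous_map[OF quotient_map_proj])

text \<open>
  The two formulas on the closed half-spaces agree at height \<open>0\<close> because boundary points of
  the ball are identified with their antipodes.
\<close>

lemma continuous_map_hproj: "continuous_map (top_of_set (- {0})) RP3 hproj"
proof -
  let ?X = "top_of_set (- {0 :: hvec})"
  define T where "T b = (if b then {v :: hvec. v \<noteq> 0 \<and> 0 \<le> snd v} else {v. v \<noteq> 0 \<and> snd v \<le> 0})" for b
  define f where "f b v = (if b then proj (fst v /\<^sub>R hnorm v) else proj (- (fst v /\<^sub>R hnorm v)))" for b v
  have cont: "continuous_on S (\<lambda>v. fst v /\<^sub>R hnorm v)" if "0 \<notin> S" for S
    by (intro continuous_intros continuous_on_hnorm) (use that hnorm_pos in \<open>metis less_irrefl\<close>)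
  have "continuous_map (top_of_set (T b)) RP3 (proj \<circ> (\<lambda>v. (if b then fst v /\<^sub>R hnorm v else - (fst v /\<^sub>R hnorm v))))" for b
  proof (rule continuous_map_compose[OF _ continuous_map_proj])
    show "continuous_map (top_of_set (T b)) (top_of_set D3)
        (\<lambda>v. (if b then fst v /\<^sub>R hnorm v else - (fst v /\<^sub>R hnorm v)))"
      using norm_scale_le_1 cont[of "T b"]
      by (cases b) (auto simp: T_def intro!: continuous_intros)
  qed
  then have f: "continuous_map (top_of_set (T b)) RP3 (f b)" for b
    by (rule continuous_map_eq) (auto simp: f_def)
  show ?thesis
  proof (rule pasting_lemma_closed[where I = UNIV and T = T and f = f])
    show "finite (UNIV :: bool set)" by simp
  next
    fix b
    have "closed {v :: hvec. 0 \<le> snd v}" "closed {v :: hvec. snd v \<le> 0}"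
      by (intro closed_Collect_le continuous_intros)+
    moreover have "T b = - {0} \<inter> (if b then {v. 0 \<le> snd v} else {v. snd v \<le> 0})"
      by (auto simp: T_def)
    ultimately show "closedin ?X (T b)"
      by (auto simp: closedin_closed)
    have "subtopology ?X (T b) = top_of_set (T b)"
      by (simp add: subtopology_subtopology T_def Int_absorb1 subset_iff)
    then show "continuous_map (subtopology ?X (T b)) RP3 (f b)"
      using f by simp
  next
    fix b b' v
    assume "v \<in> topspace ?X \<inter> T b \<inter> T b'"
    then have "v \<noteq> 0" "(b \<longleftrightarrow> b') \<or> snd v = 0"
      by (auto simp: T_def split: if_splits)
    then show "f b v = f b' v"
      using hproj_nonpos[of v] hproj_nonneg[of v] by (auto simp: f_def)
  next
    fix v
    assume "v \<in> topspace ?X"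
    then show "\<exists>b. b \<in> UNIV \<and> v \<in> T b \<and> hproj v = f b v"
      using hproj_nonneg[of v] hproj_nonpos[of v]
      by (intro exI[of _ "0 \<le> snd v"]) (auto simp: T_def f_def)
  qed
qed

lemma closed_map_proj: "closed_map (top_of_set D3) RP3 proj"
  unfolding closed_map_def
proof (intro allI impI)
  fix C
  assume "closedin (top_of_set D3) C"
  then have C: "C \<subseteq> D3" "closed C"
    using closedin_subset closedin_closed_trans closed_cball by force+
  have eq: "{x \<in> D3. proj x \<in> proj ` C} = C \<union> uminus ` (C \<inter> sphere 0 1)"
  proof (intro equalityI subsetI)
    fix x assume "x \<in> {x \<in> D3. proj x \<in> proj ` C}"
    then obtain y where "y \<in> C" "x \<in> D3" "proj x = proj y" by auto
    then have "x = y \<or> (norm x = 1 \<and> y = - x)"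
      using proj_eq_iff[of x y] C by blast
    then show "x \<in> C \<union> uminus ` (C \<inter> sphere 0 1)"
    proof
      assume "norm x = 1 \<and> y = - x"
      then have "- x \<in> C \<inter> sphere 0 1" using \<open>y \<in> C\<close> by simp
      then show ?thesis by (metis UnI2 image_eqI minus_minus)
    qed (use \<open>y \<in> C\<close> in simp)
  next
    fix x assume x: "x \<in> C \<union> uminus ` (C \<inter> sphere 0 1)"
    then show "x \<in> {x \<in> D3. proj x \<in> proj ` C}"
    proof
      assume "x \<in> uminus ` (C \<inter> sphere 0 1)"
      then obtain y where y: "y \<in> C" "norm y = 1" "x = - y" by auto
      then have "proj y = proj x" using proj_eq_iff[of y x] by auto
      then show ?thesis using y by auto
    qed (use C in auto)
  qed
  have "closed (C \<union> uminus ` (C \<inter> sphere 0 1))"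
    using C by (intro closed_Un closed_negations closed_Int) auto
  then have "closedin (top_of_set D3) {x \<in> D3. proj x \<in> proj ` C}"
    unfolding eq[symmetric] by (rule closed_subset[rotated]) auto
  then show "closedin RP3 (proj ` C)"
    using quotient_map_proj C(1)
    unfolding quotient_map_closedin by (auto dest!: spec[of _ "proj ` C"])
qed

text \<open>
  Needed so that injective continuous maps from compact spaces are embeddings.
\<close>

lemma Hausdorff_RP3: "Hausdorff_space RP3"
proof -
  have "Hausdorff_space (top_of_set D3)"
    by (simp add: Hausdorff_space_subtopology)
  moreover have "normal_space (top_of_set D3)"
    by (intro compact_Hausdorff_or_regular_imp_normal_space) (auto simp: Hausdorff_space_subtopology compact_space_subtopology)
  ultimately show ?thesis
    using normal_Hausdorff_space_closed_continuous_map_image closed_map_proj continuous_map_proj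
      quotient_map_proj unfolding quotient_map_def by blast
qed

definition hcone :: "hvec \<Rightarrow> hvec \<Rightarrow> hvec set" where
  "hcone a b = {\<alpha> *\<^sub>R a + \<beta> *\<^sub>R b | \<alpha> \<beta>. 0 \<le> \<alpha> \<and> 0 \<le> \<beta> \<and> 0 < \<alpha> + \<beta>}"

lemma hproj_straight_segment:
  assumes "norm (fst a) \<le> snd a / 2" "0 < snd a" "norm (fst b) \<le> snd b / 2" "0 < snd b"
  shows "hproj ` hcone a b = proj ` closed_segment (fst a /\<^sub>R snd a) (fst b /\<^sub>R snd b)"
proof -
  have h: "hproj v = proj (fst v /\<^sub>R snd v)" if "norm (fst v) \<le> snd v / 2" for v
  proof -
    have "0 \<le> snd v" using that norm_ge_zero[of "fst v"] by linarith
    then have "hnorm v = snd v" using that by (simp add: hnorm_def)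
    then show ?thesis using hproj_nonneg[of v] \<open>0 \<le> snd v\<close> by simp
  qed
  show ?thesis
  proof (intro equalityI subsetI)
    fix X assume "X \<in> hproj ` hcone a b"
    then obtain \<alpha> \<beta> where ab: "0 \<le> \<alpha>" "0 \<le> \<beta>" "0 < \<alpha> + \<beta>" "X = hproj (\<alpha> *\<^sub>R a + \<beta> *\<^sub>R b)"
      by (auto simp: hcone_def)
    define s where "s = \<alpha> * snd a + \<beta> * snd b"
    have s: "0 < s" unfolding s_def using ab assms
      by (metis add_cancel_left_left add_nonneg_pos add_pos_nonneg less_eq_real_def mult_nonneg_nonneg mult_pos_pos)
    have "norm (\<alpha> *\<^sub>R fst a + \<beta> *\<^sub>R fst b) \<le> \<alpha> * norm (fst a) + \<beta> * norm (fst b)"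
      using ab norm_triangle_ineq[of "\<alpha> *\<^sub>R fst a" "\<beta> *\<^sub>R fst b"] by simp
    also have "\<dots> \<le> \<alpha> * (snd a / 2) + \<beta> * (snd b / 2)"
      using ab assms by (intro add_mono mult_left_mono) auto
    finally have "X = proj ((\<alpha> *\<^sub>R fst a + \<beta> *\<^sub>R fst b) /\<^sub>R s)"
      using h[of "\<alpha> *\<^sub>R a + \<beta> *\<^sub>R b"] ab by (simp add: s_def)
    moreover have "(\<alpha> *\<^sub>R fst a + \<beta> *\<^sub>R fst b) /\<^sub>R s
       = (1 - \<beta> * snd b / s) *\<^sub>R (fst a /\<^sub>R snd a) + (\<beta> * snd b / s) *\<^sub>R (fst b /\<^sub>R snd b)"
    proof -
      have "1 - \<beta> * snd b / s = \<alpha> * snd a / s"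
        using s by (simp add: s_def field_simps)
      then show ?thesis
        using assms s by (simp add: scaleR_add_right divide_simps)
    qed
    moreover have "0 \<le> \<beta> * snd b / s" "\<beta> * snd b / s \<le> 1"
      using s ab assms by (auto simp: s_def divide_simps)
    ultimately show "X \<in> proj ` closed_segment (fst a /\<^sub>R snd a) (fst b /\<^sub>R snd b)"
      unfolding closed_segment_def by blast
  next
    fix X assume "X \<in> proj ` closed_segment (fst a /\<^sub>R snd a) (fst b /\<^sub>R snd b)"
    then obtain u where u: "0 \<le> u" "u \<le> 1"
      "X = proj ((1 - u) *\<^sub>R (fst a /\<^sub>R snd a) + u *\<^sub>R (fst b /\<^sub>R snd b))"
      by (auto simp: closed_segment_def)
    define v where "v = ((1 - u) / snd a) *\<^sub>R a + (u / snd b) *\<^sub>R b"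
    have "snd v = 1" using assms by (simp add: v_def)
    moreover have fv: "fst v = (1 - u) *\<^sub>R (fst a /\<^sub>R snd a) + u *\<^sub>R (fst b /\<^sub>R snd b)"
      by (simp add: v_def divide_inverse)
    moreover have "norm (fst v) \<le> 1 / 2"
    proof -
      have "norm (fst a /\<^sub>R snd a) \<le> 1 / 2" "norm (fst b /\<^sub>R snd b) \<le> 1 / 2"
        using assms by (simp_all add: field_simps)
      then have "fst a /\<^sub>R snd a \<in> cball 0 (1/2)" "fst b /\<^sub>R snd b \<in> cball 0 (1/2)" by simp_all
      then have "fst v \<in> cball 0 (1 / 2)"
        unfolding fv using u by (intro convexD[OF convex_cball]) auto
      then show ?thesis by simp
    qed
    ultimately have "X = hproj v" using u h[of v] by simp
    moreover have "v \<in> hcone a b"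
      unfolding hcone_def v_def
    proof (intro CollectI exI conjI)
      show "0 < (1 - u) / snd a + u / snd b"
        using u assms by (cases "u = 0") (auto intro!: add_nonneg_pos)
    qed (use u assms in auto)
    ultimately show "X \<in> hproj ` hcone a b" by blast
  qed
qed

text \<open>
  On the vertical line over \<open>x\<close>, the image depends on \<open>hnorm\<close> alone, which runs through an
  interval; the explicit preimage of \<open>g\<close> distinguishes the flat and the conical part of the sphere.
\<close>

lemma hproj_ray:
  assumes "x \<noteq> 0" "norm x \<le> t / 2"
  shows "hproj ` {(x, \<tau>) | \<tau>. 0 \<le> \<tau> \<and> \<tau> \<le> t} = proj ` closed_segment (x /\<^sub>R norm x) (x /\<^sub>R t)"
proof -
  have nx: "0 < norm x" and t: "norm x < t" using assms norm_ge_zero[of x] by (auto simp: field_simps)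
    (smt (verit) zero_less_norm_iff)
  have seg: "closed_segment (x /\<^sub>R norm x) (x /\<^sub>R t) = (\<lambda>g. x /\<^sub>R g) ` {norm x..t}"
  proof (intro equalityI subsetI)
    fix y assume "y \<in> closed_segment (x /\<^sub>R norm x) (x /\<^sub>R t)"
    then obtain u where u: "0 \<le> u" "u \<le> 1" "y = (1 - u) *\<^sub>R (x /\<^sub>R norm x) + u *\<^sub>R (x /\<^sub>R t)"
      by (auto simp: closed_segment_def)
    define k where "k = (1 - u) * inverse (norm x) + u * inverse t"
    have y: "y = k *\<^sub>R x" by (simp add: u k_def scaleR_add_left)
    have it: "inverse t \<le> inverse (norm x)" using nx t by (intro le_imp_inverse_le) auto
    have "u * inverse t \<le> u * inverse (norm x)" "(1 - u) * inverse t \<le> (1 - u) * inverse (norm x)"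
      using it u by (intro mult_left_mono; simp)+
    then have k: "inverse t \<le> k" "k \<le> inverse (norm x)"
      by (simp_all add: k_def algebra_simps)
    have k0: "0 < k" using k nx t by (smt (verit) positive_imp_inverse_positive)
    have "inverse k \<le> t" "norm x \<le> inverse k"
      using k k0 nx t by (auto simp: field_simps)
    then have "inverse k \<in> {norm x..t}" "y = x /\<^sub>R inverse k"
      by (simp_all add: y)
    then show "y \<in> (\<lambda>g. x /\<^sub>R g) ` {norm x..t}" by blast
  next
    fix y assume "y \<in> (\<lambda>g. x /\<^sub>R g) ` {norm x..t}"
    then obtain g where g: "norm x \<le> g" "g \<le> t" "y = x /\<^sub>R g" by auto
    have "inverse g \<in> closed_segment (inverse (norm x)) (inverse t)"
    proof -
      have "inverse t \<le> inverse g" "inverse g \<le> inverse (norm x)"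
        using g nx by (intro le_imp_inverse_le; linarith)+
      then show ?thesis by (auto simp: closed_segment_eq_real_ivl)
    qed
    then obtain u where "0 \<le> u" "u \<le> 1" "inverse g = (1 - u) * inverse (norm x) + u * inverse t"
      by (auto simp: closed_segment_def)
    then show "y \<in> closed_segment (x /\<^sub>R norm x) (x /\<^sub>R t)"
      unfolding closed_segment_def g by (auto simp: scaleR_add_left)
  qed
  have "hnorm ` {(x, \<tau>) | \<tau>. 0 \<le> \<tau> \<and> \<tau> \<le> t} = {norm x..t}"
  proof (intro equalityI subsetI)
    fix g assume "g \<in> hnorm ` {(x, \<tau>) | \<tau>. 0 \<le> \<tau> \<and> \<tau> \<le> t}"
    then show "g \<in> {norm x..t}" using assms by (auto simp: hnorm_def max_def)
  next
    fix g assume g: "g \<in> {norm x..t}"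
    define n where "n = norm x"
    define \<tau> where "\<tau> = (if 2 * n \<le> g then g else 2 * (g - n))"
    have n: "0 < n" "n \<le> g" "g \<le> t" using g nx by (auto simp: n_def)
    then have "0 \<le> \<tau>" "\<tau> \<le> t" "max \<bar>\<tau>\<bar> (n + \<bar>\<tau>\<bar> / 2) = g"
      by (auto simp: \<tau>_def max_def abs_if field_simps)
    then have "0 \<le> \<tau>" "\<tau> \<le> t" "hnorm (x, \<tau>) = g"
      by (auto simp: hnorm_def n_def)
    then show "g \<in> hnorm ` {(x, \<tau>) | \<tau>. 0 \<le> \<tau> \<and> \<tau> \<le> t}" by force
  qed
  then have "(\<lambda>g. proj (x /\<^sub>R g)) ` hnorm ` {(x, \<tau>) | \<tau>. 0 \<le> \<tau> \<and> \<tau> \<le> t}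
      = proj ` closed_segment (x /\<^sub>R norm x) (x /\<^sub>R t)"
    unfolding seg by (simp add: image_image)
  moreover have "hproj ` {(x, \<tau>) | \<tau>. 0 \<le> \<tau> \<and> \<tau> \<le> t} =
      (\<lambda>v. proj (x /\<^sub>R hnorm v)) ` {(x, \<tau>) | \<tau>. 0 \<le> \<tau> \<and> \<tau> \<le> t}"
    by (intro image_cong refl) (auto simp: hproj_nonneg)
  ultimately show ?thesis by (simp add: image_image)
qed

text \<open>
  The only segments through infinity that occur in the drawings lie on lines through the
  origin.  Such a segment becomes two radial segments ending at antipodal boundary points.
\<close>

lemma hproj_radial_segment:
  assumes "x \<noteq> 0" "norm x \<le> s / 2" "norm x \<le> t / 2"
  shows "hproj ` hcone (x, s) (x, - t) =
    proj ` (closed_segment (x /\<^sub>R norm x) (x /\<^sub>R s) \<union> closed_segment (- x /\<^sub>R norm x) (- x /\<^sub>R t))"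
proof -
  have st: "0 < s" "0 < t" using assms by (smt (verit) field_sum_of_halves zero_less_norm_iff)+
  have "hproj ` hcone (x, s) (x, - t) = hproj ` {(x, \<tau>) | \<tau>. - t \<le> \<tau> \<and> \<tau> \<le> s}"
  proof (intro equalityI subsetI)
    fix X assume "X \<in> hproj ` hcone (x, s) (x, - t)"
    then obtain \<alpha> \<beta> where ab: "0 \<le> \<alpha>" "0 \<le> \<beta>" "0 < \<alpha> + \<beta>" "X = hproj (\<alpha> *\<^sub>R (x, s) + \<beta> *\<^sub>R (x, - t))"
      by (auto simp: hcone_def)
    define \<tau> where "\<tau> = (\<alpha> * s - \<beta> * t) / (\<alpha> + \<beta>)"
    have "\<alpha> *\<^sub>R (x, s) + \<beta> *\<^sub>R (x, - t) = (\<alpha> + \<beta>) *\<^sub>R (x, \<tau>)"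
      using ab by (simp add: \<tau>_def scaleR_add_left)
    then have "X = hproj (x, \<tau>)"
      using ab assms hproj_scaleR[of "\<alpha> + \<beta>" "(x, \<tau>)"] by (simp add: zero_prod_def)
    moreover have "0 \<le> \<alpha> * s" "0 \<le> \<alpha> * t" "0 \<le> \<beta> * s" "0 \<le> \<beta> * t"
      using ab st by auto
    then have "- t \<le> \<tau>" "\<tau> \<le> s"
      using ab by (simp_all add: \<tau>_def le_divide_eq divide_le_eq algebra_simps)
    ultimately show "X \<in> hproj ` {(x, \<tau>) | \<tau>. - t \<le> \<tau> \<and> \<tau> \<le> s}" by blast
  next
    fix X assume "X \<in> hproj ` {(x, \<tau>) | \<tau>. - t \<le> \<tau> \<and> \<tau> \<le> s}"
    then obtain \<tau> where \<tau>: "X = hproj (x, \<tau>)" "- t \<le> \<tau>" "\<tau> \<le> s" by auto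
    define \<alpha> where "\<alpha> = (\<tau> + t) / (s + t)"
    have a: "0 \<le> \<alpha>" "\<alpha> \<le> 1" using \<tau> st by (auto simp: \<alpha>_def)
    have "\<alpha> * s - (1 - \<alpha>) * t = \<alpha> * (s + t) - t" by (simp add: algebra_simps)
    also have "\<dots> = \<tau>" using st by (simp add: \<alpha>_def)
    finally have "(x, \<tau>) = \<alpha> *\<^sub>R (x, s) + (1 - \<alpha>) *\<^sub>R (x, - t)"
      by (simp flip: scaleR_add_left)
    then have "(x, \<tau>) \<in> hcone (x, s) (x, - t)"
      using a unfolding hcone_def by (smt (verit, best) mem_Collect_eq)
    then show "X \<in> hproj ` hcone (x, s) (x, - t)" using \<tau> by blast
  qed
  also have "{(x, \<tau>) | \<tau>. - t \<le> \<tau> \<and> \<tau> \<le> s} =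
      {(x, \<tau>) | \<tau>. 0 \<le> \<tau> \<and> \<tau> \<le> s} \<union> {(x, - \<tau>) | \<tau>. 0 \<le> \<tau> \<and> \<tau> \<le> t}"
  proof (intro equalityI subsetI)
    fix v assume "v \<in> {(x, \<tau>) | \<tau>. - t \<le> \<tau> \<and> \<tau> \<le> s}"
    then obtain \<tau> where \<tau>: "v = (x, \<tau>)" "- t \<le> \<tau>" "\<tau> \<le> s" by auto
    show "v \<in> {(x, \<tau>) | \<tau>. 0 \<le> \<tau> \<and> \<tau> \<le> s} \<union> {(x, - \<tau>) | \<tau>. 0 \<le> \<tau> \<and> \<tau> \<le> t}"
    proof (cases "0 \<le> \<tau>")
      case False
      then have "v = (x, - (- \<tau>))" "0 \<le> - \<tau>" "- \<tau> \<le> t" using \<tau> by auto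
      then show ?thesis by blast
    qed (use \<tau> in auto)
  qed (use st in auto)
  also have "hproj ` \<dots> = hproj ` {(x, \<tau>) | \<tau>. 0 \<le> \<tau> \<and> \<tau> \<le> s} \<union>
       hproj ` {(- x, \<tau>) | \<tau>. 0 \<le> \<tau> \<and> \<tau> \<le> t}"
  proof -
    have "hproj (x, - \<tau>) = hproj (- x, \<tau>)" for \<tau>
      using hproj_uminus[of "(- x, \<tau>)"] assms by (simp add: zero_prod_def)
    then have "hproj ` {(x, - \<tau>) | \<tau>. 0 \<le> \<tau> \<and> \<tau> \<le> t} = hproj ` {(- x, \<tau>) | \<tau>. 0 \<le> \<tau> \<and> \<tau> \<le> t}"
      by (force simp: image_iff)
    then show ?thesis by (simp add: image_Un)
  qed
  finally show ?thesis
    using hproj_ray[of x s] hproj_ray[of "- x" t] assms by (simp add: image_Un)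
qed

section \<open>Tetrahedral balls\<close>

definition orthant :: "hvec set" where
  "orthant = {w. (\<forall>i. 0 < fst w $ i) \<and> 0 < snd w}"

lemma embedding_map_compact_into_RP3:
  fixes f :: "'a::topological_space \<Rightarrow> (real ^ 3) set"
  assumes "compact K" "continuous_map (top_of_set K) RP3 f" "inj_on f K"
  shows "embedding_map (top_of_set K) RP3 f"
  using assms Hausdorff_RP3
  by (intro continuous_imp_embedding_map) (auto simp: compact_space_subtopology)

text \<open>
  An open simplicial cone is a copy of the positive orthant, and dividing by the last coordinate
  and taking logarithms identifies its projectivization with \<open>\<real>\<^sup>3\<close>.  A compact subset is contained
  in a Euclidean ball of some radius \<open>R\<close>, and the ball of radius \<open>2 R\<close> provides the collar.
\<close>

lemma embedded_ball_in_cone: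
  fixes F :: "hvec \<Rightarrow> hvec"
  assumes "linear F" "inj F" and K: "compact K" "\<And>v. v \<in> K \<Longrightarrow> F v \<in> orthant"
  obtains B where "embedded_ball B" "hproj ` K \<subseteq> B" "B \<subseteq> hproj ` {v. F v \<in> orthant}"
proof -
  obtain G where G: "linear G" "\<And>w. F (G w) = w" "\<And>v. G (F v) = v"
    using linear_injective_isomorphism[OF assms(1,2)] by auto
  define E :: "real ^ 3 \<Rightarrow> hvec" where "E y = G (\<chi> i. exp (y $ i), 1)" for y
  define Y :: "hvec \<Rightarrow> real ^ 3" where "Y v = (\<chi> i. ln (fst (F v) $ i / snd (F v)))" for v
  have FE: "F (E y) \<in> orthant" for y
    by (simp add: E_def G orthant_def)
  have E0: "E y \<noteq> 0" for y
    using FE[of y] linear_0[OF assms(1)] by (auto simp: orthant_def)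
  have contE: "continuous_on UNIV E"
    unfolding E_def
    by (intro linear_continuous_on_compose[OF _ G(1)] continuous_intros)
  have injE: "y = z" if "hproj (E y) = hproj (E z)" for y z
  proof -
    obtain c where c: "E y = c *\<^sub>R E z"
      using hproj_eqD[OF E0 E0 \<open>hproj (E y) = hproj (E z)\<close>] by metis
    then have "F (E y) = c *\<^sub>R F (E z)"
      using linear_cmul[OF assms(1)] by metis
    then have *: "(\<chi> i. exp (y $ i), 1 :: real) = c *\<^sub>R (\<chi> i. exp (z $ i), 1)"
      by (simp add: E_def G)
    then have "c = 1" by simp
    with * show ?thesis by (simp add: vec_eq_iff)
  qed
  have EY: "hproj (E (Y v)) = hproj v" if "F v \<in> orthant" for v
  proof -
    have pos: "0 < fst (F v) $ i" "0 < snd (F v)" for i using that by (auto simp: orthant_def)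
    have "(\<chi> i. exp (Y v $ i), 1) = (1 / snd (F v)) *\<^sub>R F v"
      using pos by (cases "F v") (auto simp: Y_def vec_eq_iff less_imp_neq[symmetric])
    then have "E (Y v) = (1 / snd (F v)) *\<^sub>R v"
      by (simp add: E_def linear_cmul[OF G(1)] G)
    then show ?thesis
      using pos(2) hproj_scaleR[of "1 / snd (F v)" v] linear_0[OF assms(1)] by fastforce
  qed
  have "continuous_on K (\<lambda>v. F v)"
    using assms(1) linear_continuous_on linear_linear by blast
  then have "continuous_on K Y"
    unfolding Y_def
    by (intro continuous_intros) (use K(2) in \<open>auto simp: orthant_def less_imp_neq[symmetric]\<close>)
  then have "compact (Y ` K)"
    using K(1) compact_continuous_image by blast
  then obtain R where R: "0 < R" "Y ` K \<subseteq> cball 0 R"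
    using compact_imp_bounded bounded_pos by (metis mem_cball_0 subsetI)
  \<comment> \<open>Scaling by \<open>R\<close> makes the unit ball contain the given compact set.\<close>
  define g where "g = hproj \<circ> E \<circ> (*\<^sub>R) R"
  have "continuous_on (cball 0 2) (\<lambda>y. E (R *\<^sub>R y))"
    by (rule continuous_on_compose2[OF contE]) (auto intro!: continuous_intros)
  then have "continuous_map (top_of_set (cball (0 :: real ^ 3) 2)) (top_of_set (- {0})) (E \<circ> (*\<^sub>R) R)"
    using E0 by (simp add: o_def image_subset_iff)
  then have "continuous_map (top_of_set (cball 0 2)) RP3 g"
    unfolding g_def comp_assoc by (rule continuous_map_compose[OF _ continuous_map_hproj])
  moreover have "inj_on g (cball 0 2)"
    using R(1) by (auto simp: inj_on_def g_def dest!: injE)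
  ultimately have "embedding_map (top_of_set (cball 0 2)) RP3 g"
    by (intro embedding_map_compact_into_RP3) auto
  then have h: "homeomorphic_map (top_of_set (cball 0 2)) (subtopology RP3 (g ` cball 0 2)) g"
    by (simp add: embedding_map_def)
  have sub: "g ` ball 0 2 \<subseteq> g ` cball 0 2" by (intro image_mono ball_subset_cball)
  moreover have "topspace (subtopology RP3 (g ` cball 0 2)) = g ` cball 0 2"
    using homeomorphic_imp_surjective_map[OF h, symmetric] by (simp only: topspace_euclidean_subtopology)
  ultimately have "homeomorphic_map (subtopology (top_of_set (cball 0 2)) (ball 0 2))
      (subtopology (subtopology RP3 (g ` cball 0 2)) (g ` ball 0 2)) g"
    by (intro homeomorphic_map_subtopologies[OF h])
      (simp only: topspace_euclidean_subtopology Int_absorb1 Int_absorb2 ball_subset_cball)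
  then have "embedding_map (top_of_set (ball 0 2)) RP3 g"
    using sub
    by (simp only: embedding_map_def subtopology_subtopology topspace_euclidean_subtopology
        Int_absorb1 ball_subset_cball)
  then have "embedded_ball (g ` cball 0 1)"
    unfolding embedded_ball_def by blast
  moreover have "hproj ` K \<subseteq> g ` cball 0 1"
  proof (intro image_subsetI)
    fix v assume "v \<in> K"
    then have "norm (Y v) \<le> R" using R(2) by auto
    then have "Y v /\<^sub>R R \<in> cball 0 1" using R(1) by (simp add: field_simps)
    moreover have "g (Y v /\<^sub>R R) = hproj v"
      using R(1) EY K(2)[OF \<open>v \<in> K\<close>] by (simp add: g_def)
    ultimately show "hproj v \<in> g ` cball 0 1" by (metis imageI)
  qed
  moreover have "g ` cball 0 1 \<subseteq> hproj ` {v. F v \<in> orthant}"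
    using FE by (auto simp: g_def)
  ultimately show ?thesis by (rule that)
qed

section \<open>Integer data for drawings\<close>

type_synonym ipt = "int \<times> int \<times> int \<times> int"
text \<open>
  An arc \<open>(u, v, p, m, r)\<close> is an edge between \<open>u\<close> and \<open>v\<close> with chosen lifts \<open>p\<close> and \<open>r\<close> of its ends; the
  path runs straight from \<open>p\<close> to \<open>r\<close>, or from \<open>p\<close> via the bend \<open>m\<close> to \<open>r\<close>.  An edge crosses infinity
  when its lifts are not the standard ones of its ends.  A piece is one of the segments of an
  arc; its ends carry the graph vertex, or no label at a bend.
\<close>

type_synonym 'v arc = "'v \<times> 'v \<times> ipt \<times> ipt option \<times> ipt"
type_synonym 'v piece = "('v option \<times> ipt) \<times> ('v option \<times> ipt)"

text \<open>
  The factor \<open>8\<close> keeps the integers small: with it, all points that are used lie in the flat part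
  of the unit sphere of \<open>hnorm\<close>.
\<close>

fun hv :: "ipt \<Rightarrow> hvec" where
  "hv (a, b, c, d) = (vector [real_of_int a, real_of_int b, real_of_int c], 8 * real_of_int d)"

fun ineg :: "ipt \<Rightarrow> ipt" where "ineg (a, b, c, d) = (- a, - b, - c, - d)"

fun idot :: "ipt \<Rightarrow> ipt \<Rightarrow> int" where
  "idot (a, b, c, d) (a', b', c', d') = a * a' + b * b' + c * c' + d * d'"

fun hdot :: "ipt \<Rightarrow> hvec \<Rightarrow> real" where
  "hdot (a, b, c, d) (x, t) = a * x $ 1 + b * x $ 2 + c * x $ 3 + d * (t / 8)"

text \<open>
  Written as a Laplace expansion along two rows and generic in the ring, since it is evaluated on
  integers and used over the reals.
\<close>

fun det4 :: "'a \<times> 'a \<times> 'a \<times> 'a \<Rightarrow> 'a \<times> 'a \<times> 'a \<times> 'a \<Rightarrow> 'a \<times> 'a \<times> 'a \<times> 'a \<Rightarrow>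
    'a \<times> 'a \<times> 'a \<times> 'a \<Rightarrow> 'a :: comm_ring_1" where
  "det4 (a1, a2, a3, a4) (b1, b2, b3, b4) (c1, c2, c3, c4) (d1, d2, d3, d4) =
     (a1 * b2 - a2 * b1) * (c3 * d4 - c4 * d3) - (a1 * b3 - a3 * b1) * (c2 * d4 - c4 * d2)
   + (a1 * b4 - a4 * b1) * (c2 * d3 - c3 * d2) + (a2 * b3 - a3 * b2) * (c1 * d4 - c4 * d1)
   - (a2 * b4 - a4 * b2) * (c1 * d3 - c3 * d1) + (a3 * b4 - a4 * b3) * (c1 * d2 - c2 * d1)"

lemma det4_swap:
  "det4 b a c d = - det4 a b c d" "det4 c b a d = - det4 a b c d" "det4 d b c a = - det4 a b c d"
  by (cases a; cases b; cases c; cases d; simp add: algebra_simps)+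

lemma det4_transpose:
  "det4 (a1, b1, c1, d1) (a2, b2, c2, d2) (a3, b3, c3, d3) (a4, b4, c4, d4) =
   det4 (a1, a2, a3, a4) (b1, b2, b3, b4) (c1, c2, c3, c4) (d1, d2, d3, d4)"
  by (simp add: algebra_simps)

lemma det4_cramer_first:
  assumes "x * a1 + y * b1 + z * c1 + w * d1 = 0" "x * a2 + y * b2 + z * c2 + w * d2 = 0"
    "x * a3 + y * b3 + z * c3 + w * d3 = 0" "x * a4 + y * b4 + z * c4 + w * d4 = 0"
  shows "x * det4 (a1, a2, a3, a4) (b1, b2, b3, b4) (c1, c2, c3, c4) (d1, d2, d3, d4) = 0"
   (is "x * ?D = 0")
proof -
  have "x * ?D =
     (x * a1 + y * b1 + z * c1 + w * d1) * (b2 * (c3 * d4 - c4 * d3) - b3 * (c2 * d4 - c4 * d2) + b4 * (c2 * d3 - c3 * d2))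
   - (x * a2 + y * b2 + z * c2 + w * d2) * (b1 * (c3 * d4 - c4 * d3) - b3 * (c1 * d4 - c4 * d1) + b4 * (c1 * d3 - c3 * d1))
   + (x * a3 + y * b3 + z * c3 + w * d3) * (b1 * (c2 * d4 - c4 * d2) - b2 * (c1 * d4 - c4 * d1) + b4 * (c1 * d2 - c2 * d1))
   - (x * a4 + y * b4 + z * c4 + w * d4) * (b1 * (c2 * d3 - c3 * d2) - b2 * (c1 * d3 - c3 * d1) + b3 * (c1 * d2 - c2 * d1))"
    by (simp add: algebra_simps)
  then show ?thesis using assms by simp
qed

lemma det4_cramer:
  assumes eqs: "x * a1 + y * b1 + z * c1 + w * d1 = 0" "x * a2 + y * b2 + z * c2 + w * d2 = 0"
    "x * a3 + y * b3 + z * c3 + w * d3 = 0" "x * a4 + y * b4 + z * c4 + w * d4 = 0"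
    and nz: "det4 (a1, a2, a3, a4) (b1, b2, b3, b4) (c1, c2, c3, c4) (d1, d2, d3, d4) \<noteq> (0 :: 'a :: idom)"
  shows "x = 0 \<and> y = 0 \<and> z = 0 \<and> w = 0"
proof -
  let ?a = "(a1, a2, a3, a4)" and ?b = "(b1, b2, b3, b4)" and ?c = "(c1, c2, c3, c4)"
    and ?d = "(d1, d2, d3, d4)"
  have "x * det4 ?a ?b ?c ?d = 0"
    by (rule det4_cramer_first) (use eqs in \<open>simp_all only: ac_simps\<close>)
  moreover have "y * det4 ?b ?a ?c ?d = 0"
    by (rule det4_cramer_first[of y b1 x a1 z c1 w d1]) (use eqs in \<open>simp_all only: ac_simps\<close>)
  moreover have "z * det4 ?c ?b ?a ?d = 0"
    by (rule det4_cramer_first[of z c1 y b1 x a1 w d1]) (use eqs in \<open>simp_all only: ac_simps\<close>)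
  moreover have "w * det4 ?d ?b ?c ?a = 0"
    by (rule det4_cramer_first[of w d1 y b1 z c1 x a1]) (use eqs in \<open>simp_all only: ac_simps\<close>)
  ultimately show ?thesis
    using nz unfolding det4_swap(1)[of ?b] det4_swap(2)[of ?c] det4_swap(3)[of ?d] by (simp del: det4.simps)
qed

definition units :: "ipt list" where
  "units = [(0,0,1,0), (1,0,0,0), (0,1,0,0), (0,0,0,1)]"

definition indep3 :: "ipt \<Rightarrow> ipt \<Rightarrow> ipt \<Rightarrow> bool" where
  "indep3 a b c \<longleftrightarrow> list_ex (\<lambda>w. det4 a b c w \<noteq> 0) units"

definition indep2 :: "ipt \<Rightarrow> ipt \<Rightarrow> bool" where
  "indep2 a b \<longleftrightarrow> list_ex (\<lambda>w. indep3 a b w) units"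

lemma hv_ineg: "hv (ineg p) = - hv p"
  by (cases p) (simp add: vec_eq_iff forall_3)

lemma idot_ineg: "idot k (ineg p) = - idot k p"
  by (cases k; cases p) simp

lemma hdot_hv: "hdot k (hv p) = real_of_int (idot k p)"
  by (cases k; cases p) simp

lemma linear_hdot: "linear (hdot k)"
proof (cases k)
  case (fields a b c d)
  show ?thesis
    unfolding fields by (rule linearI) (auto simp: algebra_simps add_divide_distrib)
qed

lemmas hdot_linear = linear_add[OF linear_hdot] linear_cmul[OF linear_hdot] linear_neg[OF linear_hdot]

lemma det4_independent:
  assumes "det4 a b c d \<noteq> 0" "\<alpha> *\<^sub>R hv a + \<beta> *\<^sub>R hv b + \<gamma> *\<^sub>R hv c + \<delta> *\<^sub>R hv d = 0"
  shows "\<alpha> = 0 \<and> \<beta> = 0 \<and> \<gamma> = 0 \<and> \<delta> = 0"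
proof -
  obtain a1 a2 a3 a4 where a: "a = (a1, a2, a3, a4)" by (cases a)
  obtain b1 b2 b3 b4 where b: "b = (b1, b2, b3, b4)" by (cases b)
  obtain c1 c2 c3 c4 where c: "c = (c1, c2, c3, c4)" by (cases c)
  obtain d1 d2 d3 d4 where d: "d = (d1, d2, d3, d4)" by (cases d)
  have eqs: "\<alpha> * a1 + \<beta> * b1 + \<gamma> * c1 + \<delta> * d1 = 0" "\<alpha> * a2 + \<beta> * b2 + \<gamma> * c2 + \<delta> * d2 = 0"
    "\<alpha> * a3 + \<beta> * b3 + \<gamma> * c3 + \<delta> * d3 = 0" "\<alpha> * a4 + \<beta> * b4 + \<gamma> * c4 + \<delta> * d4 = 0"
    using assms(2) by (auto simp: a b c d zero_prod_def vec_eq_iff forall_3)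
  have "real_of_int (det4 a b c d) \<noteq> 0" using assms(1) by simp
  then have "det4 (real_of_int a1, real_of_int a2, real_of_int a3, real_of_int a4)
        (real_of_int b1, real_of_int b2, real_of_int b3, real_of_int b4)
        (real_of_int c1, real_of_int c2, real_of_int c3, real_of_int c4)
        (real_of_int d1, real_of_int d2, real_of_int d3, real_of_int d4) \<noteq> 0"
    by (simp add: a b c d)
  then show ?thesis by (rule det4_cramer[OF eqs])
qed

lemma indep3_independent:
  assumes "indep3 a b c" "\<alpha> *\<^sub>R hv a + \<beta> *\<^sub>R hv b + \<gamma> *\<^sub>R hv c = 0"
  shows "\<alpha> = 0 \<and> \<beta> = 0 \<and> \<gamma> = 0"
proof -
  obtain w where "det4 a b c w \<noteq> 0" using assms(1) by (auto simp: indep3_def list_ex_iff)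
  then show ?thesis using det4_independent[of a b c w \<alpha> \<beta> \<gamma> 0] assms(2) by simp
qed

lemma indep2_independent:
  assumes "indep2 a b" "\<alpha> *\<^sub>R hv a + \<beta> *\<^sub>R hv b = 0"
  shows "\<alpha> = 0 \<and> \<beta> = 0"
proof -
  obtain w where "indep3 a b w" using assms(1) by (auto simp: indep2_def list_ex_iff)
  then show ?thesis using indep3_independent[of a b w \<alpha> \<beta> 0] assms(2) by simp
qed

fun pieces :: "'v arc \<Rightarrow> 'v piece list" where
  "pieces (u, v, p, None, r) = [((Some u, p), (Some v, r))]"
| "pieces (u, v, p, Some m, r) = [((Some u, p), (None, m)), ((None, m), (Some v, r))]"

text \<open>
  On a bent arc \<open>min (x u) (x v)\<close> is the weight of the bend: subtracting it from both end weights
  leaves a combination of the bend and one end.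
\<close>

fun trail :: "'v arc \<Rightarrow> ('v \<Rightarrow> real) \<Rightarrow> hvec" where
  "trail (u, v, p, m, r) x = x u *\<^sub>R hv p + x v *\<^sub>R hv r +
     (case m of None \<Rightarrow> 0 | Some m \<Rightarrow> min (x u) (x v) *\<^sub>R (hv m - hv p - hv r))"

fun extent :: "'v arc \<Rightarrow> ('v \<Rightarrow> real) set" where
  "extent (u, v, _) = {x. (\<forall>w. 0 \<le> x w) \<and> (\<forall>w. w \<notin> {u, v} \<longrightarrow> x w = 0) \<and> x u + x v = 1}"

definition vert :: "'v \<Rightarrow> 'v \<Rightarrow> real" where "vert w = (\<lambda>z. if z = w then 1 else 0)"

fun ends :: "'v arc \<Rightarrow> 'v set" where "ends (u, v, _) = {u, v}"

text \<open>
  Segments in a common plane are kept apart by a linear form instead of a determinant.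
\<close>

definition divided :: "ipt list \<Rightarrow> ipt \<Rightarrow> ipt \<Rightarrow> ipt \<Rightarrow> ipt \<Rightarrow> bool" where
  "divided H a b c d \<longleftrightarrow>
     list_ex (\<lambda>k. 0 < idot k a \<and> 0 < idot k b \<and> idot k c \<le> 0 \<and> idot k d \<le> 0) H"

text \<open>
  Two pieces with a common labelled end meet in that end only if the three vectors are
  independent; two others are disjoint if their four ends are independent, or if linear
  forms separate the lifts of the first piece from both lifts of the second.
\<close>

fun apart :: "ipt list \<Rightarrow> 'v piece \<Rightarrow> 'v piece \<Rightarrow> bool" where
  "apart H ((la, a), (lb, b)) ((lc, c), (ld, d)) \<longleftrightarrow>
     (if la \<noteq> None \<and> la = lc then indep3 a b d
      else if la \<noteq> None \<and> la = ld then indep3 a b c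
      else if lb \<noteq> None \<and> lb = lc then indep3 a b d
      else if lb \<noteq> None \<and> lb = ld then indep3 a b c
      else det4 a b c d \<noteq> 0 \<or> divided H a b c d \<and> divided H a b (ineg c) (ineg d))"

fun nondegenerate :: "'v arc \<Rightarrow> bool" where
  "nondegenerate (u, v, p, None, r) \<longleftrightarrow> indep2 p r"
| "nondegenerate (u, v, p, Some m, r) \<longleftrightarrow> indep3 p m r"

fun central :: "ipt \<Rightarrow> bool" where
  "central (a, b, c, d) \<longleftrightarrow> a * a + b * b + c * c \<le> 16 * (d * d)"

fun tame_piece :: "'v piece \<Rightarrow> bool" where
  "tame_piece ((_, a1, a2, a3, a4), (_, b1, b2, b3, b4)) \<longleftrightarrow>
     central (a1, a2, a3, a4) \<and> central (b1, b2, b3, b4) \<and>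
     (0 < a4 \<and> 0 < b4 \<or> a4 < 0 \<and> b4 < 0 \<or>
      0 < a4 \<and> b4 < 0 \<and> (a1, a2, a3) = (b1, b2, b3) \<and> (a1, a2, a3) \<noteq> (0, 0, 0))"

lemma extent_ext:
  assumes "u \<noteq> v" "x \<in> extent (u, v, p, m, r)" "y \<in> extent (u, v, p, m, r)" "x u = y u"
  shows "x = y"
proof
  fix w
  have "x v = y v" using assms by auto
  then show "x w = y w" using assms by (cases "w \<in> {u, v}") auto
qed

lemma extent_cases:
  assumes "u \<noteq> v" "x \<in> extent (u, v, p, m, r)"
  shows "0 \<le> x u" "0 \<le> x v" "x u + x v = 1"
  using assms by auto

lemma extent_vert: "u \<noteq> v \<Longrightarrow> x \<in> extent (u, v, p, m, r) \<Longrightarrow> x v = 0 \<Longrightarrow> x = vert u"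
  "u \<noteq> v \<Longrightarrow> x \<in> extent (u, v, p, m, r) \<Longrightarrow> x u = 0 \<Longrightarrow> x = vert v"
  by (auto simp: fun_eq_iff vert_def)

text \<open>
  The two conditions at the end locate graph vertices: a point at a labelled end of a piece
  is that vertex.
\<close>

lemma trail_piece:
  assumes uv: "u \<noteq> v" and x: "x \<in> extent (u, v, p, m, r)"
  obtains la a lb b \<alpha> \<beta> where "((la, a), (lb, b)) \<in> set (pieces (u, v, p, m, r))"
    "0 \<le> \<alpha>" "0 \<le> \<beta>" "0 < \<alpha> + \<beta>" "trail (u, v, p, m, r) x = \<alpha> *\<^sub>R hv a + \<beta> *\<^sub>R hv b"
    "\<And>w. \<beta> = 0 \<Longrightarrow> la = Some w \<Longrightarrow> x = vert w" "\<And>w. \<alpha> = 0 \<Longrightarrow> lb = Some w \<Longrightarrow> x = vert w"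
proof (cases m)
  case None
  show ?thesis
    by (rule that[of "Some u" p "Some v" r "x u" "x v"])
       (use None extent_cases[OF uv x] extent_vert[OF uv x] in auto)
next
  case (Some m')
  note dc = extent_cases[OF uv x]
  show ?thesis
  proof (cases "x v \<le> x u")
    case True
    show ?thesis
    proof (rule that[of "Some u" p None m' "x u - x v" "x v"])
      show "trail (u, v, p, m, r) x = (x u - x v) *\<^sub>R hv p + x v *\<^sub>R hv m'"
        using Some True by (simp add: algebra_simps)
    qed (use Some True dc extent_vert[OF uv x] in auto)
  next
    case False
    show ?thesis
    proof (rule that[of None m' "Some v" r "x u" "x v - x u"])
      show "trail (u, v, p, m, r) x = x u *\<^sub>R hv m' + (x v - x u) *\<^sub>R hv r"
        using Some False by (simp add: algebra_simps)
    qed (use Some False dc extent_vert[OF uv x] in auto)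
  qed
qed

definition edge_point :: "'v \<Rightarrow> 'v \<Rightarrow> real \<Rightarrow> 'v \<Rightarrow> real" where
  "edge_point u v s = (\<lambda>w. if w = u then 1 - s else if w = v then s else 0)"

lemma extent_eq: "u \<noteq> v \<Longrightarrow> extent (u, v, p, m, r) = edge_point u v ` {0..1}"
proof (intro equalityI subsetI)
  fix x assume uv: "u \<noteq> v" and x: "x \<in> extent (u, v, p, m, r)"
  have "x v \<in> {0..1}" using extent_cases[OF uv x] by auto
  moreover from this have "edge_point u v (x v) \<in> extent (u, v, p, m, r)" using uv by (auto simp: edge_point_def)
  moreover have "x u = edge_point u v (x v) u" using extent_cases[OF uv x] by (simp add: edge_point_def)
  ultimately have "x = edge_point u v (x v)" "x v \<in> {0..1}"
    using extent_ext[OF uv x] by auto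
  then show "x \<in> edge_point u v ` {0..1}" by blast
qed (auto simp: edge_point_def)

lemma compact_extent:
  assumes "u \<noteq> v"
  shows "compact (extent (u, v, p, m, r))"
proof -
  have "continuous_on {0..1} (edge_point u v)"
  proof (rule continuous_on_coordinatewise_then_product)
    show "continuous_on {0..1} (\<lambda>s. edge_point u v s i)" for i
      by (cases "i = u"; cases "i = v") (auto simp: edge_point_def intro!: continuous_intros)
  qed
  then have "compact (edge_point u v ` {0..1})" by (rule compact_continuous_image) simp
  then show ?thesis by (simp only: extent_eq[OF assms])
qed

lemma continuous_on_trail: "continuous_on X (trail e)"
proof -
  obtain u v p m r where e: "e = (u, v, p, m, r)" by (cases e)
  have c: "continuous_on X (\<lambda>x. x w)" for w :: 'a
    by (rule continuous_on_subset[OF continuous_on_product_coordinates]) simp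
  show ?thesis
    unfolding e trail.simps by (cases m) (auto intro!: continuous_intros c)
qed

lemma hcone_scale:
  assumes "0 \<le> \<alpha>" "0 \<le> \<beta>" "0 < \<alpha> + \<beta>"
  shows "\<alpha> *\<^sub>R a + \<beta> *\<^sub>R b \<in> hcone a b"
  using assms unfolding hcone_def by blast

lemma trail_nonzero:
  assumes "u \<noteq> v" "nondegenerate (u, v, p, m, r)" "x \<in> extent (u, v, p, m, r)"
  shows "trail (u, v, p, m, r) x \<noteq> 0"
proof
  assume 0: "trail (u, v, p, m, r) x = 0"
  note d = extent_cases[OF assms(1,3)]
  show False
  proof (cases m)
    case None
    then have "x u = 0 \<and> x v = 0" using indep2_independent[of p r "x u" "x v"] 0 assms(2) by simp
    then show False using d by simp
  next
    case (Some m')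
    then have "(x u - min (x u) (x v)) *\<^sub>R hv p + min (x u) (x v) *\<^sub>R hv m' + (x v - min (x u) (x v)) *\<^sub>R hv r = 0"
      using 0 by (simp add: algebra_simps)
    moreover have "indep3 p m' r" using assms(2) Some by simp
    ultimately have "x u - min (x u) (x v) = 0" "min (x u) (x v) = 0" "x v - min (x u) (x v) = 0"
      using indep3_independent by blast+
    then show False using d by linarith
  qed
qed

lemma trail_injective:
  assumes uv: "u \<noteq> v" and n: "nondegenerate (u, v, p, m, r)"
    and x: "x \<in> extent (u, v, p, m, r)" and y: "y \<in> extent (u, v, p, m, r)"
    and eq: "trail (u, v, p, m, r) x = c *\<^sub>R trail (u, v, p, m, r) y"
  shows "x = y"
proof -
  note dx = extent_cases[OF uv x] and dy = extent_cases[OF uv y]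
  have "x u = y u \<and> x v = y v"
  proof (cases m)
    case None
    then have "(x u - c * y u) *\<^sub>R hv p + (x v - c * y v) *\<^sub>R hv r = 0"
      using eq by (simp add: algebra_simps)
    then have *: "x u = c * y u" "x v = c * y v"
      using indep2_independent[of p r "x u - c * y u" "x v - c * y v"] n None by auto
    then have "c * (y u + y v) = 1" using dx by (simp add: distrib_left)
    then show ?thesis using * dy by simp
  next
    case (Some m')
    define i j where "i = min (x u) (x v)" and "j = min (y u) (y v)"
    have "(x u - i - c * (y u - j)) *\<^sub>R hv p + (i - c * j) *\<^sub>R hv m' + (x v - i - c * (y v - j)) *\<^sub>R hv r = 0"
      using eq Some by (simp add: algebra_simps i_def j_def)
    then have *: "x u - i = c * (y u - j)" "i = c * j" "x v - i = c * (y v - j)"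
      using indep3_independent[of p m' r "x u - i - c * (y u - j)" "i - c * j" "x v - i - c * (y v - j)"]
        n Some by auto
    have "c * (y u + y v) = c * (y u - j) + c * (y v - j) + 2 * (c * j)" by (simp add: algebra_simps)
    also have "\<dots> = x u + x v" unfolding *(1,3)[symmetric] *(2)[symmetric] by simp
    finally have "c = 1" using dx dy by simp
    then show ?thesis using * by simp
  qed
  then show ?thesis using extent_ext[OF uv x y] by simp
qed

lemma norm_vector_3_le:
  assumes "central (a, b, c, d)"
  shows "norm (vector [real_of_int a, real_of_int b, real_of_int c] :: real ^ 3) \<le> 4 * \<bar>real_of_int d\<bar>"
proof -
  have "real_of_int (a * a + b * b + c * c) \<le> real_of_int (16 * (d * d))"
    using assms by (simp only: central.simps of_int_le_iff)
  then have "norm (vector [real_of_int a, real_of_int b, real_of_int c] :: real ^ 3)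
      \<le> sqrt ((4 * real_of_int d)\<^sup>2)"
    unfolding norm_vec_def L2_set_def sum_3
    by (intro real_sqrt_le_mono) (simp add: power2_eq_square)
  then show ?thesis by (simp only: real_sqrt_abs abs_mult abs_numeral)
qed

lemma hproj_hcone_neg:
  assumes "0 \<notin> hcone a b"
  shows "hproj ` hcone (- a) (- b) = hproj ` hcone a b"
proof -
  have neg: "- v \<in> hcone (- a) (- b)" if mem: "v \<in> hcone a b" for a b v
  proof -
    obtain \<alpha> \<beta> where v: "v = \<alpha> *\<^sub>R a + \<beta> *\<^sub>R b" "0 \<le> \<alpha>" "0 \<le> \<beta>" "0 < \<alpha> + \<beta>"
      using mem unfolding hcone_def by blast
    then have "- v = \<alpha> *\<^sub>R (- a) + \<beta> *\<^sub>R (- b)" by simp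
    then show ?thesis using hcone_scale[OF v(2-4)] by metis
  qed
  then have "hcone (- a) (- b) = uminus ` hcone a b"
  proof (intro equalityI subsetI)
    fix v assume "v \<in> hcone (- a) (- b)"
    then have "- v \<in> hcone a b" using neg[of v "- a" "- b"] by simp
    then show "v \<in> uminus ` hcone a b" by (metis imageI minus_minus)
  qed (use neg in blast)
  moreover have "hproj (- v) = hproj v" if "v \<in> hcone a b" for v
    using that assms hproj_uminus by metis
  ultimately show ?thesis by (simp only: image_image cong: image_cong)
qed

lemma polygonal_Un: "polygonal A \<Longrightarrow> polygonal B \<Longrightarrow> polygonal (A \<union> B)"
proof -
  assume "polygonal A" "polygonal B"
  then obtain S T where "finite S" "S \<subseteq> D3 \<times> D3" "A = proj ` (\<Union>(a, b) \<in> S. closed_segment a b)"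
    "finite T" "T \<subseteq> D3 \<times> D3" "B = proj ` (\<Union>(a, b) \<in> T. closed_segment a b)"
    unfolding polygonal_def by auto
  then show ?thesis
    unfolding polygonal_def by (intro exI[of _ "S \<union> T"]) auto
qed

lemma polygonal_segment: "a \<in> D3 \<Longrightarrow> b \<in> D3 \<Longrightarrow> polygonal (proj ` closed_segment a b)"
  unfolding polygonal_def by (intro exI[of _ "{(a, b)}"]) auto

lemma polygonal_UN: "finite I \<Longrightarrow> (\<And>i. i \<in> I \<Longrightarrow> polygonal (A i)) \<Longrightarrow> polygonal (\<Union>i\<in>I. A i)"
proof (induction I rule: finite_induct)
  case empty
  then show ?case unfolding polygonal_def by (intro exI[of _ "{}"]) auto
next
  case (insert i I)
  then show ?case by (auto intro!: polygonal_Un)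
qed

section \<open>Separating tetrahedra\<close>

definition all_pos :: "ipt list \<Rightarrow> ipt list \<Rightarrow> bool" where
  "all_pos M ps \<longleftrightarrow> list_all (\<lambda>k. list_all (\<lambda>p. 0 < idot k p) ps) M"

fun controls :: "'v arc \<Rightarrow> ipt list" where
  "controls (u, v, p, None, r) = [p, r]"
| "controls (u, v, p, Some m, r) = [p, m, r]"

definition beyond :: "ipt list \<Rightarrow> ipt \<Rightarrow> ipt \<Rightarrow> bool" where
  "beyond M a b \<longleftrightarrow> list_ex (\<lambda>k. idot k a \<le> 0 \<and> idot k b \<le> 0) M"

definition encloses :: "ipt list \<Rightarrow> 'v arc \<Rightarrow> bool" where
  "encloses M e \<longleftrightarrow> all_pos M (controls e) \<or> all_pos M (map ineg (controls e))"

text \<open>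
  A tetrahedron is convex in both lifts, so a segment misses it if one face plane has the
  segment on its outer side; both lifts of the segment have to be tested.
\<close>

definition avoids :: "ipt list \<Rightarrow> 'v arc \<Rightarrow> bool" where
  "avoids M e \<longleftrightarrow>
     list_all (\<lambda>((_, a), (_, b)). beyond M a b \<and> beyond M (ineg a) (ineg b)) (pieces e)"

fun simplicial :: "ipt list \<Rightarrow> bool" where
  "simplicial [k1, k2, k3, k4] \<longleftrightarrow> det4 k1 k2 k3 k4 \<noteq> 0"
| "simplicial _ \<longleftrightarrow> False"

text \<open>
  The certificate \<open>(S, M)\<close>: the tetrahedron given by the forms \<open>M\<close> contains the subgraph induced
  by \<open>S\<close> and misses the subgraph induced by the complement.  Edges between the two may
  do anything, since they belong to no component that is sorted to one side.
\<close>

fun separates :: "'v arc list \<Rightarrow> 'v list \<times> ipt list \<Rightarrow> bool" where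
  "separates D (S, M) \<longleftrightarrow> simplicial M \<and>
     list_all (\<lambda>(u, v, a).
       (if List.member S u then List.member S v \<longrightarrow> encloses M (u, v, a)
        else \<not> List.member S v \<longrightarrow> avoids M (u, v, a))) D"

definition coords :: "ipt \<Rightarrow> ipt \<Rightarrow> ipt \<Rightarrow> ipt \<Rightarrow> hvec \<Rightarrow> hvec" where
  "coords k1 k2 k3 k4 v = (vector [hdot k1 v, hdot k2 v, hdot k3 v], hdot k4 v)"

lemma linear_coords: "linear (coords k1 k2 k3 k4)"
  by (rule linearI) (simp_all add: coords_def hdot_linear vec_eq_iff forall_3)

lemma coords_orthant:
  "coords k1 k2 k3 k4 v \<in> orthant \<longleftrightarrow> (\<forall>k \<in> set [k1, k2, k3, k4]. 0 < hdot k v)"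
  by (auto simp: coords_def orthant_def forall_3)

lemma inj_coords:
  assumes "det4 k1 k2 k3 k4 \<noteq> 0"
  shows "inj (coords k1 k2 k3 k4)"
proof -
  obtain a1 a2 a3 a4 where a: "k1 = (a1, a2, a3, a4)" by (cases k1)
  obtain b1 b2 b3 b4 where b: "k2 = (b1, b2, b3, b4)" by (cases k2)
  obtain c1 c2 c3 c4 where c: "k3 = (c1, c2, c3, c4)" by (cases k3)
  obtain d1 d2 d3 d4 where d: "k4 = (d1, d2, d3, d4)" by (cases k4)
  have "v = 0" if "coords k1 k2 k3 k4 v = 0" for v
  proof -
    obtain x t where v: "v = (x, t)" by (cases v)
    have eqs: "x $ 1 * a1 + x $ 2 * a2 + x $ 3 * a3 + (t / 8) * a4 = 0"
      "x $ 1 * b1 + x $ 2 * b2 + x $ 3 * b3 + (t / 8) * b4 = 0"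
      "x $ 1 * c1 + x $ 2 * c2 + x $ 3 * c3 + (t / 8) * c4 = 0"
      "x $ 1 * d1 + x $ 2 * d2 + x $ 3 * d3 + (t / 8) * d4 = 0"
      using that by (auto simp: coords_def a b c d v zero_prod_def vec_eq_iff forall_3 mult.commute)
    have "real_of_int (det4 k1 k2 k3 k4) \<noteq> 0" using assms by simp
    then have "det4 (real_of_int a1, real_of_int a2, real_of_int a3, real_of_int a4)
        (real_of_int b1, real_of_int b2, real_of_int b3, real_of_int b4)
        (real_of_int c1, real_of_int c2, real_of_int c3, real_of_int c4)
        (real_of_int d1, real_of_int d2, real_of_int d3, real_of_int d4) \<noteq> 0"
      by (simp add: a b c d)
    then have "det4 (real_of_int a1, real_of_int b1, real_of_int c1, real_of_int d1)
        (real_of_int a2, real_of_int b2, real_of_int c2, real_of_int d2)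
        (real_of_int a3, real_of_int b3, real_of_int c3, real_of_int d3)
        (real_of_int a4, real_of_int b4, real_of_int c4, real_of_int d4) \<noteq> 0"
      by (subst det4_transpose)
    from det4_cramer[OF eqs this] show ?thesis
      by (simp add: v zero_prod_def vec_eq_iff forall_3)
  qed
  then show ?thesis by (rule linear_injective_0[OF linear_coords, THEN iffD2, rule_format])
qed

lemma conic_pos:
  fixes \<alpha> \<beta> :: real
  assumes "0 \<le> \<alpha>" "0 \<le> \<beta>" "0 < \<alpha> + \<beta>" "0 < a" "0 < b"
  shows "0 < \<alpha> * a + \<beta> * b"
proof (cases "\<alpha> = 0")
  case False
  then have "0 < \<alpha> * a" "0 \<le> \<beta> * b" using assms by auto
  then show ?thesis by linarith
qed (use assms in simp)

lemma hdot_trail_pos: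
  assumes "u \<noteq> v" "x \<in> extent (u, v, p, m, r)" "\<And>q. q \<in> set (controls (u, v, p, m, r)) \<Longrightarrow> 0 < s * hdot k (hv q)"
  shows "0 < s * hdot k (trail (u, v, p, m, r) x)"
proof -
  obtain la a lb b \<alpha> \<beta> where *: "((la, a), (lb, b)) \<in> set (pieces (u, v, p, m, r))"
    "0 \<le> \<alpha>" "0 \<le> \<beta>" "0 < \<alpha> + \<beta>" "trail (u, v, p, m, r) x = \<alpha> *\<^sub>R hv a + \<beta> *\<^sub>R hv b"
    by (rule trail_piece[OF assms(1,2)])
  have "a \<in> set (controls (u, v, p, m, r))" "b \<in> set (controls (u, v, p, m, r))"
    using *(1) by (cases m; auto)+
  then have pos: "0 < s * hdot k (hv a)" "0 < s * hdot k (hv b)" using assms(3) by auto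
  have "s * hdot k (trail (u, v, p, m, r) x) = \<alpha> * (s * hdot k (hv a)) + \<beta> * (s * hdot k (hv b))"
    unfolding *(5) by (simp add: hdot_linear algebra_simps)
  also have "0 < \<dots>"
    using pos *(2-4)
    by (intro conic_pos)
  finally show ?thesis .
qed

lemma trail_bent:
  "x v \<le> x u \<Longrightarrow> trail (u, v, p, Some m, r) x = (x u - x v) *\<^sub>R hv p + x v *\<^sub>R hv m"
  "x u \<le> x v \<Longrightarrow> trail (u, v, p, Some m, r) x = x u *\<^sub>R hv m + (x v - x u) *\<^sub>R hv r"
  by (simp_all add: algebra_simps)

lemma closed_extent: "closed (extent (u, v, p, m, r))"
proof -
  have c: "continuous_on UNIV (\<lambda>x :: 'a \<Rightarrow> real. x w)" for w
    by (rule continuous_on_product_coordinates)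
  have "closed {x. (0 :: real) \<le> x w}" for w :: 'a
    by (rule closed_Collect_le[OF continuous_on_const c])
  moreover have "closed {x. w \<notin> {u, v} \<longrightarrow> x w = (0 :: real)}" for w :: 'a
  proof (cases "w \<in> {u, v}")
    case False
    then show ?thesis using closed_Collect_eq[OF c continuous_on_const, of w 0] by simp
  qed simp
  moreover have "closed {x. x u + x v = (1 :: real)}"
    by (rule closed_Collect_eq[OF continuous_on_add[OF c c] continuous_on_const])
  ultimately show ?thesis
    unfolding extent.simps by (intro closed_Collect_conj closed_Collect_all)
qed

section \<open>Drawings and their embeddings\<close>

locale drawing =
  fixes G :: "'v graph" and P :: "'v \<Rightarrow> ipt" and D :: "'v arc list" and H :: "ipt list"
  assumes placed: "\<And>u v p m r. (u, v, p, m, r) \<in> set D \<Longrightarrow>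
      u \<noteq> v \<and> p \<in> {P u, ineg (P u)} \<and> r \<in> {P v, ineg (P v)}"
    and edges: "snd G = ends ` set D"
    and verts: "fst G = \<Union> (ends ` set D)"
    and nondeg: "\<And>e. e \<in> set D \<Longrightarrow> nondegenerate e"
    and tame: "\<And>e s. e \<in> set D \<Longrightarrow> s \<in> set (pieces e) \<Longrightarrow> tame_piece s"
    and apart: "\<And>e f. e \<in> set D \<Longrightarrow> f \<in> set D \<Longrightarrow> e \<noteq> f \<Longrightarrow> ends e \<noteq> ends f \<and>
      ((\<forall>s \<in> set (pieces e). \<forall>t \<in> set (pieces f). apart H s t) \<or>
       (\<forall>s \<in> set (pieces f). \<forall>t \<in> set (pieces e). apart H s t))"
begin

text \<open>
  At a graph vertex the lifts given by different arcs can differ in sign; the projection to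
  projective space does not depend on the choice (lemma \<open>place_trail\<close>).
\<close>

definition place :: "('v \<Rightarrow> real) \<Rightarrow> (real ^ 3) set" where
  "place x = hproj (trail (SOME e. e \<in> set D \<and> x \<in> extent e) x)"

lemma realization_eq: "realization G = (\<Union>e \<in> set D. extent e)"
proof (intro equalityI subsetI)
  fix x assume "x \<in> realization G"
  then obtain s where s: "s \<in> (\<lambda>v. {v}) ` fst G \<union> snd G" "\<And>v. 0 \<le> x v" "\<And>v. v \<notin> s \<Longrightarrow> x v = 0" "sum x s = 1"
    by (auto simp: realization_def)
  then obtain e where e: "e \<in> set D" "s \<subseteq> ends e" by (auto simp: edges verts)
  obtain u v p m r where e': "e = (u, v, p, m, r)" by (cases e)
  have "u \<noteq> v" using placed e e' by blast
  have "sum x s = sum x (ends e)"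
    using e s(3) by (intro sum.mono_neutral_left) (auto simp: e')
  then have "x u + x v = 1" using s(4) \<open>u \<noteq> v\<close> by (simp add: e')
  then have "x \<in> extent e" using s e(2) by (auto simp: e')
  then show "x \<in> (\<Union>e \<in> set D. extent e)" using e by blast
next
  fix x assume "x \<in> (\<Union>e \<in> set D. extent e)"
  then obtain u v p m r where e: "(u, v, p, m, r) \<in> set D" "x \<in> extent (u, v, p, m, r)" by auto
  moreover have "u \<noteq> v" using placed e by blast
  moreover have "{u, v} \<in> snd G" using imageI[OF e(1), of ends] by (simp add: edges)
  ultimately have "(\<forall>w. 0 \<le> x w) \<and> (\<forall>w. w \<notin> {u, v} \<longrightarrow> x w = 0) \<and> sum x {u, v} = 1"
    "{u, v} \<in> (\<lambda>v. {v}) ` fst G \<union> snd G"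
    by auto
  then show "x \<in> realization G"
    unfolding realization_def by blast
qed

text \<open>
  This is injectivity across different arcs.  An equation between lifts is a linear relation between
  the ends of two pieces, and the tests in \<open>apart\<close> force the coefficients that lead away from
  a common end to vanish.
\<close>

lemma shared_vertex:
  assumes e: "(u, v, p, m, r) \<in> set D" and f: "(u', v', p', m', r') \<in> set D"
    and ap: "\<forall>s \<in> set (pieces (u, v, p, m, r)). \<forall>t \<in> set (pieces (u', v', p', m', r')). apart H s t"
    and x: "x \<in> extent (u, v, p, m, r)" and y: "y \<in> extent (u', v', p', m', r')"
    and eq: "trail (u, v, p, m, r) x = c *\<^sub>R trail (u', v', p', m', r') y" and "c \<noteq> 0"
  shows "\<exists>w. x = vert w \<and> y = vert w"
proof -
  have uv: "u \<noteq> v" "u' \<noteq> v'" using placed e f by blast+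
  obtain la a lb b \<alpha> \<beta> where 1: "((la, a), (lb, b)) \<in> set (pieces (u, v, p, m, r))"
    "0 \<le> \<alpha>" "0 \<le> \<beta>" "0 < \<alpha> + \<beta>" "trail (u, v, p, m, r) x = \<alpha> *\<^sub>R hv a + \<beta> *\<^sub>R hv b"
    "\<And>w. \<beta> = 0 \<Longrightarrow> la = Some w \<Longrightarrow> x = vert w" "\<And>w. \<alpha> = 0 \<Longrightarrow> lb = Some w \<Longrightarrow> x = vert w"
    by (rule trail_piece[OF uv(1) x]) blast
  obtain lc c' ld d \<gamma> \<delta> where 2: "((lc, c'), (ld, d)) \<in> set (pieces (u', v', p', m', r'))"
    "0 \<le> \<gamma>" "0 \<le> \<delta>" "0 < \<gamma> + \<delta>" "trail (u', v', p', m', r') y = \<gamma> *\<^sub>R hv c' + \<delta> *\<^sub>R hv d"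
    "\<And>w. \<delta> = 0 \<Longrightarrow> lc = Some w \<Longrightarrow> y = vert w" "\<And>w. \<gamma> = 0 \<Longrightarrow> ld = Some w \<Longrightarrow> y = vert w"
    by (rule trail_piece[OF uv(2) y]) blast
  have ap: "apart H ((la, a), (lb, b)) ((lc, c'), (ld, d))" using ap 1(1) 2(1) by blast
  have eq: "\<alpha> *\<^sub>R hv a + \<beta> *\<^sub>R hv b = (c * \<gamma>) *\<^sub>R hv c' + (c * \<delta>) *\<^sub>R hv d"
    using eq unfolding 1(5) 2(5) by (simp add: scaleR_add_right)
  have lab: "q \<in> {P w, ineg (P w)}" if "(l, q) \<in> {(la, a), (lb, b), (lc, c'), (ld, d)}" "l = Some w" for l q w
  proof -
    have "(l, q) \<in> {(la, a), (lb, b)} \<or> (l, q) \<in> {(lc, c'), (ld, d)}" using that(1) by blast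
    then show ?thesis
    proof
      assume "(l, q) \<in> {(la, a), (lb, b)}"
      then have "(l, q) \<in> {(Some u, p), (Some v, r)}" using 1(1) that(2) by (cases m) auto
      then show ?thesis using placed[OF e] that(2) by auto
    next
      assume "(l, q) \<in> {(lc, c'), (ld, d)}"
      then have "(l, q) \<in> {(Some u', p'), (Some v', r')}" using 2(1) that(2) by (cases m') auto
      then show ?thesis using placed[OF f] that(2) by auto
    qed
  qed
  have pm: "\<exists>s. s \<noteq> 0 \<and> hv q' = s *\<^sub>R hv q"
    if "(Some w, q) \<in> {(la, a), (lb, b), (lc, c'), (ld, d)}"
       "(Some w, q') \<in> {(la, a), (lb, b), (lc, c'), (ld, d)}" for w q q'
  proof -
    have "q \<in> {P w, ineg (P w)}" "q' \<in> {P w, ineg (P w)}" using lab that by blast+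
    then have "hv q' = 1 *\<^sub>R hv q \<or> hv q' = (-1) *\<^sub>R hv q" by (auto simp: hv_ineg)
    then show ?thesis by (metis zero_neq_neg_one zero_neq_one)
  qed
  have dep: "\<beta>' = 0 \<and> \<delta>' = 0"
    if "indep3 a' b' d'" "\<alpha>' *\<^sub>R hv a' + \<beta>' *\<^sub>R hv b' = \<gamma>' *\<^sub>R hv c'' + \<delta>' *\<^sub>R hv d'" "hv c'' = s *\<^sub>R hv a'"
    for a' b' c'' d' \<alpha>' \<beta>' \<gamma>' \<delta>' s
  proof -
    have "(\<alpha>' - \<gamma>' * s) *\<^sub>R hv a' + \<beta>' *\<^sub>R hv b' + (- \<delta>') *\<^sub>R hv d' = 0"
      using that(2,3) by (simp add: algebra_simps)
    then show ?thesis using indep3_independent[OF that(1)] by fastforce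
  qed
  have indep_swap: "indep3 b' a' d'" if "indep3 a' b' d'" for a' b' d'
  proof -
    have "det4 b' a' d' w = - det4 a' b' d' w" for w
      by (rule det4_swap)
    then show ?thesis using that by (simp add: indep3_def list_ex_iff)
  qed
  consider
      (ac) w where "la = Some w" "lc = Some w" "indep3 a b d"
    | (ad) w where "la = Some w" "ld = Some w" "indep3 a b c'"
    | (bc) w where "lb = Some w" "lc = Some w" "indep3 a b d"
    | (bd) w where "lb = Some w" "ld = Some w" "indep3 a b c'"
    | (none) "det4 a b c' d \<noteq> 0 \<or> divided H a b c' d \<and> divided H a b (ineg c') (ineg d)"
    using ap by (auto split: if_splits)
  then show ?thesis
  proof cases
    case ac
    obtain s where "hv c' = s *\<^sub>R hv a" using pm[of w a c'] ac by auto
    then have "\<beta> = 0 \<and> c * \<delta> = 0" using dep[OF ac(3) eq] by blast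
    then show ?thesis using 1(6) 2(6) ac \<open>c \<noteq> 0\<close> by auto
  next
    case ad
    obtain s where "hv d = s *\<^sub>R hv a" using pm[of w a d] ad by auto
    then have "\<beta> = 0 \<and> c * \<gamma> = 0" using dep[OF ad(3), of \<alpha> \<beta> "c * \<delta>" d "c * \<gamma>" s] eq by (simp add: add.commute)
    then show ?thesis using 1(6) 2(7) ad \<open>c \<noteq> 0\<close> by auto
  next
    case bc
    obtain s where "hv c' = s *\<^sub>R hv b" using pm[of w b c'] bc by auto
    then have "\<alpha> = 0 \<and> c * \<delta> = 0"
      using dep[OF indep_swap[OF bc(3)], of \<beta> \<alpha> "c * \<gamma>" c' "c * \<delta>" s] eq by (simp add: add.commute)
    then show ?thesis using 1(7) 2(6) bc \<open>c \<noteq> 0\<close> by auto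
  next
    case bd
    obtain s where "hv d = s *\<^sub>R hv b" using pm[of w b d] bd by auto
    then have "\<alpha> = 0 \<and> c * \<gamma> = 0"
      using dep[OF indep_swap[OF bd(3)], of \<beta> \<alpha> "c * \<delta>" d "c * \<gamma>" s] eq by (simp add: add.commute)
    then show ?thesis using 1(7) 2(7) bd \<open>c \<noteq> 0\<close> by auto
  next
    case none
    have False if "det4 a b c' d \<noteq> 0"
    proof -
      have "\<alpha> *\<^sub>R hv a + \<beta> *\<^sub>R hv b + (- (c * \<gamma>)) *\<^sub>R hv c' + (- (c * \<delta>)) *\<^sub>R hv d = 0"
        using eq by simp
      then show False using det4_independent[OF that] 1(4) by fastforce
    qed
    moreover have False if sep: "divided H a b (if 0 < c then c' else ineg c') (if 0 < c then d else ineg d)"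
    proof -
      define s :: real where "s = (if 0 < c then 1 else -1)"
      obtain k where k: "0 < idot k a" "0 < idot k b"
        "idot k (if 0 < c then c' else ineg c') \<le> 0" "idot k (if 0 < c then d else ineg d) \<le> 0"
        using sep unfolding divided_def list_ex_iff by blast
      have k': "s * real_of_int (idot k c') \<le> 0" "s * real_of_int (idot k d) \<le> 0"
        using k(3,4) by (auto simp: s_def idot_ineg split: if_splits)
      have "\<alpha> * idot k a + \<beta> * idot k b = \<bar>c\<bar> * (\<gamma> * (s * idot k c') + \<delta> * (s * idot k d))"
        using arg_cong[OF eq, of "hdot k"] by (simp add: hdot_linear hdot_hv s_def algebra_simps)
      also have "\<dots> \<le> 0"
        using mult_nonneg_nonpos[OF 2(2) k'(1)] mult_nonneg_nonpos[OF 2(3) k'(2)]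
        by (simp add: mult_nonneg_nonpos)
      finally have "\<alpha> * idot k a + \<beta> * idot k b \<le> 0" .
      moreover have "0 < \<alpha> * idot k a + \<beta> * idot k b"
        using k(1,2) 1(2-4) by (intro conic_pos) auto
      ultimately show False by simp
    qed
    ultimately show ?thesis using none by (cases "0 < c") auto
  qed
qed

lemma ends_distinct: "(u, v, p, m, r) \<in> set D \<Longrightarrow> u \<noteq> v"
  using placed by blast

lemma trail_nz:
  assumes "e \<in> set D" "x \<in> extent e"
  shows "trail e x \<noteq> 0"
proof -
  obtain u v p m r where e: "e = (u, v, p, m, r)" by (cases e)
  show ?thesis
    using trail_nonzero[OF ends_distinct[of u v p m r] nondeg[of e, unfolded e]] assms unfolding e by blast
qed

lemma trail_vert:
  assumes "e \<in> set D" "vert w \<in> extent e"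
  shows "hproj (trail e (vert w)) = hproj (hv (P w))"
proof -
  obtain u v p m r where e: "e = (u, v, p, m, r)" by (cases e)
  have uv: "u \<noteq> v" "p \<in> {P u, ineg (P u)}" "r \<in> {P v, ineg (P v)}" using placed assms e by blast+
  have "w = u \<or> w = v" using assms(2) uv(1) by (auto simp: e vert_def split: if_splits)
  then have t: "trail e (vert w) = hv (P w) \<or> trail e (vert w) = - hv (P w)"
    using uv by (auto simp: e vert_def hv_ineg split: option.splits)
  moreover have "hv (P w) \<noteq> 0" using t trail_nz[OF assms] by auto
  ultimately show ?thesis using hproj_uminus by metis
qed

lemma place_trail:
  assumes e: "e \<in> set D" "x \<in> extent e"
  shows "place x = hproj (trail e x)"
proof -
  define f where "f = (SOME e. e \<in> set D \<and> x \<in> extent e)"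
  have f: "f \<in> set D" "x \<in> extent f"
    using someI[of "\<lambda>e. e \<in> set D \<and> x \<in> extent e" e] assms unfolding f_def by blast+
  have "hproj (trail f x) = hproj (trail e x)"
  proof (cases "f = e")
    case False
    obtain u v p m r where e': "e = (u, v, p, m, r)" by (cases e)
    obtain u' v' p' m' r' where f': "f = (u', v', p', m', r')" by (cases f)
    have uv: "u \<noteq> v" "u' \<noteq> v'" using ends_distinct e(1) f(1) unfolding e' f' by blast+
    have "{u, v} \<noteq> {u', v'}" using apart[OF f(1) e(1) False, THEN conjunct1] unfolding e' f' by auto
    then have "x u = 0 \<or> x v = 0"
      using e(2) f(2) uv unfolding e' f' by (auto simp: doubleton_eq_iff)
    then have "x = vert u \<or> x = vert v"
      using extent_vert[OF uv(1) e(2)[unfolded e']] by argo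
    then obtain w where "x = vert w" by metis
    then show ?thesis using trail_vert[OF e(1), of w] trail_vert[OF f(1), of w] e(2) f(2) by simp
  qed simp
  then show ?thesis by (simp add: place_def f_def)
qed

lemma continuous_map_place: "continuous_map (top_of_set (realization G)) RP3 place"
proof (rule pasting_lemma_closed[where I = "set D" and T = extent and f = "\<lambda>e. hproj \<circ> trail e"])
  fix e assume e: "e \<in> set D"
  obtain u v p m r where e': "e = (u, v, p, m, r)" by (cases e)
  have sub: "extent e \<subseteq> realization G" using e realization_eq by blast
  have "closed (extent e)" unfolding e' by (rule closed_extent)
  then show "closedin (top_of_set (realization G)) (extent e)"
    by (rule closed_subset[OF sub])
  have "continuous_map (top_of_set (extent e)) (top_of_set (- {0})) (trail e)"
    using trail_nz[OF e] continuous_on_trail by (simp add: image_subset_iff)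
  then have "continuous_map (top_of_set (extent e)) RP3 (hproj \<circ> trail e)"
    by (rule continuous_map_compose[OF _ continuous_map_hproj])
  then show "continuous_map (subtopology (top_of_set (realization G)) (extent e)) RP3 (hproj \<circ> trail e)"
    using sub by (simp add: subtopology_subtopology Int_absorb1)
next
  fix e f x
  assume "e \<in> set D" "f \<in> set D" "x \<in> topspace (top_of_set (realization G)) \<inter> extent e \<inter> extent f"
  then show "(hproj \<circ> trail e) x = (hproj \<circ> trail f) x"
    using place_trail[of e x] place_trail[of f x] by simp
next
  fix x assume "x \<in> topspace (top_of_set (realization G))"
  then obtain e where e: "e \<in> set D" "x \<in> extent e" by (auto simp: realization_eq)
  then show "\<exists>e. e \<in> set D \<and> x \<in> extent e \<and> place x = (hproj \<circ> trail e) x"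
    using place_trail[OF e] by (intro exI[of _ e]) simp
qed simp

lemma inj_place: "inj_on place (realization G)"
proof (rule inj_onI)
  fix x y assume "x \<in> realization G" "y \<in> realization G" and xy: "place x = place y"
  then obtain e f where e: "e \<in> set D" "x \<in> extent e" and f: "f \<in> set D" "y \<in> extent f"
    by (auto simp: realization_eq)
  have "hproj (trail e x) = hproj (trail f y)" using xy place_trail e f by simp
  then obtain c where c: "c \<noteq> 0" "trail e x = c *\<^sub>R trail f y"
    by (rule hproj_eqD[OF trail_nz[OF e] trail_nz[OF f]])
  then have c': "trail f y = (1 / c) *\<^sub>R trail e x" by simp
  obtain u v p m r where e': "e = (u, v, p, m, r)" by (cases e)
  obtain u' v' p' m' r' where f': "f = (u', v', p', m', r')" by (cases f)
  show "x = y"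
  proof (cases "e = f")
    case True
    have "u \<noteq> v" using ends_distinct e(1) unfolding e' by blast
    then show ?thesis
      using trail_injective[of u v p m r x y c] nondeg[OF e(1)] e f c(2) True unfolding e' by blast
  next
    case False
    then have "\<exists>w. x = vert w \<and> y = vert w"
      using apart[OF e(1) f(1)] shared_vertex[of u v p m r u' v' p' m' r' x y c]
        shared_vertex[of u' v' p' m' r' u v p m r y x "1 / c"] e f c c'
      unfolding e' f' by (metis divide_eq_0_iff zero_neq_one)
    then show ?thesis by auto
  qed
qed

lemma embedding_map_place: "embedding_map (top_of_set (realization G)) RP3 place"
proof (rule embedding_map_compact_into_RP3[OF _ continuous_map_place inj_place])
  have "compact (extent e)" if "e \<in> set D" for e
  proof -
    obtain u v p m r where e: "e = (u, v, p, m, r)" by (cases e)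
    show ?thesis using compact_extent[OF ends_distinct[OF that[unfolded e]]] unfolding e .
  qed
  then show "compact (realization G)"
    unfolding realization_eq by (intro compact_UN) auto
qed

text \<open>
  The parametrization by barycentric coordinates is not linear on bent arcs, but its image is
  the union of the projected pieces.
\<close>

lemma image_trail:
  assumes "e \<in> set D"
  shows "place ` extent e = (\<Union>((_, a), (_, b)) \<in> set (pieces e). hproj ` hcone (hv a) (hv b))"
proof (intro equalityI subsetI)
  obtain u v p m r where e: "e = (u, v, p, m, r)" by (cases e)
  have uv: "u \<noteq> v" using ends_distinct assms unfolding e by blast
  fix X assume "X \<in> place ` extent e"
  then obtain x where x: "x \<in> extent e" "X = hproj (trail e x)" using place_trail[OF assms] by auto
  obtain la a lb b \<alpha> \<beta> where "((la, a), (lb, b)) \<in> set (pieces e)"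
    "0 \<le> \<alpha>" "0 \<le> \<beta>" "0 < \<alpha> + \<beta>" "trail e x = \<alpha> *\<^sub>R hv a + \<beta> *\<^sub>R hv b"
    using trail_piece[OF uv, of x p m r] x(1) unfolding e by metis
  then show "X \<in> (\<Union>((_, a), (_, b)) \<in> set (pieces e). hproj ` hcone (hv a) (hv b))"
    using hcone_scale[of \<alpha> \<beta> "hv a" "hv b"] x(2) by (auto intro!: bexI[of _ "((la, a), (lb, b))"])
next
  obtain u v p m r where e: "e = (u, v, p, m, r)" by (cases e)
  have uv: "u \<noteq> v" using ends_distinct assms unfolding e by blast
  fix X assume "X \<in> (\<Union>((_, a), (_, b)) \<in> set (pieces e). hproj ` hcone (hv a) (hv b))"
  then obtain la a lb b \<alpha> \<beta> where ab: "((la, a), (lb, b)) \<in> set (pieces e)"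
    "0 \<le> \<alpha>" "0 \<le> \<beta>" "0 < \<alpha> + \<beta>" "X = hproj (\<alpha> *\<^sub>R hv a + \<beta> *\<^sub>R hv b)"
    unfolding hcone_def by auto
  have "\<exists>s c. 0 \<le> s \<and> s \<le> 1 \<and> 0 < c \<and> c *\<^sub>R trail e (edge_point u v s) = \<alpha> *\<^sub>R hv a + \<beta> *\<^sub>R hv b"
  proof (cases m)
    case None
    then have "a = p" "b = r" using ab(1) by (auto simp: e)
    then show ?thesis
      using ab(2-4) uv None
      by (intro exI[of _ "\<beta> / (\<alpha> + \<beta>)"] exI[of _ "\<alpha> + \<beta>"]) (simp add: e edge_point_def scaleR_add_right right_diff_distrib)
  next
    case (Some m')
    then have "a = p \<and> b = m' \<or> a = m' \<and> b = r" using ab(1) by (auto simp: e)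
    then show ?thesis
    proof
      assume 1: "a = p \<and> b = m'"
      define c where "c = \<alpha> + 2 * \<beta>"
      have c: "0 < c" using ab by (simp add: c_def)
      have "\<beta> / c \<le> 1 - \<beta> / c" "\<beta> / c \<le> 1" using ab c by (simp_all add: field_simps c_def)
      then have "c *\<^sub>R trail e (edge_point u v (\<beta> / c)) = (c * (1 - \<beta> / c) - c * (\<beta> / c)) *\<^sub>R hv p + (c * (\<beta> / c)) *\<^sub>R hv m'"
        using uv trail_bent(1)[of "edge_point u v (\<beta> / c)" v u p m' r] unfolding e Some
        by (simp add: edge_point_def scaleR_add_right right_diff_distrib del: trail.simps)
      also have "c * (1 - \<beta> / c) - c * (\<beta> / c) = \<alpha>" using c by (simp add: algebra_simps) (simp add: c_def)
      finally show ?thesis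
        using 1 c ab \<open>\<beta> / c \<le> 1\<close> by (intro exI[of _ "\<beta> / c"] exI[of _ c]) simp
    next
      assume 1: "a = m' \<and> b = r"
      define c where "c = 2 * \<alpha> + \<beta>"
      have c: "0 < c" using ab by (simp add: c_def)
      have "\<alpha> / c \<le> 1 - \<alpha> / c" "\<alpha> / c \<le> 1" using ab c by (simp_all add: field_simps c_def)
      then have "c *\<^sub>R trail e (edge_point u v (1 - \<alpha> / c)) = (c * (\<alpha> / c)) *\<^sub>R hv m' + (c * (1 - \<alpha> / c) - c * (\<alpha> / c)) *\<^sub>R hv r"
        using uv trail_bent(2)[of "edge_point u v (1 - \<alpha> / c)" u v p m' r] unfolding e Some
        by (simp add: edge_point_def scaleR_add_right right_diff_distrib del: trail.simps)
      also have "c * (1 - \<alpha> / c) - c * (\<alpha> / c) = \<beta>" using c by (simp add: algebra_simps) (simp add: c_def)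
      finally show ?thesis
        using 1 c ab \<open>\<alpha> / c \<le> 1\<close> by (intro exI[of _ "1 - \<alpha> / c"] exI[of _ c]) simp
    qed
  qed
  then obtain s c where s: "0 \<le> s" "s \<le> 1" "0 < c" "c *\<^sub>R trail e (edge_point u v s) = \<alpha> *\<^sub>R hv a + \<beta> *\<^sub>R hv b"
    by blast
  then have d: "edge_point u v s \<in> extent e" using extent_eq[OF uv] by (auto simp: e)
  have "X = place (edge_point u v s)"
    using hproj_scaleR[of c "trail e (edge_point u v s)"] trail_nz[OF assms d] s ab(5) place_trail[OF assms d] by simp
  then show "X \<in> place ` extent e" using d by blast
qed

end

section \<open>Splitting links by tetrahedra\<close>

lemma polygonal_tame_piece:
  assumes "tame_piece ((la, a), (lb, b))"
  shows "polygonal (hproj ` hcone (hv a) (hv b))"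
proof -
  have central: "norm (fst (hv p)) \<le> \<bar>snd (hv p)\<bar> / 2" if "central p" for p
    using norm_vector_3_le that by (cases p) fastforce
  have straight: "polygonal (hproj ` hcone (hv p) (hv q))" "0 \<notin> hcone (hv p) (hv q)"
    if pq: "central p" "central q" "0 < snd (hv p)" "0 < snd (hv q)" for p q
  proof -
    have n: "norm (fst (hv p)) \<le> snd (hv p) / 2" "norm (fst (hv q)) \<le> snd (hv q) / 2"
      using central[OF pq(1)] central[OF pq(2)] pq by simp_all
    have "fst (hv p) /\<^sub>R snd (hv p) \<in> D3" "fst (hv q) /\<^sub>R snd (hv q) \<in> D3"
      using n pq by (simp_all add: field_simps)
    then show "polygonal (hproj ` hcone (hv p) (hv q))"
      using hproj_straight_segment n pq polygonal_segment by metis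
    show "0 \<notin> hcone (hv p) (hv q)"
    proof
      assume "0 \<in> hcone (hv p) (hv q)"
      then obtain \<alpha> \<beta> where *: "0 = \<alpha> *\<^sub>R hv p + \<beta> *\<^sub>R hv q" "0 \<le> \<alpha>" "0 \<le> \<beta>" "0 < \<alpha> + \<beta>"
        unfolding hcone_def by auto
      have "\<alpha> * snd (hv p) + \<beta> * snd (hv q) = 0" using arg_cong[OF *(1), of snd] by simp
      then show False using conic_pos[OF *(2-4) pq(3,4)] by simp
    qed
  qed
  obtain a1 a2 a3 a4 where a: "a = (a1, a2, a3, a4)" by (cases a)
  obtain b1 b2 b3 b4 where b: "b = (b1, b2, b3, b4)" by (cases b)
  have c: "central a" "central b" using assms by (auto simp: a b)
  consider "0 < a4" "0 < b4" | "a4 < 0" "b4 < 0"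
    | "0 < a4" "b4 < 0" "a1 = b1" "a2 = b2" "a3 = b3" "(a1, a2, a3) \<noteq> (0, 0, 0)"
    using assms by (auto simp: a b)
  then show ?thesis
  proof cases
    case 1
    then have "0 < snd (hv a)" "0 < snd (hv b)" by (simp_all add: a b)
    then show ?thesis by (rule straight(1)[OF c])
  next
    case 2
    have "central (ineg a)" "central (ineg b)" "0 < snd (hv (ineg a))" "0 < snd (hv (ineg b))"
      using c 2 by (simp_all add: a b)
    from straight[OF this] show ?thesis
      using hproj_hcone_neg[of "hv (ineg a)" "hv (ineg b)"] by (simp add: hv_ineg)
  next
    case 3
    define x where "x = fst (hv a)"
    define s t where "s = snd (hv a)" and "t = - snd (hv b)"
    have st: "0 < s" "0 < t" using 3 by (simp_all add: s_def t_def a b)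
    have ab: "hv a = (x, s)" "hv b = (x, - t)" using 3 by (simp_all add: x_def s_def t_def a b)
    have "x \<noteq> 0"
      using 3(6) by (auto simp: x_def a vec_eq_iff forall_3)
    have n: "norm x \<le> s / 2" "norm x \<le> t / 2"
      using central[OF c(1)] central[OF c(2)] st by (simp_all add: ab)
    have "x /\<^sub>R norm x \<in> D3" "- x /\<^sub>R norm x \<in> D3" "x /\<^sub>R s \<in> D3" "- x /\<^sub>R t \<in> D3"
      using n st by (simp_all add: field_simps)
    then show ?thesis
      unfolding ab hproj_radial_segment[OF \<open>x \<noteq> 0\<close> n] image_Un
      by (intro polygonal_Un polygonal_segment)
  qed
qed

lemma trail_beyond:
  assumes "avoids M (u, v, p, m, r)" "u \<noteq> v" "x \<in> extent (u, v, p, m, r)" "c \<noteq> 0"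
  shows "\<exists>k \<in> set M. hdot k (c *\<^sub>R trail (u, v, p, m, r) x) \<le> 0"
proof -
  obtain la a lb b \<alpha> \<beta> where *: "((la, a), (lb, b)) \<in> set (pieces (u, v, p, m, r))"
    "0 \<le> \<alpha>" "0 \<le> \<beta>" "0 < \<alpha> + \<beta>" "trail (u, v, p, m, r) x = \<alpha> *\<^sub>R hv a + \<beta> *\<^sub>R hv b"
    by (rule trail_piece[OF assms(2,3)])
  have "beyond M a b" "beyond M (ineg a) (ineg b)"
    using assms(1) *(1) unfolding avoids_def list_all_iff by fastforce+
  then obtain k k' where k: "k \<in> set M" "idot k a \<le> 0" "idot k b \<le> 0"
    and k': "k' \<in> set M" "0 \<le> idot k' a" "0 \<le> idot k' b"
    unfolding beyond_def list_ex_iff idot_ineg by auto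
  have eq: "hdot k (c *\<^sub>R trail (u, v, p, m, r) x) = c * (\<alpha> * idot k a + \<beta> * idot k b)" for k
    unfolding *(5) by (simp add: hdot_linear hdot_hv)
  show ?thesis
  proof (cases "0 < c")
    case True
    then have "c * (\<alpha> * idot k a + \<beta> * idot k b) \<le> 0"
      using k *(2,3) by (intro mult_nonneg_nonpos add_nonpos_nonpos) (auto intro: mult_nonneg_nonpos)
    then show ?thesis using k(1) eq by metis
  next
    case False
    then have "c * (\<alpha> * idot k' a + \<beta> * idot k' b) \<le> 0"
      using k' *(2,3) by (intro mult_nonpos_nonneg add_nonneg_nonneg) auto
    then show ?thesis using k'(1) eq by metis
  qed
qed

context drawing
begin

lemma polygonal_place: "polygonal (place ` realization G)"
proof -
  have "polygonal (place ` extent e)" if e: "e \<in> set D" for e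
  proof -
    have "polygonal (case s of ((la, a), (lb, b)) \<Rightarrow> hproj ` hcone (hv a) (hv b))" if "s \<in> set (pieces e)" for s
      using polygonal_tame_piece tame[OF e that] by (cases s) auto
    then show ?thesis
      unfolding image_trail[OF e] by (intro polygonal_UN) auto
  qed
  then show ?thesis
    unfolding realization_eq image_UN by (intro polygonal_UN) auto
qed

lemma tame_embedding_place: "tame_embedding G place"
proof -
  have "homeomorphic_map RP3 RP3 id" by (simp add: homeomorphic_map_id)
  then show ?thesis
    unfolding tame_embedding_def using embedding_map_place polygonal_place by (metis image_id id_apply)
qed

text \<open>
  The lifts of the arcs inside are normalized by signs so that all of them lie in the same
  open cone; they form a compact set, to which \<open>embedded_ball_in_cone\<close> applies.
\<close>

lemma separating_ball:
  assumes "separates D (S, M)"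
  obtains B where "embedded_ball B"
    "\<And>e. e \<in> set D \<Longrightarrow> ends e \<subseteq> set S \<Longrightarrow> place ` extent e \<subseteq> B"
    "\<And>e. e \<in> set D \<Longrightarrow> ends e \<inter> set S = {} \<Longrightarrow> place ` extent e \<inter> B = {}"
proof -
  have "simplicial M" using assms by simp
  then obtain k1 k2 k3 k4 where M: "M = [k1, k2, k3, k4]" "det4 k1 k2 k3 k4 \<noteq> 0"
    by (cases M rule: simplicial.cases) auto
  define F where "F = coords k1 k2 k3 k4"
  have F: "linear F" "inj F" unfolding F_def using linear_coords inj_coords[OF M(2)] by auto
  have orth: "F v \<in> orthant \<longleftrightarrow> (\<forall>k \<in> set M. 0 < hdot k v)" for v
    unfolding F_def M(1) by (rule coords_orthant)
  have inout: "(ends e \<subseteq> set S \<longrightarrow> encloses M e) \<and> (ends e \<inter> set S = {} \<longrightarrow> avoids M e)"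
    if "e \<in> set D" for e
  proof -
    obtain u v a where e: "e = (u, v, a)" by (cases e)
    show ?thesis
      using assms that by (auto simp: e list_all_iff split: if_splits)
  qed
  define sg :: "'v arc \<Rightarrow> real" where "sg e = (if all_pos M (controls e) then 1 else -1)" for e
  define K where "K = (\<Union>e \<in> {e \<in> set D. ends e \<subseteq> set S}. (\<lambda>x. sg e *\<^sub>R trail e x) ` extent e)"
  have "compact K"
    unfolding K_def
  proof (intro compact_UN compact_continuous_image)
    fix e assume "e \<in> {e \<in> set D. ends e \<subseteq> set S}"
    then have e: "e \<in> set D" by simp
    obtain u v p m r where e': "e = (u, v, p, m, r)" by (cases e)
    show "compact (extent e)" using compact_extent[OF ends_distinct[OF e[unfolded e']]] unfolding e' .
    show "continuous_on (extent e) (\<lambda>x. sg e *\<^sub>R trail e x)"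
      by (intro continuous_intros continuous_on_trail)
  qed auto
  moreover have "F v \<in> orthant" if v: "v \<in> K" for v
  proof -
    obtain e x where e: "e \<in> set D" "ends e \<subseteq> set S" "x \<in> extent e" "v = sg e *\<^sub>R trail e x"
      using v unfolding K_def by blast
    obtain u w p m r where e': "e = (u, w, p, m, r)" by (cases e)
    have "all_pos M (controls e) \<or> all_pos M (map ineg (controls e))"
      using inout e by (simp add: encloses_def)
    then have "0 < sg e * hdot k (hv q)" if "k \<in> set M" "q \<in> set (controls e)" for k q
      using that by (auto simp: sg_def all_pos_def list_all_iff hdot_hv idot_ineg)
    then have "0 < sg e * hdot k (trail e x)" if "k \<in> set M" for k
      using hdot_trail_pos[OF ends_distinct[OF e(1)[unfolded e']], of x p m r] e(3) that
      unfolding e' by blast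
    then show ?thesis unfolding orth e(4) by (simp add: hdot_linear)
  qed
  ultimately obtain B where B: "embedded_ball B" "hproj ` K \<subseteq> B" "B \<subseteq> hproj ` {v. F v \<in> orthant}"
    by (rule embedded_ball_in_cone[OF F])
  show ?thesis
  proof (rule that[OF B(1)])
    fix e assume e: "e \<in> set D" "ends e \<subseteq> set S"
    show "place ` extent e \<subseteq> B"
    proof (intro image_subsetI)
      fix x assume x: "x \<in> extent e"
      have "place x = hproj (sg e *\<^sub>R trail e x)"
        using place_trail[OF e(1) x] hproj_scaleR[OF _ trail_nz[OF e(1) x], of "sg e"] by (simp add: sg_def)
      moreover have "sg e *\<^sub>R trail e x \<in> K" unfolding K_def using e x by blast
      ultimately show "place x \<in> B" using B(2) by blast
    qed
  next
    fix e assume e: "e \<in> set D" "ends e \<inter> set S = {}"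
    obtain u w p m r where e': "e = (u, w, p, m, r)" by (cases e)
    have "place x \<notin> B" if x: "x \<in> extent e" for x
    proof
      assume "place x \<in> B"
      then obtain v where v: "F v \<in> orthant" "hproj v = hproj (trail e x)"
        using B(3) place_trail[OF e(1) x] by force
      have "v \<noteq> 0" using v(1) linear_0[OF F(1)] by (auto simp: orthant_def)
      then obtain c where c: "c \<noteq> 0" "v = c *\<^sub>R trail e x"
        using hproj_eqD[OF _ trail_nz[OF e(1) x] v(2)] by blast
      have "avoids M e" using inout e by blast
      then obtain k where "k \<in> set M" "hdot k v \<le> 0"
        using trail_beyond[of M u w p m r x c] ends_distinct e(1) x c unfolding e' by blast
      then show False using v(1) unfolding orth by force
    qed
    then show "place ` extent e \<inter> B = {}" by blast
  qed
qed

lemma extent_support: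
  assumes "e \<in> set D" "s \<subseteq> ends e" "\<And>v. 0 \<le> x v" "\<And>v. v \<notin> s \<Longrightarrow> x v = 0" "sum x s = 1"
  shows "x \<in> extent e"
proof -
  obtain u v p m r where e': "e = (u, v, p, m, r)" by (cases e)
  have "u \<noteq> v" using ends_distinct assms(1) unfolding e' by blast
  have "sum x s = sum x (ends e)"
    using assms(2,4) by (intro sum.mono_neutral_left) (auto simp: e')
  then have "x u + x v = 1" using assms(5) \<open>u \<noteq> v\<close> by (simp add: e')
  then show ?thesis using assms by (auto simp: e')
qed

lemma cycle_realization:
  assumes "is_cycle G c"
  shows "realization (set c, cycle_edges c) \<subseteq> (\<Union>e \<in> {e \<in> set D. ends e \<subseteq> set c}. extent e)"
    and "realization (set c, cycle_edges c) \<noteq> {}"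
proof -
  have c: "3 \<le> length c" "cycle_edges c \<subseteq> snd G" using assms by (auto simp: is_cycle_def)
  have arc: "\<exists>e \<in> set D. ends e \<subseteq> set c \<and> s \<subseteq> ends e" if s: "s \<in> (\<lambda>v. {v}) ` set c \<union> cycle_edges c" for s
  proof -
    obtain i where i: "i < length c" "s \<subseteq> {c ! i, c ! (Suc i mod length c)}"
      using s by (auto simp: cycle_edges_def in_set_conv_nth)
    have "Suc i mod length c < length c" by (rule mod_less_divisor) (use i(1) in linarith)
    then have sub: "{c ! i, c ! (Suc i mod length c)} \<subseteq> set c" using i(1) by simp
    have "{c ! i, c ! (Suc i mod length c)} \<in> snd G"
      using c(2) i(1) by (auto simp: cycle_edges_def)
    then obtain e where "e \<in> set D" "ends e = {c ! i, c ! (Suc i mod length c)}"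
      unfolding edges by auto
    then show ?thesis using i(2) sub by blast
  qed
  show "realization (set c, cycle_edges c) \<subseteq> (\<Union>e \<in> {e \<in> set D. ends e \<subseteq> set c}. extent e)"
  proof
    fix x assume "x \<in> realization (set c, cycle_edges c)"
    then obtain s where s: "s \<in> (\<lambda>v. {v}) ` set c \<union> cycle_edges c"
      "\<And>v. 0 \<le> x v" "\<And>v. v \<notin> s \<Longrightarrow> x v = 0" "sum x s = 1"
      unfolding realization_def fst_conv snd_conv by blast
    then obtain e where e: "e \<in> set D" "ends e \<subseteq> set c" "s \<subseteq> ends e" using arc by blast
    then have "x \<in> extent e" using extent_support[OF e(1,3)] s by blast
    then show "x \<in> (\<Union>e \<in> {e \<in> set D. ends e \<subseteq> set c}. extent e)" using e by blast
  qed
  have "c ! 0 \<in> set c" using c(1) by (intro nth_mem) linarith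
  then have "vert (c ! 0) \<in> realization (set c, cycle_edges c)"
    unfolding realization_def by (auto simp: vert_def intro!: bexI[of _ "{c ! 0}"])
  then show "realization (set c, cycle_edges c) \<noteq> {}" by blast
qed

theorem three_linkless_criterion:
  assumes certs: "\<And>C. C \<in> set Cs \<Longrightarrow> separates D C"
    and cover: "\<And>c1 c2 c3. is_cycle G c1 \<Longrightarrow> is_cycle G c2 \<Longrightarrow> is_cycle G c3 \<Longrightarrow>
      set c1 \<inter> set c2 = {} \<Longrightarrow> set c1 \<inter> set c3 = {} \<Longrightarrow> set c2 \<inter> set c3 = {} \<Longrightarrow>
      \<exists>S \<in> fst ` set Cs. (\<forall>c \<in> {c1, c2, c3}. set c \<subseteq> set S \<or> set c \<inter> set S = {}) \<and>
        (\<exists>c \<in> {c1, c2, c3}. set c \<subseteq> set S) \<and> (\<exists>c \<in> {c1, c2, c3}. set c \<inter> set S = {})"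
  shows "three_linklessly_embeddable G"
  unfolding three_linklessly_embeddable_def
proof (intro exI[of _ place] conjI ballI)
  show "tame_embedding G place" by (rule tame_embedding_place)
next
  fix L assume "L \<in> three_component_links G place"
  then obtain c1 c2 c3 where L: "L = (\<lambda>c. place ` realization (set c, cycle_edges c)) ` {c1, c2, c3}"
    and cyc: "is_cycle G c1" "is_cycle G c2" "is_cycle G c3"
    and disj: "set c1 \<inter> set c2 = {}" "set c1 \<inter> set c3 = {}" "set c2 \<inter> set c3 = {}"
    unfolding three_component_links_def by blast
  define comp where "comp c = place ` realization (set c, cycle_edges c)" for c
  obtain S where S0: "S \<in> fst ` set Cs"
    and S1: "(\<forall>c \<in> {c1, c2, c3}. set c \<subseteq> set S \<or> set c \<inter> set S = {}) \<and>
      (\<exists>c \<in> {c1, c2, c3}. set c \<subseteq> set S) \<and> (\<exists>c \<in> {c1, c2, c3}. set c \<inter> set S = {})"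
    using cover[OF cyc disj] by (rule bexE)
  note S2 = S1[THEN conjunct1] and S3 = S1[THEN conjunct2, THEN conjunct1] S1[THEN conjunct2, THEN conjunct2]
  obtain C where C: "S = fst C" "C \<in> set Cs" using S0 by (rule imageE)
  obtain M where SM: "(S, M) \<in> set Cs" using C by (cases C) simp
  have S: "set c \<subseteq> set S \<or> set c \<inter> set S = {}" if "c \<in> {c1, c2, c3}" for c
    using S2 that by (rule bspec)
  obtain B where B: "embedded_ball B"
    "\<And>e. e \<in> set D \<Longrightarrow> ends e \<subseteq> set S \<Longrightarrow> place ` extent e \<subseteq> B"
    "\<And>e. e \<in> set D \<Longrightarrow> ends e \<inter> set S = {} \<Longrightarrow> place ` extent e \<inter> B = {}"
    using separating_ball[OF certs[OF SM]] by blast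
  have cyc': "is_cycle G c" if "c \<in> {c1, c2, c3}" for c using that cyc by blast
  have sub: "comp c \<subseteq> (\<Union>e \<in> {e \<in> set D. ends e \<subseteq> set c}. place ` extent e)" if "c \<in> {c1, c2, c3}" for c
    using cycle_realization(1)[OF cyc'[OF that]] unfolding comp_def by blast
  have ne: "comp c \<noteq> {}" if "c \<in> {c1, c2, c3}" for c
    using cycle_realization(2)[OF cyc'[OF that]] unfolding comp_def by blast
  have inside: "comp c \<subseteq> B" if "c \<in> {c1, c2, c3}" "set c \<subseteq> set S" for c
    using sub[OF that(1)] that(2) B(2) by blast
  have outside: "comp c \<inter> B = {}" if "c \<in> {c1, c2, c3}" "set c \<inter> set S = {}" for c
  proof -
    have "place ` extent e \<inter> B = {}" if "e \<in> set D" "ends e \<subseteq> set c" for e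
      using B(3)[OF that(1)] that(2) \<open>set c \<inter> set S = {}\<close> by blast
    then show ?thesis using sub[OF that(1)] by blast
  qed
  define L1 where "L1 = comp ` {c \<in> {c1, c2, c3}. set c \<subseteq> set S}"
  define L2 where "L2 = comp ` {c \<in> {c1, c2, c3}. set c \<inter> set S = {}}"
  have "L1 \<noteq> {}" "L2 \<noteq> {}" using S3 unfolding L1_def L2_def by blast+
  moreover have "L1 \<union> L2 = L"
    unfolding L L1_def L2_def comp_def[symmetric] using S by blast
  moreover have "\<Union> L1 \<subseteq> B" unfolding L1_def using inside by blast
  moreover have "\<Union> L2 \<inter> B = {}" unfolding L2_def using outside by blast
  moreover have "L1 \<inter> L2 = {}"
  proof -
    have "X \<subseteq> B \<and> X \<noteq> {}" if X: "X \<in> L1" for X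
    proof -
      obtain c where "X = comp c" "c \<in> {c1, c2, c3}" "set c \<subseteq> set S"
        using X unfolding L1_def by (elim imageE CollectE conjE)
      then show ?thesis using inside ne by metis
    qed
    moreover have "X \<inter> B = {}" if X: "X \<in> L2" for X
    proof -
      obtain c where "X = comp c" "c \<in> {c1, c2, c3}" "set c \<inter> set S = {}"
        using X unfolding L2_def by (elim imageE CollectE conjE)
      then show ?thesis using outside by metis
    qed
    ultimately have "X \<notin> L2" if "X \<in> L1" for X
      using that by (metis inf.absorb1)
    then show ?thesis by blast
  qed
  ultimately show "splittable L" unfolding splittable_def using B(1) by blast
qed

end

section \<open>Cycles and cut vertices\<close>

text \<open>
  A cycle minus a vertex is a path, so it cannot get from \<open>P\<close> to \<open>Q\<close> without an edge between
  them.  The walk \<open>s\<close> starts at \<open>v\<close> if \<open>v\<close> lies on the cycle, and anywhere otherwise.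
\<close>

lemma cycle_avoids_cut_vertex:
  assumes c: "is_cycle G c" and PQ: "set c \<subseteq> P \<union> Q \<union> {v}" "v \<notin> P" "v \<notin> Q"
    and cut: "\<And>a b. {a, b} \<in> snd G \<Longrightarrow> a \<in> P \<inter> set c \<Longrightarrow> b \<in> Q \<inter> set c \<Longrightarrow> False"
  shows "set c \<subseteq> P \<union> {v} \<or> set c \<subseteq> Q \<union> {v}"
proof -
  define n where "n = length c"
  have n: "3 \<le> n" and dc: "distinct c" using c by (auto simp: is_cycle_def n_def)
  obtain t where t: "t < n" "v \<in> set c \<Longrightarrow> c ! t = v"
    using n in_set_conv_nth[of v c] by (cases "v \<in> set c") (force simp: n_def)+
  have lt: "m mod n < n" for m by (rule mod_less_divisor) (use n in linarith)
  define s where "s k = c ! ((t + k) mod n)" for k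
  have mem: "s k \<in> set c" for k
    using lt by (auto simp: s_def n_def intro!: nth_mem)
  have adj: "{s k, s (Suc k)} \<in> snd G" for k
  proof -
    have "(t + k) mod n < n" by (rule lt)
    then have "{c ! ((t + k) mod n), c ! (Suc ((t + k) mod n) mod n)} \<in> cycle_edges c"
      by (auto simp: cycle_edges_def n_def)
    then show ?thesis using c by (auto simp: s_def is_cycle_def mod_Suc_eq)
  qed
  have nv: "s k \<noteq> v" if "0 < k" "k < n" for k
  proof
    assume sk: "s k = v"
    then have "c ! t = v" using t(2) mem by metis
    then have "c ! ((t + k) mod n) = c ! t" using sk by (simp add: s_def)
    then have "(t + k) mod n = t"
      using nth_eq_iff_index_eq[OF dc, of "(t + k) mod n" t] lt[of "t + k"] t(1) by (simp add: n_def)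
    show False
    proof (cases "t + k < n")
      case True
      then show False using \<open>(t + k) mod n = t\<close> that by simp
    next
      case False
      then have "(t + k) mod n = t + k - n" using that t(1) by (simp add: le_mod_geq)
      then show False using \<open>(t + k) mod n = t\<close> that False by linarith
    qed
  qed
  have cover: "\<exists>k < n. s k = x" if x: "x \<in> set c" for x
  proof -
    obtain i where i: "i < n" "x = c ! i" using x by (auto simp: in_set_conv_nth n_def)
    show ?thesis
    proof (cases "t \<le> i")
      case True
      then show ?thesis using i by (intro exI[of _ "i - t"]) (simp add: s_def)
    next
      case False
      have "t + (i + n - t) = i + n" using t(1) by simp
      then show ?thesis using i t(1) False by (intro exI[of _ "i + n - t"]) (simp add: s_def)
    qed
  qed
  have walk: "set c \<subseteq> U \<union> {v}"
    if UW: "set c \<subseteq> U \<union> W \<union> {v}" "s 1 \<in> U"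
      and cutU: "\<And>a b. {a, b} \<in> snd G \<Longrightarrow> a \<in> U \<inter> set c \<Longrightarrow> b \<in> W \<inter> set c \<Longrightarrow> False" for U W
  proof
    have s: "s k \<in> U" if "0 < k" "k < n" for k
      using that
    proof (induction k)
      case (Suc k)
      show ?case
      proof (cases "k = 0")
        case False
        then have "s k \<in> U" using Suc by simp
        then have "s (Suc k) \<notin> W" using cutU[OF adj[of k]] mem by blast
        then show ?thesis using UW(1) mem[of "Suc k"] nv[OF Suc.prems] by blast
      qed (use UW(2) in simp)
    qed simp
    fix x assume "x \<in> set c"
    then obtain k where k: "k < n" "s k = x" using cover by blast
    show "x \<in> U \<union> {v}"
    proof (cases "k = 0")
      case True
      have "s 0 \<notin> W" using cutU[of "s 1" "s 0"] adj[of 0] UW(2) mem by (auto simp: insert_commute)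
      then show ?thesis using UW(1) mem[of 0] k True by blast
    qed (use s k in auto)
  qed
  have "s 1 \<in> P \<union> Q" using PQ(1) mem[of 1] nv[of 1] n by auto
  then show ?thesis
  proof
    assume "s 1 \<in> P"
    then show ?thesis using walk[of P Q] PQ(1) cut by blast
  next
    assume "s 1 \<in> Q"
    then show ?thesis using walk[of Q P] PQ(1) cut by (metis Un_commute insert_commute)
  qed
qed

lemma cycle_two_neighbours:
  assumes c: "is_cycle G c" and v: "v \<in> set c"
  obtains a b where "a \<noteq> b" "a \<in> set c" "b \<in> set c" "{v, a} \<in> snd G" "{v, b} \<in> snd G"
proof -
  define n where "n = length c"
  have n: "3 \<le> n" and dc: "distinct c" using c by (auto simp: is_cycle_def n_def)
  obtain i where i: "i < n" "v = c ! i" using v by (auto simp: in_set_conv_nth n_def)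
  define j where "j = (if i = 0 then n - 1 else i - 1)"
  define k where "k = (if i = n - 1 then 0 else Suc i)"
  have jk: "j < n" "k < n" "j \<noteq> k" "Suc j mod n = i" "Suc i mod n = k"
    using i n by (auto simp: j_def k_def)
  have "{c ! i, c ! (Suc i mod n)} \<in> cycle_edges c" "{c ! j, c ! (Suc j mod n)} \<in> cycle_edges c"
    using i jk by (auto simp: cycle_edges_def n_def)
  then have "{c ! i, c ! k} \<in> snd G" "{c ! i, c ! j} \<in> snd G"
    using c by (auto simp: is_cycle_def jk insert_commute)
  moreover have "c ! k \<noteq> c ! j" using jk dc by (simp add: nth_eq_iff_index_eq n_def)
  ultimately show ?thesis using that[of "c ! k" "c ! j"] i jk by (simp add: n_def)
qed

lemma cycle_card: "is_cycle G c \<Longrightarrow> 3 \<le> card (set c)"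
  by (simp add: is_cycle_def distinct_card)

text \<open>
  Some member of the family has every one of the three sets inside or outside, and both occur.
\<close>

definition sorted_by :: "'v set set \<Rightarrow> 'v set \<Rightarrow> 'v set \<Rightarrow> 'v set \<Rightarrow> bool" where
  "sorted_by F X Y Z \<longleftrightarrow> (\<exists>S \<in> F. (\<forall>W \<in> {X, Y, Z}. W \<subseteq> S \<or> W \<inter> S = {}) \<and>
     (\<exists>W \<in> {X, Y, Z}. W \<subseteq> S) \<and> (\<exists>W \<in> {X, Y, Z}. W \<inter> S = {}))"

lemma sorted_by_swap:
  "sorted_by F X Y Z \<Longrightarrow> sorted_by F Y X Z" "sorted_by F X Y Z \<Longrightarrow> sorted_by F X Z Y"
  "sorted_by F X Y Z \<Longrightarrow> sorted_by F Z Y X" "sorted_by F X Y Z \<Longrightarrow> sorted_by F Y Z X"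
  "sorted_by F X Y Z \<Longrightarrow> sorted_by F Z X Y"
  unfolding sorted_by_def by (simp_all add: insert_commute)

lemma sorted_byI:
  assumes "S \<in> F" "X \<subseteq> S" "Z \<inter> S = {}" "Y \<subseteq> S \<or> Y \<inter> S = {}"
  shows "sorted_by F X Y Z"
  unfolding sorted_by_def
proof (rule bexI[OF _ assms(1)], intro conjI)
  show "\<exists>W \<in> {X, Y, Z}. W \<subseteq> S" using assms(2) by (intro bexI[of _ X]) simp_all
  show "\<exists>W \<in> {X, Y, Z}. W \<inter> S = {}" using assms(3) by (intro bexI[of _ Z]) simp_all
qed (use assms in simp)

lemma card_split3:
  assumes "finite U" "A \<subseteq> U" "B \<subseteq> U" "C \<subseteq> U" "A \<inter> B = {}" "A \<inter> C = {}" "B \<inter> C = {}"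
  shows "card A + card B + card C \<le> card U"
proof -
  have fin: "finite A" "finite B" "finite C" using assms finite_subset by blast+
  have "card (A \<union> B \<union> C) = card A + card B + card C"
    using fin assms by (simp add: card_Un_disjoint Int_Un_distrib2)
  moreover have "card (A \<union> B \<union> C) \<le> card U" using assms by (intro card_mono) auto
  ultimately show ?thesis by simp
qed

text \<open>
  Since \<open>Y\<close> takes three of the six elements, \<open>S\<close> and \<open>S'\<close> have at most three elements together.  As they are not both singletons, one is a singleton and the other a pair within \<open>C\<close>.
\<close>

lemma two_crossing_sides:
  assumes "finite U" "card U = 6" "C \<subseteq> U" "card C = 3" "S \<subseteq> U" "S' \<subseteq> U" "Y \<subseteq> U" "3 \<le> card Y"
    "S \<inter> S' = {}" "S \<inter> Y = {}" "S' \<inter> Y = {}"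
    "(\<exists>v \<in> C. S = {v}) \<or> 2 \<le> card (S \<inter> C)" "(\<exists>v \<in> C. S' = {v}) \<or> 2 \<le> card (S' \<inter> C)"
    "\<not> ((\<exists>v \<in> C. S = {v}) \<and> (\<exists>v \<in> C. S' = {v}))"
  shows "S \<union> S' = C"
proof -
  have fin: "finite S" "finite S'" "finite C"
    by (rule finite_subset[OF _ assms(1)], rule assms)+
  have le: "card S + card S' \<le> 3" using card_split3[of U S S' Y] assms(1,2,5-11) by linarith
  have "card (S \<inter> C) \<le> card S" "card (S' \<inter> C) \<le> card S'" using fin by (auto intro: card_mono)
  then have "(\<exists>v \<in> C. S = {v}) \<and> card S' = 2 \<and> card (S' \<inter> C) = 2 \<or>
    (\<exists>v \<in> C. S' = {v}) \<and> card S = 2 \<and> card (S \<inter> C) = 2"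
    using le assms(12-14) by auto
  then have sub: "S \<subseteq> C \<and> S' \<subseteq> C" and c: "card S + card S' = 3"
    using fin card_subset_eq[of S' "S' \<inter> C"] card_subset_eq[of S "S \<inter> C"] by auto
  have "card (S \<union> S') = card C" using card_Un_disjoint[OF fin(1,2) assms(9)] c assms(4) by simp
  then show ?thesis using card_subset_eq[OF fin(3)] sub by blast
qed


text \<open>
  If the cycle used at most one vertex \<open>v\<close> of \<open>C\<close>, then \<open>v\<close> would be a cut vertex unless it is the
  whole part of the cycle in \<open>U\<close>.
\<close>

lemma crossing_side:
  assumes c: "is_cycle G c" "set c \<subseteq> U \<union> V" "U \<inter> V = {}" "set c \<inter> U \<noteq> {}" "set c \<inter> V \<noteq> {}"
    and cross: "\<And>a b. {a, b} \<in> snd G \<Longrightarrow> a \<in> U \<Longrightarrow> b \<in> V \<Longrightarrow> a \<in> C"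
    and irr: "\<And>a. {a} \<notin> snd G"
  shows "(\<exists>v \<in> C. set c \<inter> U = {v}) \<or> 2 \<le> card (set c \<inter> U \<inter> C)"
proof (rule disjCI)
  assume "\<not> 2 \<le> card (set c \<inter> U \<inter> C)"
  then have "card (set c \<inter> U \<inter> C) = 0 \<or> card (set c \<inter> U \<inter> C) = 1" by linarith
  then have "set c \<inter> U \<inter> C = {} \<or> (\<exists>v. set c \<inter> U \<inter> C = {v})"
    by (auto simp: card_1_singleton_iff)
  then obtain v where v: "v \<in> set c" "v \<in> U" "set c \<inter> U \<inter> C \<subseteq> {v}" using c(4) by blast
  have "set c \<subseteq> (set c \<inter> U - {v}) \<union> {v} \<or> set c \<subseteq> (set c \<inter> V) \<union> {v}"
  proof (rule cycle_avoids_cut_vertex[OF c(1)])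
    show "set c \<subseteq> set c \<inter> U - {v} \<union> set c \<inter> V \<union> {v}" using c(2) by blast
    show "v \<notin> set c \<inter> V" using v c(3) by blast
    fix a b assume "{a, b} \<in> snd G" "a \<in> (set c \<inter> U - {v}) \<inter> set c" "b \<in> set c \<inter> V \<inter> set c"
    then show False using cross v(3) by blast
  qed simp
  then have one: "set c \<inter> U = {v}" using v c(2,3,5) by blast
  obtain a b where ab: "a \<noteq> b" "a \<in> set c" "{v, a} \<in> snd G" by (rule cycle_two_neighbours[OF c(1) v(1)])
  have "a \<noteq> v" using ab(3) irr by auto
  then have "a \<in> V" using one ab(2) c(2) by blast
  then show "\<exists>v \<in> C. set c \<inter> U = {v}" using cross[OF ab(3) v(2)] one by blast
qed

lemma single_crossing:
  assumes c: "is_cycle G c" "set c \<subseteq> U \<union> V" "set c \<inter> U = {v}" and irr: "\<And>a. {a} \<notin> snd G"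
  obtains a b where "a \<noteq> b" "a \<in> set c" "b \<in> set c" "a \<in> V" "b \<in> V" "{v, a} \<in> snd G" "{v, b} \<in> snd G"
proof -
  have "v \<in> set c" using c(3) by blast
  then obtain a b where ab: "a \<noteq> b" "a \<in> set c" "b \<in> set c" "{v, a} \<in> snd G" "{v, b} \<in> snd G"
    by (rule cycle_two_neighbours[OF c(1)])
  have "a \<noteq> v" "b \<noteq> v" using ab(4,5) irr by auto
  then have "a \<in> V" "b \<in> V" using ab c(2,3) by blast+
  then show ?thesis using that ab by blast
qed

fun pairs :: "'a list \<Rightarrow> ('a \<times> 'a) list" where
  "pairs [] = []"
| "pairs (x # xs) = map (Pair x) xs @ pairs xs"

lemma pairs_cover: "x \<in> set xs \<Longrightarrow> y \<in> set xs \<Longrightarrow> x \<noteq> y \<Longrightarrow> (x, y) \<in> set (pairs xs) \<or> (y, x) \<in> set (pairs xs)"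
  by (induction xs) auto

lemma pairs_distinct: "distinct xs \<Longrightarrow> (x, y) \<in> set (pairs xs) \<Longrightarrow> x \<in> set xs \<and> y \<in> set xs \<and> x \<noteq> y"
  by (induction xs) auto

lemma nsets_2_pairs:
  assumes "distinct xs"
  shows "nsets (set xs) 2 = (\<lambda>(x, y). {x, y}) ` set (pairs xs)"
proof (intro equalityI subsetI)
  fix e assume "e \<in> nsets (set xs) 2"
  then obtain x y where e: "e = {x, y}" "x \<in> set xs" "y \<in> set xs" "x \<noteq> y"
    by (auto simp: nsets_def card_2_iff)
  have "(x, y) \<in> set (pairs xs) \<or> (y, x) \<in> set (pairs xs)" using pairs_cover[OF e(2-4)] .
  then show "e \<in> (\<lambda>(x, y). {x, y}) ` set (pairs xs)" by (auto simp: e(1) image_iff insert_commute)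
next
  fix e assume "e \<in> (\<lambda>(x, y). {x, y}) ` set (pairs xs)"
  then obtain x y where "e = {x, y}" "(x, y) \<in> set (pairs xs)" by auto
  then show "e \<in> nsets (set xs) 2"
    using pairs_distinct[OF assms, of x y] by (auto simp: nsets_def)
qed

section \<open>Two copies of \<open>K\<^sub>6\<close> joined by a hexagon\<close>

definition left :: "vertex list" where "left = [Num 1, Num 2, Num 3, Num 4, Num 5, Num 6]"
definition right :: "vertex list" where "right = [VA, VB, VC, VD, VE, VF]"
definition bridges :: "(vertex \<times> vertex) list" where
  "bridges = [(Num 4, VA), (Num 4, VC), (Num 5, VA), (Num 5, VB), (Num 6, VB), (Num 6, VC)]"

lemma hexagon_graph:
  "K6_K6_hexagon = (set left \<union> set right,
     (\<lambda>(x, y). {x, y}) ` set (pairs left @ pairs right @ bridges))"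
proof -
  have "Num ` {1..6} = set left" by (force simp: left_def)
  moreover have "{VA, VB, VC, VD, VE, VF} = set right" by (auto simp: right_def)
  moreover have "distinct left" "distinct right" by (simp_all add: left_def right_def)
  ultimately show ?thesis
    by (simp add: K6_K6_hexagon_def nsets_2_pairs image_Un Un_assoc) (simp add: bridges_def)
qed

lemma left_right_disjoint: "set left \<inter> set right = {}" by (simp add: left_def right_def)

lemma hexagon_crossing:
  assumes "{a, b} \<in> snd K6_K6_hexagon" "a \<in> set left" "b \<in> set right"
  shows "(a, b) \<in> set bridges"
proof -
  have d: "distinct left" "distinct right" by (simp_all add: left_def right_def)
  have "b \<notin> set left" "a \<notin> set right" using assms left_right_disjoint by blast+
  obtain x y where xy: "{a, b} = {x, y}" "(x, y) \<in> set (pairs left @ pairs right @ bridges)"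
    using assms(1) by (auto simp: hexagon_graph)
  have "(x, y) \<notin> set (pairs left)" "(x, y) \<notin> set (pairs right)"
    using pairs_distinct[OF d(1)] pairs_distinct[OF d(2)] xy(1) \<open>b \<notin> set left\<close> \<open>a \<notin> set right\<close>
    by (metis doubleton_eq_iff)+
  then have b: "(x, y) \<in> set bridges" using xy(2) by simp
  have "x \<in> set left" using b by (auto simp: bridges_def left_def)
  then have "x = a" "y = b" using xy(1) \<open>b \<notin> set left\<close> by (auto simp: doubleton_eq_iff)
  then show ?thesis using b by simp
qed

lemma hexagon_irrefl: "{a} \<notin> snd K6_K6_hexagon"
  using finite_simple_graph_K6_K6_hexagon unfolding finite_simple_graph_def by force

text \<open>
  Any two hexagon vertices of one copy have a common neighbour on the hexagon.  Hence two
  disjoint cycles cannot both meet this copy in a single vertex.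
\<close>

lemma bridges_common:
  "\<forall>p \<in> set bridges. \<forall>q \<in> set bridges. fst p = fst q \<and> snd p \<noteq> snd q \<longrightarrow>
     (\<forall>r \<in> set bridges. \<forall>s \<in> set bridges. fst r = fst s \<and> snd r \<noteq> snd s \<and> fst p \<noteq> fst r \<longrightarrow>
       {snd p, snd q} \<inter> {snd r, snd s} \<noteq> {})"
  "\<forall>p \<in> set bridges. \<forall>q \<in> set bridges. snd p = snd q \<and> fst p \<noteq> fst q \<longrightarrow>
     (\<forall>r \<in> set bridges. \<forall>s \<in> set bridges. snd r = snd s \<and> fst r \<noteq> fst s \<and> snd p \<noteq> snd r \<longrightarrow>
       {fst p, fst q} \<inter> {fst r, fst s} \<noteq> {})"
  by code_simp+

text \<open>
  The first tetrahedron contains the right copy and lies above the plane of the left copy.  The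
  next ten also contain the right copy, and meet that plane in a triangle around a vertex, an
  edge or a face.  Then come six thin neighbourhoods of faces, and the last one surrounds \<open>D, E, F\<close>.
\<close>

definition hex_certs :: "(vertex list \<times> ipt list) list" where
  "hex_certs =
    [([VA, VB, VC, VD, VE, VF],
      [(0, 0, 1, 0), (1, 0, 4, 0), (0, 1, 4, 0), (0, 0, 0, 1)]),
    ([Num 4, VA, VB, VC, VD, VE, VF],
      [(3, 1, 13, -1), (-2, -3, 13, 3), (-1, -3, 13, 0), (3, 1, 14, -1)]),
    ([Num 5, VA, VB, VC, VD, VE, VF],
      [(2, -3, 13, 3), (3, 1, 13, -1), (0, 1, 13, 0), (2, -3, 14, 3)]),
    ([Num 6, VA, VB, VC, VD, VE, VF],
      [(1, 1, 9, 0), (0, -3, 9, 1), (-3, 0, 9, 2), (1, 1, 10, 0)]),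
    ([Num 4, Num 5, VA, VB, VC, VD, VE, VF],
      [(3, 1, 13, -1), (2, -3, 13, 3), (0, 2, 13, 3), (3, 1, 14, -1)]),
    ([Num 4, Num 6, VA, VB, VC, VD, VE, VF],
      [(1, 0, 4, 0), (-2, -3, 4, 3), (-1, 0, 4, 1), (1, 0, 5, 0)]),
    ([Num 5, Num 6, VA, VB, VC, VD, VE, VF],
      [(1, 3, 8, 0), (2, -3, 8, 3), (1, 0, 8, 0), (1, 3, 9, 0)]),
    ([Num 4, Num 5, Num 6, VA, VB, VC, VD, VE, VF],
      [(1, 0, 8, 0), (2, -3, 8, 3), (1, -1, 8, 0), (1, 0, 9, 0)]),
    ([Num 2, Num 4, Num 5, VA, VB, VC, VD, VE, VF],
      [(3, 1, 13, -1), (1, 0, 13, 0), (1, -1, 13, 0), (3, 1, 14, -1)]),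
    ([Num 1, Num 5, Num 6, VA, VB, VC, VD, VE, VF],
      [(1, 3, 7, 0), (1, 0, 7, 1), (1, 1, 7, 0), (1, 3, 8, 0)]),
    ([Num 3, Num 4, Num 6, VA, VB, VC, VD, VE, VF],
      [(1, -3, 12, 0), (-2, -3, 12, 3), (1, 0, 12, 1), (1, -3, 13, 0)]),
    ([Num 2, Num 3, Num 6],
      [(0, 0, -8, 1), (-2, 0, -8, 1), (-1, -2, -8, 1), (0, 0, 1, 1)]),
    ([Num 1, Num 2, Num 6],
      [(0, 0, -8, 1), (-2, 0, -8, 1), (0, 2, -8, 1), (0, 0, 1, 1)]),
    ([Num 1, Num 3, Num 4],
      [(0, 1, -3, 0), (-1, 2, -3, 0), (0, 2, -3, -1), (0, 1, 1, 0)]),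
    ([Num 1, Num 2, Num 4],
      [(-1, 1, -3, 0), (0, 1, -3, 0), (-2, 0, -3, 1), (0, 1, 1, 0)]),
    ([Num 2, Num 3, Num 5],
      [(-1, -1, -3, 0), (-1, 0, -3, 0), (-1, -1, -3, 1), (-1, -1, 2, 1)]),
    ([Num 1, Num 3, Num 5],
      [(0, 1, -2, 0), (1, 1, -2, 0), (1, 2, -2, -1), (1, 1, 5, 0)]),
    ([VD, VE, VF],
      [(0, 0, 1, -1), (0, 0, 1, 0), (1, 0, 1, 0), (0, 1, 1, 0)])]"

definition hex_family :: "vertex set set" where "hex_family = set ` fst ` set hex_certs"

lemma hex_family_members:
  "set right \<in> hex_family" "set right \<union> {Num 4, Num 5, Num 6} \<in> hex_family" "{VD, VE, VF} \<in> hex_family"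
  "\<forall>S \<in> set (subseqs left). card (set S) \<le> 3 \<and>
     ((\<exists>v \<in> {Num 4, Num 5, Num 6}. set S = {v}) \<or> 2 \<le> card (set S \<inter> {Num 4, Num 5, Num 6})) \<longrightarrow>
     set right \<union> set S \<in> hex_family \<or> card (set S) = 3 \<and> set left - set S \<in> hex_family"
  by code_simp+

abbreviation "core \<equiv> {Num 4, Num 5, Num 6}"
abbreviation "core' \<equiv> {VA, VB, VC}"

definition hex_cycle :: "vertex set \<Rightarrow> bool" where
  "hex_cycle X \<longleftrightarrow> (\<exists>c. is_cycle K6_K6_hexagon c \<and> set c = X)"

lemma hex_cycle_sub: "hex_cycle X \<Longrightarrow> X \<subseteq> set left \<union> set right"
  by (auto simp: hex_cycle_def is_cycle_def hexagon_graph)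

lemma hex_cycle_card: "hex_cycle X \<Longrightarrow> 3 \<le> card X"
  using cycle_card unfolding hex_cycle_def by blast

lemma hex_left_side:
  assumes "hex_cycle X" "X \<inter> set left \<noteq> {}" "X \<inter> set right \<noteq> {}"
  shows "(\<exists>v \<in> core. X \<inter> set left = {v}) \<or> 2 \<le> card (X \<inter> set left \<inter> core)"
proof -
  obtain c where c: "is_cycle K6_K6_hexagon c" "set c = X" using assms(1) by (auto simp: hex_cycle_def)
  have "a \<in> core" if "{a, b} \<in> snd K6_K6_hexagon" "a \<in> set left" "b \<in> set right" for a b
    using hexagon_crossing[OF that] by (auto simp: bridges_def)
  then show ?thesis
    using crossing_side[of K6_K6_hexagon c "set left" "set right" core] c assms hex_cycle_sub[OF assms(1)]
      left_right_disjoint hexagon_irrefl by blast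
qed

lemma hex_right_side:
  assumes "hex_cycle X" "X \<inter> set left \<noteq> {}" "X \<inter> set right \<noteq> {}"
  shows "(\<exists>v \<in> core'. X \<inter> set right = {v}) \<or> 2 \<le> card (X \<inter> set right \<inter> core')"
proof -
  obtain c where c: "is_cycle K6_K6_hexagon c" "set c = X" using assms(1) by (auto simp: hex_cycle_def)
  have cross: "a \<in> core'" if "{a, b} \<in> snd K6_K6_hexagon" "a \<in> set right" "b \<in> set left" for a b
  proof -
    have "{b, a} \<in> snd K6_K6_hexagon" using that(1) by (simp add: insert_commute)
    then show ?thesis using hexagon_crossing[OF _ that(3,2)] by (auto simp: bridges_def)
  qed
  have sub: "set c \<subseteq> set right \<union> set left" using hex_cycle_sub[OF assms(1)] c(2) by blast
  show ?thesis
    unfolding c(2)[symmetric]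
  proof (rule crossing_side[OF c(1) sub _ _ _ cross hexagon_irrefl])
    show "set right \<inter> set left = {}" using left_right_disjoint by (simp only: Int_commute)
  qed (use c(2) assms in simp_all)
qed

lemma singles_clash_left:
  assumes "hex_cycle X" "hex_cycle Y" "X \<inter> Y = {}" "X \<inter> set left = {v}" "Y \<inter> set left = {w}"
  shows False
proof -
  obtain c d where c: "is_cycle K6_K6_hexagon c" "set c = X" and d: "is_cycle K6_K6_hexagon d" "set d = Y"
    using assms(1,2) by (auto simp: hex_cycle_def)
  obtain a b where ab: "a \<noteq> b" "a \<in> X" "b \<in> X" "a \<in> set right" "b \<in> set right"
    "{v, a} \<in> snd K6_K6_hexagon" "{v, b} \<in> snd K6_K6_hexagon"
    using single_crossing[OF c(1), of "set left" "set right" v] hex_cycle_sub[OF assms(1)] assms(4) hexagon_irrefl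
    unfolding c(2) by blast
  obtain a' b' where ab': "a' \<noteq> b'" "a' \<in> Y" "b' \<in> Y" "a' \<in> set right" "b' \<in> set right"
    "{w, a'} \<in> snd K6_K6_hexagon" "{w, b'} \<in> snd K6_K6_hexagon"
    using single_crossing[OF d(1), of "set left" "set right" w] hex_cycle_sub[OF assms(2)] assms(5) hexagon_irrefl
    unfolding d(2) by blast
  have v: "v \<in> set left" "w \<in> set left" "v \<noteq> w" using assms(3-5) by blast+
  have "(v, a) \<in> set bridges" "(v, b) \<in> set bridges" "(w, a') \<in> set bridges" "(w, b') \<in> set bridges"
    using hexagon_crossing ab ab' v by blast+
  then have "{a, b} \<inter> {a', b'} \<noteq> {}"
    using bridges_common(1)[rule_format, of "(v, a)" "(v, b)" "(w, a')" "(w, b')"] ab(1) ab'(1) v(3) by simp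
  then show False using ab ab' assms(3) by blast
qed

lemma singles_clash_right:
  assumes "hex_cycle X" "hex_cycle Y" "X \<inter> Y = {}" "X \<inter> set right = {v}" "Y \<inter> set right = {w}"
  shows False
proof -
  obtain c d where c: "is_cycle K6_K6_hexagon c" "set c = X" and d: "is_cycle K6_K6_hexagon d" "set d = Y"
    using assms(1,2) by (auto simp: hex_cycle_def)
  have sub: "X \<subseteq> set right \<union> set left" "Y \<subseteq> set right \<union> set left"
    using hex_cycle_sub assms(1,2) by blast+
  obtain a b where ab: "a \<noteq> b" "a \<in> X" "b \<in> X" "a \<in> set left" "b \<in> set left"
    "{v, a} \<in> snd K6_K6_hexagon" "{v, b} \<in> snd K6_K6_hexagon"
    using single_crossing[OF c(1), of "set right" "set left" v] sub(1) assms(4) hexagon_irrefl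
    unfolding c(2) by blast
  obtain a' b' where ab': "a' \<noteq> b'" "a' \<in> Y" "b' \<in> Y" "a' \<in> set left" "b' \<in> set left"
    "{w, a'} \<in> snd K6_K6_hexagon" "{w, b'} \<in> snd K6_K6_hexagon"
    using single_crossing[OF d(1), of "set right" "set left" w] sub(2) assms(5) hexagon_irrefl
    unfolding d(2) by blast
  have v: "v \<in> set right" "w \<in> set right" "v \<noteq> w" using assms(3-5) by blast+
  have "(a, v) \<in> set bridges" "(b, v) \<in> set bridges" "(a', w) \<in> set bridges" "(b', w) \<in> set bridges"
    using hexagon_crossing[of a v] hexagon_crossing[of b v] hexagon_crossing[of a' w]
      hexagon_crossing[of b' w] ab ab' v by (simp_all add: insert_commute)
  then have "{a, b} \<inter> {a', b'} \<noteq> {}"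
    using bridges_common(2)[rule_format, of "(a, v)" "(b, v)" "(a', w)" "(b', w)"] ab(1) ab'(1) v(3) by simp
  then show False using ab ab' assms(3) by blast
qed

abbreviation "mixed X \<equiv> X \<inter> set left \<noteq> {} \<and> X \<inter> set right \<noteq> {}"

lemma card_left_right: "card (set left) = 6" "card (set right) = 6"
  by (simp_all add: left_def right_def)

lemma core_sub: "core \<subseteq> set left" "core' \<subseteq> set right" "card core = 3" "card core' = 3"
  by (simp_all add: left_def right_def)

lemma unmixed:
  assumes "hex_cycle X" "\<not> mixed X"
  shows "X \<subseteq> set left \<or> X \<subseteq> set right"
  using hex_cycle_sub[OF assms(1)] assms(2) by blast

lemma hex_side_room:
  assumes "hex_cycle Y" "hex_cycle Z" "Y \<inter> Z = {}" "X \<inter> Y = {}" "X \<inter> Z = {}" "X \<inter> U \<noteq> {}"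
    "Y \<subseteq> U" "Z \<subseteq> U" "finite U" "card U = 6"
  shows False
proof -
  have "card (X \<inter> U) + card Y + card Z \<le> card U"
    by (rule card_split3) (use assms in blast)+
  moreover have "0 < card (X \<inter> U)" using assms by (simp add: card_gt_0_iff)
  ultimately show False using hex_cycle_card[OF assms(1)] hex_cycle_card[OF assms(2)] assms(10) by linarith
qed

text \<open>
  The left part \<open>S\<close> of \<open>X\<close> has at most three vertices.  It is enclosed with the right copy when it
  is contained in a face; otherwise it is a triangle and its complement is a face.
\<close>

lemma hex_one_mixed:
  assumes X: "hex_cycle X" "mixed X" and Y: "hex_cycle Y" "Y \<subseteq> set left" and Z: "hex_cycle Z" "Z \<subseteq> set right"
    and disj: "X \<inter> Y = {}" "X \<inter> Z = {}"
  shows "sorted_by hex_family X Y Z"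
proof -
  define S where "S = X \<inter> set left"
  have fin: "finite S" "finite Y" using Y(2) finite_subset by (auto simp: S_def)
  have SY: "S \<inter> Y = {}" "S \<union> Y \<subseteq> set left" using disj(1) Y(2) by (auto simp: S_def)
  have "card S + card Y \<le> card (set left)"
    using card_Un_disjoint[OF fin SY(1)] card_mono[OF _ SY(2)] by simp
  then have c: "card S \<le> 3" "card Y \<le> 6 - card S"
    using hex_cycle_card[OF Y(1)] by (simp_all add: card_left_right)
  have "S \<in> set ` set (subseqs left)" unfolding subseqs_powset by (simp add: S_def)
  then obtain xs where xs: "S = set xs" "xs \<in> set (subseqs left)" by (rule imageE)
  have side: "(\<exists>v \<in> core. S = {v}) \<or> 2 \<le> card (S \<inter> core)"
    unfolding S_def by (rule hex_left_side) (use X in blast)+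
  have "set right \<union> S \<in> hex_family \<or> card S = 3 \<and> set left - S \<in> hex_family"
    using bspec[OF hex_family_members(4) xs(2)] c(1) side unfolding xs(1) by argo
  then show ?thesis
  proof
    assume A: "set right \<union> S \<in> hex_family"
    have "X \<subseteq> set right \<union> S" using hex_cycle_sub[OF X(1)] unfolding S_def by blast
    moreover have "Y \<inter> (set right \<union> S) = {}"
      using Y(2) disj(1) left_right_disjoint unfolding S_def by blast
    moreover have "Z \<subseteq> set right \<union> S" using Z(2) by blast
    ultimately have "sorted_by hex_family X Z Y" using sorted_byI[OF A] by simp
    then show ?thesis by (rule sorted_by_swap)
  next
    assume A: "card S = 3 \<and> set left - S \<in> hex_family"
    have "Y \<subseteq> set left - S" using Y(2) disj(1) unfolding S_def by blast
    moreover have "X \<inter> (set left - S) = {}" unfolding S_def by blast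
    moreover have "Z \<inter> (set left - S) = {}" using Z(2) left_right_disjoint by blast
    ultimately have "sorted_by hex_family Y X Z" using sorted_byI[OF A[THEN conjunct2]] by simp
    then show ?thesis by (rule sorted_by_swap)
  qed
qed

lemma hex_one_mixed':
  assumes X: "hex_cycle X" "mixed X" and Y: "hex_cycle Y" "\<not> mixed Y" and Z: "hex_cycle Z" "\<not> mixed Z"
    and disj: "X \<inter> Y = {}" "X \<inter> Z = {}" "Y \<inter> Z = {}"
  shows "sorted_by hex_family X Y Z"
proof -
  have "\<not> (Y \<subseteq> set left \<and> Z \<subseteq> set left)"
    using hex_side_room[of Y Z X "set left"] X Y Z disj card_left_right by auto
  moreover have "\<not> (Y \<subseteq> set right \<and> Z \<subseteq> set right)"
    using hex_side_room[of Y Z X "set right"] X Y Z disj card_left_right by auto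
  ultimately consider "Y \<subseteq> set left" "Z \<subseteq> set right" | "Z \<subseteq> set left" "Y \<subseteq> set right"
    using unmixed[OF Y] unmixed[OF Z] by blast
  then show ?thesis
  proof cases
    case 1
    then show ?thesis using hex_one_mixed[OF X Y(1) _ Z(1)] disj by blast
  next
    case 2
    then have "sorted_by hex_family X Z Y" using hex_one_mixed[OF X Z(1) _ Y(1)] disj by blast
    then show ?thesis by (rule sorted_by_swap)
  qed
qed

text \<open>
  The two crossing cycles use up the hexagon vertices of the copy that contains \<open>Y\<close>.  In the
  left copy they are a face, in the right copy they lie below the other three vertices.
\<close>

lemma hex_two_mixed:
  assumes X: "hex_cycle X" "mixed X" and X': "hex_cycle X'" "mixed X'" and Y: "hex_cycle Y" "\<not> mixed Y"
    and disj: "X \<inter> X' = {}" "X \<inter> Y = {}" "X' \<inter> Y = {}"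
  shows "sorted_by hex_family X X' Y"
proof -
  consider "Y \<subseteq> set left" | "Y \<subseteq> set right" using unmixed[OF Y] by blast
  then show ?thesis
  proof cases
    case 1
    have "X \<inter> set left \<union> X' \<inter> set left = core"
    proof (rule two_crossing_sides[of "set left" core _ _ Y])
      show "(\<exists>v \<in> core. X \<inter> set left = {v}) \<or> 2 \<le> card (X \<inter> set left \<inter> core)"
        by (rule hex_left_side) (use X in blast)+
      show "(\<exists>v \<in> core. X' \<inter> set left = {v}) \<or> 2 \<le> card (X' \<inter> set left \<inter> core)"
        by (rule hex_left_side) (use X' in blast)+
      show "\<not> ((\<exists>v \<in> core. X \<inter> set left = {v}) \<and> (\<exists>v \<in> core. X' \<inter> set left = {v}))"
        using singles_clash_left[OF X(1) X'(1) disj(1)] by blast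
    qed (use 1 disj core_sub card_left_right hex_cycle_card[OF Y(1)] in auto)
    then have "X \<subseteq> set right \<union> core" "X' \<subseteq> set right \<union> core" "Y \<inter> (set right \<union> core) = {}"
    proof -
      assume eq: "X \<inter> set left \<union> X' \<inter> set left = core"
      show "X \<subseteq> set right \<union> core" unfolding eq[symmetric] using hex_cycle_sub[OF X(1)] by blast
      show "X' \<subseteq> set right \<union> core" unfolding eq[symmetric] using hex_cycle_sub[OF X'(1)] by blast
      show "Y \<inter> (set right \<union> core) = {}"
        unfolding eq[symmetric] using 1 disj left_right_disjoint by blast
    qed
    then show ?thesis using sorted_byI[OF hex_family_members(2)] by metis
  next
    case 2
    have eq: "X \<inter> set right \<union> X' \<inter> set right = core'"
    proof (rule two_crossing_sides[of "set right" core' _ _ Y])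
      show "(\<exists>v \<in> core'. X \<inter> set right = {v}) \<or> 2 \<le> card (X \<inter> set right \<inter> core')"
        by (rule hex_right_side) (use X in blast)+
      show "(\<exists>v \<in> core'. X' \<inter> set right = {v}) \<or> 2 \<le> card (X' \<inter> set right \<inter> core')"
        by (rule hex_right_side) (use X' in blast)+
      show "\<not> ((\<exists>v \<in> core'. X \<inter> set right = {v}) \<and> (\<exists>v \<in> core'. X' \<inter> set right = {v}))"
        using singles_clash_right[OF X(1) X'(1) disj(1)] by blast
    qed (use 2 disj core_sub card_left_right hex_cycle_card[OF Y(1)] in auto)
    define E where "E = {VD, VE, VF}"
    have r: "set right = core' \<union> E" "core' \<inter> E = {}" by (auto simp: right_def E_def)
    have "X \<inter> E = {}" "X' \<inter> E = {}" using eq r by blast+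
    moreover have "Y \<inter> core' = {}" using eq disj by blast
    then have "Y \<subseteq> E" using 2 r(1) by blast
    moreover have "E \<in> hex_family" using hex_family_members(3) by (simp add: E_def)
    ultimately have "sorted_by hex_family Y X X'" using sorted_byI[of E] by metis
    then show ?thesis by (rule sorted_by_swap)
  qed
qed

lemma hex_three_mixed:
  assumes X: "hex_cycle X" "mixed X" and Y: "hex_cycle Y" "mixed Y" and Z: "hex_cycle Z" "mixed Z"
    and disj: "X \<inter> Y = {}" "X \<inter> Z = {}" "Y \<inter> Z = {}"
  shows False
proof -
  have c: "card (W \<inter> set left \<inter> core) \<ge> 1 \<and> ((\<exists>v. W \<inter> set left = {v}) \<or> card (W \<inter> set left \<inter> core) \<ge> 2)"
    if "hex_cycle W" "mixed W" for W
  proof -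
    have "(\<exists>v \<in> core. W \<inter> set left = {v}) \<or> 2 \<le> card (W \<inter> set left \<inter> core)"
      by (rule hex_left_side[OF that(1) that(2)[THEN conjunct1] that(2)[THEN conjunct2]])
    then show ?thesis
    proof
      assume "\<exists>v \<in> core. W \<inter> set left = {v}"
      then obtain v where v: "v \<in> core" "W \<inter> set left = {v}" by blast
      then have "W \<inter> set left \<inter> core = {v}" by blast
      then show ?thesis using v by simp
    qed auto
  qed
  have "card (X \<inter> set left \<inter> core) + card (Y \<inter> set left \<inter> core) + card (Z \<inter> set left \<inter> core) \<le> card core"
  proof (rule card_split3)
    show "finite core" by simp
    show "X \<inter> set left \<inter> core \<inter> (Y \<inter> set left \<inter> core) = {}"
      "X \<inter> set left \<inter> core \<inter> (Z \<inter> set left \<inter> core) = {}"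
      "Y \<inter> set left \<inter> core \<inter> (Z \<inter> set left \<inter> core) = {}"
      using disj by blast+
  qed (rule Int_lower2)+
  then have "\<not> 2 \<le> card (X \<inter> set left \<inter> core)" "\<not> 2 \<le> card (Y \<inter> set left \<inter> core)"
    using c[OF X, THEN conjunct1] c[OF Y, THEN conjunct1] c[OF Z, THEN conjunct1] core_sub(3) by linarith+
  then have "(\<exists>v. X \<inter> set left = {v}) \<and> (\<exists>v. Y \<inter> set left = {v})"
    using c[OF X, THEN conjunct2] c[OF Y, THEN conjunct2] by argo
  then show False using singles_clash_left[OF X(1) Y(1) disj(1)] by blast
qed

lemma hex_no_mixed:
  assumes X: "hex_cycle X" "\<not> mixed X" and Y: "hex_cycle Y" "\<not> mixed Y" and Z: "hex_cycle Z" "\<not> mixed Z"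
    and disj: "X \<inter> Y = {}" "X \<inter> Z = {}" "Y \<inter> Z = {}"
  shows "sorted_by hex_family X Y Z"
proof -
  have ne: "X \<noteq> {}" using hex_cycle_card[OF X(1)] by auto
  have "\<not> (X \<subseteq> U \<and> Y \<subseteq> U \<and> Z \<subseteq> U)" if "finite U" "card U = 6" for U
    using hex_side_room[of Y Z X U] ne X(1) Y(1) Z(1) disj that by blast
  then have "\<not> (X \<subseteq> set left \<and> Y \<subseteq> set left \<and> Z \<subseteq> set left)"
    "\<not> (X \<subseteq> set right \<and> Y \<subseteq> set right \<and> Z \<subseteq> set right)"
    using card_left_right by auto
  moreover have "W \<subseteq> set right \<or> W \<inter> set right = {}" if "hex_cycle W" "\<not> mixed W" for W
    using unmixed[OF that] left_right_disjoint by blast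
  note this[OF X] this[OF Y] this[OF Z]
  moreover have "W \<inter> set right = {}" if "W \<subseteq> set left" for W
    using that left_right_disjoint by blast
  ultimately have "(X \<subseteq> set right \<or> Y \<subseteq> set right \<or> Z \<subseteq> set right) \<and>
    (X \<inter> set right = {} \<or> Y \<inter> set right = {} \<or> Z \<inter> set right = {})"
    using unmixed[OF X] unmixed[OF Y] unmixed[OF Z] by metis
  then show ?thesis
    using \<open>X \<subseteq> set right \<or> X \<inter> set right = {}\<close> \<open>Y \<subseteq> set right \<or> Y \<inter> set right = {}\<close>
      \<open>Z \<subseteq> set right \<or> Z \<inter> set right = {}\<close> hex_family_members(1)
    unfolding sorted_by_def by (intro bexI[of _ "set right"]) simp_all
qed

theorem hex_sorted:
  assumes "hex_cycle X" "hex_cycle Y" "hex_cycle Z" "X \<inter> Y = {}" "X \<inter> Z = {}" "Y \<inter> Z = {}"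
  shows "sorted_by hex_family X Y Z"
proof -
  have disj: "Y \<inter> X = {}" "Z \<inter> X = {}" "Z \<inter> Y = {}" using assms by blast+
  note c = assms(1-3) and d = assms(4-6) disj
  show ?thesis
  proof (cases "mixed X")
    case mX: True
    show ?thesis
    proof (cases "mixed Y")
      case mY: True
      show ?thesis
        using hex_two_mixed[OF c(1) mX c(2) mY c(3)] hex_three_mixed[OF c(1) mX c(2) mY c(3)] d by blast
    next
      case mY: False
      show ?thesis
        using hex_two_mixed[OF c(1) mX c(3) _ c(2) mY] hex_one_mixed'[OF c(1) mX c(2) mY c(3)] d
          sorted_by_swap(2) by blast
    qed
  next
    case mX: False
    show ?thesis
    proof (cases "mixed Y")
      case mY: True
      show ?thesis
        using hex_two_mixed[OF c(2) mY c(3) _ c(1) mX] hex_one_mixed'[OF c(2) mY c(1) mX c(3)] d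
          sorted_by_swap(1)[of hex_family Y X Z] sorted_by_swap(5)[of hex_family Y Z X] by blast
    next
      case mY: False
      show ?thesis
        using hex_one_mixed'[OF c(3) _ c(1) mX c(2) mY] hex_no_mixed[OF c(1) mX c(2) mY c(3)] d
          sorted_by_swap(4)[of hex_family Z X Y] by blast
    qed
  qed
qed

section \<open>Two copies of \<open>K\<^sub>7\<close> sharing an edge\<close>

definition lo :: "vertex list" where "lo = [Num 1, Num 2, Num 3, Num 4, Num 5]"
definition hi :: "vertex list" where "hi = [VA, VB, VC, VD, VE]"

text \<open>
  The first tetrahedron has the vertices \<open>1, 2, 6, 7\<close>.  The next two and the eleven that follow
  contain \<open>A, \<dots>, E\<close> with one or both of \<open>6, 7\<close>, in the latter case meeting the plane of \<open>1, \<dots>, 6\<close>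
  in a triangle around \<open>6\<close>, an edge at \<open>6\<close>, or a face at \<open>6\<close>.  The last five are thin
  neighbourhoods of faces.
\<close>

definition glued_certs :: "(vertex list \<times> ipt list) list" where
  "glued_certs =
    [([VA, VB, VC, VD, VE],
      [(-3, -1, 0, 1), (3, 12, 0, -1), (0, 0, 1, 0), (18, -27, -11, 27)]),
    ([Num 6, VA, VB, VC, VD, VE],
      [(-5, -2, 0, 2), (3, 6, -1, 1), (-3, -4, -1, 4), (0, -3, 1, 1)]),
    ([Num 7, VA, VB, VC, VD, VE],
      [(0, 0, 1, 0), (1, 0, 2, 0), (0, 1, 2, 0), (0, 0, 0, 1)]),
    ([Num 6, Num 7, VA, VB, VC, VD, VE],
      [(1, 1, 1, 0), (0, -3, 1, 1), (-3, 0, 1, 2), (1, 1, 2, 0)]),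
    ([Num 1, Num 6, Num 7, VA, VB, VC, VD, VE],
      [(-1, 0, 1, 1), (1, 1, 1, 0), (-3, 0, 1, 2), (-1, 0, 2, 1)]),
    ([Num 2, Num 6, Num 7, VA, VB, VC, VD, VE],
      [(0, 3, 0, 2), (-1, -3, 0, 2), (-3, 0, 0, 2), (0, 3, 1, 2)]),
    ([Num 3, Num 6, Num 7, VA, VB, VC, VD, VE],
      [(1, -3, 5, 0), (1, 0, 5, 1), (-2, 3, 5, 1), (1, -3, 6, 0)]),
    ([Num 4, Num 6, Num 7, VA, VB, VC, VD, VE],
      [(1, 0, 2, 0), (-2, -3, 2, 3), (-1, 0, 2, 1), (1, 0, 3, 0)]),
    ([Num 5, Num 6, Num 7, VA, VB, VC, VD, VE],
      [(1, 3, 2, 0), (2, -3, 2, 3), (1, 0, 2, 0), (1, 3, 3, 0)]),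
    ([Num 1, Num 2, Num 6, Num 7, VA, VB, VC, VD, VE],
      [(-1, 0, 0, 1), (0, 3, 0, 2), (-3, 0, 0, 2), (-1, 0, 1, 1)]),
    ([Num 2, Num 3, Num 6, Num 7, VA, VB, VC, VD, VE],
      [(0, -1, 0, 1), (-2, 3, 0, 1), (-1, -3, 0, 2), (0, -1, 1, 1)]),
    ([Num 3, Num 4, Num 6, Num 7, VA, VB, VC, VD, VE],
      [(1, -3, 5, 0), (-2, -3, 5, 3), (1, 0, 5, 1), (1, -3, 6, 0)]),
    ([Num 4, Num 5, Num 6, Num 7, VA, VB, VC, VD, VE],
      [(1, 0, 3, 0), (2, -3, 3, 3), (1, -1, 3, 0), (1, 0, 4, 0)]),
    ([Num 1, Num 5, Num 6, Num 7, VA, VB, VC, VD, VE],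
      [(1, 3, 1, 0), (1, 0, 1, 1), (1, 1, 1, 0), (1, 3, 2, 0)]),
    ([Num 2, Num 4, Num 5],
      [(-1, 0, -1, 0), (-1, 1, -1, 0), (-2, 0, -1, 1), (-2, 0, 1, 1)]),
    ([Num 1, Num 3, Num 5],
      [(0, 1, -1, 0), (1, 1, -1, 1), (2, 2, -1, -1), (1, 1, 1, 1)]),
    ([Num 1, Num 2, Num 4],
      [(-1, 1, -1, 0), (0, 1, -1, 0), (-1, 1, -1, 1), (-2, 3, 1, 1)]),
    ([Num 2, Num 3, Num 5],
      [(-1, -1, -1, 0), (-1, 0, -1, 0), (-1, -1, -1, 1), (-1, -1, 1, 1)]),
    ([Num 1, Num 3, Num 4],
      [(0, 1, -1, 0), (-1, 2, -1, 0), (0, 2, -1, -1), (0, 1, 1, 0)])]"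

definition glued_family :: "vertex set set" where "glued_family = set ` fst ` set glued_certs"

lemma glued_family_members:
  "set hi \<in> glued_family" "set hi \<union> {Num 6, Num 7} \<in> glued_family"
  "set hi \<union> {Num 6} \<in> glued_family" "set hi \<union> {Num 7} \<in> glued_family"
  "\<forall>S \<in> set (subseqs lo). set S \<noteq> {} \<and> card (set S) \<le> 2 \<longrightarrow>
     set hi \<union> {Num 6, Num 7} \<union> set S \<in> glued_family \<or> card (set S) = 2 \<and> set lo - set S \<in> glued_family"
  by code_simp+

lemma K7_K7_graph:
  "K7_K7_edge = (set lo \<union> set hi \<union> {Num 6, Num 7},
     (\<lambda>(x, y). {x, y}) ` set (pairs (lo @ [Num 6, Num 7]) @ pairs ([Num 6, Num 7] @ hi)))"
proof -
  have e: "Num ` {1..7} = set (lo @ [Num 6, Num 7])" by (force simp: lo_def)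
  have e': "{Num 6, Num 7, VA, VB, VC, VD, VE} = set ([Num 6, Num 7] @ hi)" by (auto simp: hi_def)
  have d: "distinct (lo @ [Num 6, Num 7])" "distinct ([Num 6, Num 7] @ hi)"
    by (simp_all add: lo_def hi_def)
  have "nsets (Num ` {1..7}) 2 \<union> nsets {Num 6, Num 7, VA, VB, VC, VD, VE} 2 =
    (\<lambda>(x, y). {x, y}) ` set (pairs (lo @ [Num 6, Num 7]) @ pairs ([Num 6, Num 7] @ hi))"
    unfolding e e' nsets_2_pairs[OF d(1)] nsets_2_pairs[OF d(2)] by (simp only: set_append image_Un)
  moreover have "Num ` {1..7} \<union> {VA, VB, VC, VD, VE} = set lo \<union> set hi \<union> {Num 6, Num 7}"
    unfolding e by (auto simp: hi_def)
  ultimately show ?thesis unfolding K7_K7_edge_def by simp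
qed

lemma lo_hi: "set lo \<inter> set hi = {}" "set lo \<inter> {Num 6, Num 7} = {}" "set hi \<inter> {Num 6, Num 7} = {}"
    "card (set lo) = 5" "card (set hi) = 5"
  by (simp_all add: lo_def hi_def)

definition glued_cycle :: "vertex set \<Rightarrow> bool" where
  "glued_cycle X \<longleftrightarrow> (\<exists>c. is_cycle K7_K7_edge c \<and> set c = X)"

lemma glued_cycle_sub: "glued_cycle X \<Longrightarrow> X \<subseteq> set lo \<union> set hi \<union> {Num 6, Num 7}"
  by (auto simp: glued_cycle_def is_cycle_def K7_K7_graph)

lemma glued_cycle_card: "glued_cycle X \<Longrightarrow> 3 \<le> card X"
  using cycle_card unfolding glued_cycle_def by blast

lemma no_lo_hi_edge:
  assumes "{a, b} \<in> snd K7_K7_edge" "a \<in> set lo" "b \<in> set hi"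
  shows False
proof -
  have "{a, b} \<subseteq> Num ` {1..7} \<or> {a, b} \<subseteq> {Num 6, Num 7, VA, VB, VC, VD, VE}"
    using assms(1) by (auto simp: K7_K7_edge_def nsets_def)
  then show False using assms(2,3) by (auto simp: lo_def hi_def)
qed

lemma glued_cycle_side:
  assumes "glued_cycle X" "X \<inter> {Num 6, Num 7} \<subseteq> {v}" "v \<in> {Num 6, Num 7}"
  shows "X \<subseteq> set lo \<union> {v} \<or> X \<subseteq> set hi \<union> {v}"
proof -
  obtain c where c: "is_cycle K7_K7_edge c" "set c = X" using assms(1) by (auto simp: glued_cycle_def)
  show ?thesis
    unfolding c(2)[symmetric]
  proof (rule cycle_avoids_cut_vertex[OF c(1)])
    show "set c \<subseteq> set lo \<union> set hi \<union> {v}" using glued_cycle_sub[OF assms(1)] assms(2) c(2) by blast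
    show "v \<notin> set lo" "v \<notin> set hi" using assms(3) lo_hi by blast+
  qed (use no_lo_hi_edge in blast)
qed

lemma glued_cycle_inner:
  assumes "glued_cycle X" "X \<inter> {Num 6, Num 7} = {}"
  shows "X \<subseteq> set lo \<or> X \<subseteq> set hi"
  using glued_cycle_side[OF assms(1), of "Num 6"] assms(2) by blast

lemma glued_side_room:
  assumes "glued_cycle Y" "glued_cycle Z" "Y \<inter> Z = {}" "Y \<subseteq> U" "Z \<subseteq> U" "finite U" "card U = 5"
  shows False
proof -
  have "card Y + card Z + card ({} :: vertex set) \<le> card U"
    by (rule card_split3[OF assms(6,4,5)]) (simp_all add: assms(3))
  then show False using glued_cycle_card[OF assms(1)] glued_cycle_card[OF assms(2)] assms(7) by simp
qed

text \<open>
  The part \<open>S\<close> of \<open>X\<close> and \<open>Z\<close> within \<open>1, \<dots>, 5\<close> has at most two vertices.  It can be enclosed with \<open>6\<close>,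
  \<open>7\<close> and \<open>A, \<dots>, E\<close> when \<open>S\<close> and \<open>6\<close> lie in a common face; otherwise \<open>S\<close> is a diagonal of
  the pentagon and \<open>Y\<close> is the face complementary to \<open>S\<close> and \<open>6\<close>.
\<close>

lemma glued_cut_out:
  assumes X: "glued_cycle X" and Y: "glued_cycle Y" "Y \<subseteq> set lo" and disj: "X \<inter> Y = {}" "Z \<inter> Y = {}"
    and ne: "(X \<union> Z) \<inter> set lo \<noteq> {}" and XZ: "X \<union> Z \<subseteq> set lo \<union> set hi \<union> {Num 6, Num 7}"
  shows "sorted_by glued_family X Y Z"
proof -
  define S where "S = (X \<union> Z) \<inter> set lo"
  have fin: "finite S" "finite Y" using Y(2) finite_subset by (auto simp: S_def)
  have SY: "S \<inter> Y = {}" "S \<union> Y \<subseteq> set lo" using disj Y(2) by (auto simp: S_def)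
  have "card S + card Y \<le> card (set lo)"
    using card_Un_disjoint[OF fin SY(1)] card_mono[OF _ SY(2)] by simp
  then have c: "card S \<le> 2" using glued_cycle_card[OF Y(1)] by (simp add: lo_hi)
  have "S \<in> set ` set (subseqs lo)" unfolding subseqs_powset by (simp add: S_def)
  then obtain xs where xs: "S = set xs" "xs \<in> set (subseqs lo)" by (rule imageE)
  have "S \<noteq> {}" using ne by (simp add: S_def)
  then have "set hi \<union> {Num 6, Num 7} \<union> S \<in> glued_family \<or> card S = 2 \<and> set lo - S \<in> glued_family"
    using bspec[OF glued_family_members(5) xs(2)] c unfolding xs(1) by argo
  then show ?thesis
  proof
    assume A: "set hi \<union> {Num 6, Num 7} \<union> S \<in> glued_family"
    have "X \<subseteq> set hi \<union> {Num 6, Num 7} \<union> S" "Z \<subseteq> set hi \<union> {Num 6, Num 7} \<union> S"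
      using XZ unfolding S_def by blast+
    moreover have "Y \<inter> (set hi \<union> {Num 6, Num 7} \<union> S) = {}"
      using Y(2) SY(1) lo_hi(1,2) by blast
    ultimately have "sorted_by glued_family X Z Y" using sorted_byI[OF A] by simp
    then show ?thesis by (rule sorted_by_swap)
  next
    assume A: "card S = 2 \<and> set lo - S \<in> glued_family"
    have "Y \<subseteq> set lo - S" using SY by blast
    moreover have "X \<inter> (set lo - S) = {}" "Z \<inter> (set lo - S) = {}" unfolding S_def by blast+
    ultimately have "sorted_by glued_family Y X Z" using sorted_byI[OF A[THEN conjunct2]] by simp
    then show ?thesis by (rule sorted_by_swap)
  qed
qed

lemma glued_one_hub:
  assumes X: "glued_cycle X" and Y: "glued_cycle Y" "Y \<subseteq> set lo" and Z: "glued_cycle Z" "Z \<subseteq> set hi"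
    and disj: "X \<inter> Y = {}" "X \<inter> Z = {}"
  shows "sorted_by glued_family X Y Z"
proof (cases "X \<inter> set lo = {}")
  case True
  have "X \<subseteq> set hi \<union> {Num 6, Num 7}" using glued_cycle_sub[OF X] True by blast
  moreover have "Z \<subseteq> set hi \<union> {Num 6, Num 7}" using Z(2) by blast
  moreover have "Y \<inter> (set hi \<union> {Num 6, Num 7}) = {}" using Y(2) lo_hi(1,2) by blast
  ultimately have "sorted_by glued_family X Z Y" using sorted_byI[OF glued_family_members(2)] by simp
  then show ?thesis by (rule sorted_by_swap)
next
  case False
  show ?thesis
  proof (rule glued_cut_out[OF X Y disj(1)])
    show "Z \<inter> Y = {}" using Y(2) Z(2) lo_hi(1) by blast
    show "(X \<union> Z) \<inter> set lo \<noteq> {}" using False by blast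
    show "X \<union> Z \<subseteq> set lo \<union> set hi \<union> {Num 6, Num 7}"
      using glued_cycle_sub[OF X] glued_cycle_sub[OF Z(1)] by blast
  qed
qed

lemma glued_one_hub':
  assumes X: "glued_cycle X" and Y: "glued_cycle Y" "Y \<inter> {Num 6, Num 7} = {}"
    and Z: "glued_cycle Z" "Z \<inter> {Num 6, Num 7} = {}"
    and disj: "X \<inter> Y = {}" "X \<inter> Z = {}" "Y \<inter> Z = {}"
  shows "sorted_by glued_family X Y Z"
proof -
  have "\<not> (Y \<subseteq> set lo \<and> Z \<subseteq> set lo)" "\<not> (Y \<subseteq> set hi \<and> Z \<subseteq> set hi)"
    using glued_side_room[OF Y(1) Z(1) disj(3)] lo_hi(4,5) by blast+
  then consider "Y \<subseteq> set lo" "Z \<subseteq> set hi" | "Z \<subseteq> set lo" "Y \<subseteq> set hi"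
    using glued_cycle_inner[OF Y] glued_cycle_inner[OF Z] by blast
  then show ?thesis
  proof cases
    case 1
    then show ?thesis using glued_one_hub[OF X Y(1) _ Z(1)] disj by simp
  next
    case 2
    then have "sorted_by glued_family X Z Y" using glued_one_hub[OF X Z(1) _ Y(1)] disj by simp
    then show ?thesis by (rule sorted_by_swap)
  qed
qed

text \<open>
  The two outer vertices \<open>v\<close> and \<open>w\<close> take one vertex from each of \<open>X\<close> and \<open>Z\<close>, so at least seven vertices remain for
  \<open>U\<close>, which has only five.
\<close>

lemma card_three_in_side:
  assumes X: "glued_cycle X" "X \<subseteq> U \<union> {v}" and Z: "glued_cycle Z" "Z \<subseteq> U \<union> {w}"
    and Y: "glued_cycle Y" "Y \<subseteq> U" and disj: "X \<inter> Z = {}" "X \<inter> Y = {}" "Z \<inter> Y = {}"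
    and U: "finite U" "card U = 5"
  shows False
proof -
  have less: "card W \<le> card (W \<inter> U) + 1" if "W \<subseteq> U \<union> {x}" for W x
  proof -
    have "W \<subseteq> insert x (W \<inter> U)" using that by blast
    then have "card W \<le> card (insert x (W \<inter> U))" using U(1) by (intro card_mono) auto
    also have "\<dots> \<le> card (W \<inter> U) + 1" using U(1) by (simp add: card_insert_if)
    finally show ?thesis .
  qed
  have "card (X \<inter> U) + card (Z \<inter> U) + card Y \<le> card U"
    by (rule card_split3[OF U(1) _ _ Y(2)]) (use disj in blast)+
  then show False
    using less[OF X(2)] less[OF Z(2)] glued_cycle_card[OF X(1)] glued_cycle_card[OF Z(1)]
      glued_cycle_card[OF Y(1)] U(2) by linarith
qed

lemma glued_two_hubs:
  assumes X: "glued_cycle X" "Num 6 \<in> X" and Z: "glued_cycle Z" "Num 7 \<in> Z"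
    and Y: "glued_cycle Y" and disj: "X \<inter> Z = {}" "X \<inter> Y = {}" "Z \<inter> Y = {}"
  shows "sorted_by glued_family X Y Z"
proof -
  have v67: "Num 6 \<in> {Num 6, Num 7}" "Num 7 \<in> {Num 6, Num 7}" by simp_all
  have "Num 7 \<notin> X" "Num 6 \<notin> Z" using X(2) Z(2) disj(1) by blast+
  then have X': "X \<subseteq> set lo \<union> {Num 6} \<or> X \<subseteq> set hi \<union> {Num 6}"
    and Z': "Z \<subseteq> set lo \<union> {Num 7} \<or> Z \<subseteq> set hi \<union> {Num 7}"
    using glued_cycle_side[OF X(1) _ v67(1)] glued_cycle_side[OF Z(1) _ v67(2)] by blast+
  have Y': "Y \<subseteq> set lo \<or> Y \<subseteq> set hi"
    by (rule glued_cycle_inner[OF Y]) (use X(2) Z(2) disj in blast)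
  have XZ: "X \<union> Z \<subseteq> set lo \<union> set hi \<union> {Num 6, Num 7}"
    using glued_cycle_sub[OF X(1)] glued_cycle_sub[OF Z(1)] by blast
  have full: "\<not> (X \<subseteq> set U \<union> {Num 6} \<and> Z \<subseteq> set U \<union> {Num 7} \<and> Y \<subseteq> set U)" if "card (set U) = 5" for U
    using card_three_in_side[OF X(1) _ Z(1) _ Y _ disj, of "set U" "Num 6" "Num 7"] that by blast
  from Y' show ?thesis
  proof
    assume Y: "Y \<subseteq> set lo"
    show ?thesis
    proof (cases "(X \<union> Z) \<inter> set lo = {}")
      case True
      have "X \<subseteq> set hi \<union> {Num 6, Num 7}" "Z \<subseteq> set hi \<union> {Num 6, Num 7}" using XZ True by blast+
      moreover have "Y \<inter> (set hi \<union> {Num 6, Num 7}) = {}" using Y lo_hi(1,2) by blast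
      ultimately have "sorted_by glued_family X Z Y" using sorted_byI[OF glued_family_members(2)] by simp
      then show ?thesis by (rule sorted_by_swap)
    next
      case False
      show ?thesis by (rule glued_cut_out[OF X(1) \<open>glued_cycle Y\<close> Y disj(2,3) False XZ])
    qed
  next
    assume Y: "Y \<subseteq> set hi"
    have hi: "W \<inter> (set hi \<union> V) = {}" if "W \<subseteq> set lo \<union> T" "T \<subseteq> {Num 6, Num 7}" "W \<inter> V = {}" for W T V
      using that lo_hi by blast
    have "\<not> (X \<subseteq> set hi \<union> {Num 6} \<and> Z \<subseteq> set hi \<union> {Num 7})" using full[of hi] Y lo_hi(5) by blast
    then consider "X \<subseteq> set lo \<union> {Num 6}" "Z \<subseteq> set lo \<union> {Num 7}"
      | "X \<subseteq> set lo \<union> {Num 6}" "Z \<subseteq> set hi \<union> {Num 7}"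
      | "X \<subseteq> set hi \<union> {Num 6}" "Z \<subseteq> set lo \<union> {Num 7}"
      using X' Z' by blast
    then show ?thesis
    proof cases
      case 1
      have "X \<inter> set hi = {}" using hi[OF 1(1), of "{}"] by simp
      moreover have "Z \<inter> set hi = {}" using hi[OF 1(2), of "{}"] by simp
      ultimately have "sorted_by glued_family Y X Z"
        using sorted_byI[OF glued_family_members(1) Y] by simp
      then show ?thesis by (rule sorted_by_swap)
    next
      case 2
      have "X \<inter> (set hi \<union> {Num 7}) = {}" using hi[OF 2(1), of "{Num 7}"] \<open>Num 7 \<notin> X\<close> by simp
      moreover have "Y \<subseteq> set hi \<union> {Num 7}" using Y by blast
      ultimately have "sorted_by glued_family Z Y X"
        using sorted_byI[OF glued_family_members(4) 2(2)] by simp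
      then show ?thesis by (rule sorted_by_swap)
    next
      case 3
      have "Z \<inter> (set hi \<union> {Num 6}) = {}" using hi[OF 3(2), of "{Num 6}"] \<open>Num 6 \<notin> Z\<close> by simp
      moreover have "Y \<subseteq> set hi \<union> {Num 6}" using Y by blast
      ultimately show ?thesis
        using sorted_byI[OF glued_family_members(3) 3(1)] by simp
    qed
  qed
qed

theorem glued_sorted:
  assumes X: "glued_cycle X" and Y: "glued_cycle Y" and Z: "glued_cycle Z"
    and d: "X \<inter> Y = {}" "X \<inter> Z = {}" "Y \<inter> Z = {}"
  shows "sorted_by glued_family X Y Z"
proof -
  have d': "Y \<inter> X = {}" "Z \<inter> X = {}" "Z \<inter> Y = {}" using d by blast+
  let ?H = "{Num 6, Num 7}"
  have "X \<inter> ?H = {} \<and> Y \<inter> ?H = {} \<or> X \<inter> ?H = {} \<and> Z \<inter> ?H = {} \<or> Y \<inter> ?H = {} \<and> Z \<inter> ?H = {}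
    \<or> Num 6 \<in> X \<and> Num 7 \<in> Y \<or> Num 6 \<in> X \<and> Num 7 \<in> Z \<or> Num 6 \<in> Y \<and> Num 7 \<in> X
    \<or> Num 6 \<in> Y \<and> Num 7 \<in> Z \<or> Num 6 \<in> Z \<and> Num 7 \<in> X \<or> Num 6 \<in> Z \<and> Num 7 \<in> Y"
    using d by auto
  then show ?thesis
  proof (elim disjE conjE)
    assume "X \<inter> ?H = {}" "Y \<inter> ?H = {}"
    from glued_one_hub'[OF Z X this(1) Y this(2) d'(2,3) d(1)] show ?thesis by (rule sorted_by_swap)
  next
    assume "X \<inter> ?H = {}" "Z \<inter> ?H = {}"
    from glued_one_hub'[OF Y X this(1) Z this(2) d'(1) d(3,2)] show ?thesis by (rule sorted_by_swap)
  next
    assume "Y \<inter> ?H = {}" "Z \<inter> ?H = {}"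
    from glued_one_hub'[OF X Y this(1) Z this(2) d] show ?thesis .
  next
    assume "Num 6 \<in> X" "Num 7 \<in> Y"
    from glued_two_hubs[OF X this(1) Y this(2) Z d] show ?thesis by (rule sorted_by_swap)
  next
    assume "Num 6 \<in> X" "Num 7 \<in> Z"
    from glued_two_hubs[OF X this(1) Z this(2) Y d(2,1) d'(3)] show ?thesis .
  next
    assume "Num 6 \<in> Y" "Num 7 \<in> X"
    from glued_two_hubs[OF Y this(1) X this(2) Z d'(1) d(3,2)] show ?thesis by (rule sorted_by_swap)
  next
    assume "Num 6 \<in> Y" "Num 7 \<in> Z"
    from glued_two_hubs[OF Y this(1) Z this(2) X d(3) d'(1,2)] show ?thesis by (rule sorted_by_swap)
  next
    assume "Num 6 \<in> Z" "Num 7 \<in> X"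
    from glued_two_hubs[OF Z this(1) X this(2) Y d'(2,3) d(1)] show ?thesis by (rule sorted_by_swap)
  next
    assume "Num 6 \<in> Z" "Num 7 \<in> Y"
    from glued_two_hubs[OF Z this(1) Y this(2) X d'(3,2,1)] show ?thesis by (rule sorted_by_swap)
  qed
qed

section \<open>The two drawings\<close>

text \<open>
  A pentagon with \<open>6\<close> inside, in the plane of height \<open>0\<close>, and \<open>7\<close> above \<open>6\<close>.  The vertex \<open>6\<close> is not
  at the origin, because the origin lies on the radial lines used by the diagonals.
\<close>

fun planar :: "nat \<Rightarrow> ipt" where
  "planar n = (if n = 1 then (0, 3, 0, 3) else if n = 2 then (-3, 1, 0, 3) else if n = 3 then (-2, -2, 0, 3)
     else if n = 4 then (2, -2, 0, 3) else if n = 5 then (3, 1, 0, 3) else if n = 6 then (1, 0, 0, 3)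
     else (1, 0, 9, 3))"

fun hex_place :: "vertex \<Rightarrow> ipt" where
  "hex_place (Num n) = planar n"
| "hex_place VA = (4, 0, 1, 2)" | "hex_place VB = (-3, -1, 1, 2)" | "hex_place VC = (-2, 3, 1, 2)"
| "hex_place VD = (-1, 0, 7, 2)" | "hex_place VE = (-1, -1, 6, 2)" | "hex_place VF = (3, 0, 5, 2)"

fun glued_place :: "vertex \<Rightarrow> ipt" where
  "glued_place (Num n) = planar n"
| "glued_place VA = (-1, 1, 1, 5)" | "glued_place VB = (0, 2, 5, 5)" | "glued_place VC = (-1, 2, 2, 5)"
| "glued_place VD = (1, 1, 6, 5)" | "glued_place VE = (-2, 1, 3, 5)" | "glued_place VF = (0, 0, 0, 1)"

text \<open>
  Each diagonal of the pentagon leaves one of its ends radially, passes through infinity to a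
  point outside the opposite side, and bends there towards its other end.
\<close>

definition bends :: "((vertex \<times> vertex) \<times> ipt) list" where
  "bends = [((Num 1, Num 3), (0, 3, 0, -2)), ((Num 2, Num 4), (-3, 1, 0, -2)),
     ((Num 3, Num 5), (-2, -2, 0, -2)), ((Num 1, Num 4), (-2, 2, 0, 2)), ((Num 2, Num 5), (-3, -1, 0, 2))]"

definition draw :: "(vertex \<Rightarrow> ipt) \<Rightarrow> vertex \<times> vertex \<Rightarrow> vertex arc" where
  "draw P e = (case map_of bends e of
     None \<Rightarrow> (fst e, snd e, P (fst e), None, P (snd e))
   | Some m \<Rightarrow> (fst e, snd e, P (fst e), Some m, ineg (P (snd e))))"

text \<open>
  Linear forms that separate disjoint segments of the planar part; all other pairs of segments
  are in general position.
\<close>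

definition planes :: "ipt list" where
  "planes = [(-3, 1, 0, 1), (0, 1, 0, 0), (-1, 3, 0, 3), (1, 3, 0, 0), (-3, 0, 0, 2), (-1, 0, 0, -1),
     (1, 1, 0, 0), (1, 3, 0, -1), (-1, 1, 0, 0), (1, -3, 0, 0), (-1, 0, 0, 0), (0, 2, 0, 1),
     (3, -1, 0, 4), (0, -1, 0, 0), (-1, 0, 0, 1), (-1, -1, 0, 2)]"

definition arcs_apart :: "ipt list \<Rightarrow> 'v arc \<Rightarrow> 'v arc \<Rightarrow> bool" where
  "arcs_apart H e f \<longleftrightarrow> ends e \<noteq> ends f \<and> list_all (\<lambda>s. list_all (apart H s) (pieces f)) (pieces e)"

definition hex_edges :: "(vertex \<times> vertex) list" where
  "hex_edges = pairs left @ pairs right @ bridges"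

definition glued_edges :: "(vertex \<times> vertex) list" where
  "glued_edges = pairs (lo @ [Num 6, Num 7]) @ pairs ([Num 6, Num 7] @ hi)"

lemma ends_draw: "ends (draw P e) = {fst e, snd e}"
  by (simp add: draw_def split: option.split)

lemma draw_placed:
  assumes "(u, v, p, m, r) = draw P e" "fst e \<noteq> snd e"
  shows "u \<noteq> v \<and> p \<in> {P u, ineg (P u)} \<and> r \<in> {P v, ineg (P v)}"
  using assms by (auto simp: draw_def split: option.splits)

lemma drawing_draw:
  assumes G: "snd G = (\<lambda>(x, y). {x, y}) ` set es" "fst G = \<Union> (snd G)"
    and loops: "list_all (\<lambda>e. fst e \<noteq> snd e) es"
    and local: "list_all (\<lambda>e. nondegenerate e \<and> list_all tame_piece (pieces e)) (map (draw P) es)"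
    and apart: "list_all (\<lambda>(e, f). e = f \<or> arcs_apart H e f) (pairs (map (draw P) es))"
  shows "drawing G P (map (draw P) es) H"
proof
  have E: "snd G = ends ` set (map (draw P) es)"
    unfolding G(1) by (simp add: image_image ends_draw case_prod_beta)
  then show "snd G = ends ` set (map (draw P) es)" .
  show "fst G = \<Union> (ends ` set (map (draw P) es))" unfolding E[symmetric] by (rule G(2))
  fix u v p m r
  assume "(u, v, p, m, r) \<in> set (map (draw P) es)"
  then obtain e where e: "(u, v, p, m, r) = draw P e" "e \<in> set es" unfolding set_map by (rule imageE)
  have "fst e \<noteq> snd e" using loops e(2) unfolding list_all_iff by blast
  then show "u \<noteq> v \<and> p \<in> {P u, ineg (P u)} \<and> r \<in> {P v, ineg (P v)}"
    by (rule draw_placed[OF e(1)])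
next
  fix e assume e: "e \<in> set (map (draw P) es)"
  have "nondegenerate e \<and> list_all tame_piece (pieces e)"
    using local e unfolding list_all_iff by (rule bspec)
  then show "nondegenerate e" "\<And>s. s \<in> set (pieces e) \<Longrightarrow> tame_piece s"
    unfolding list_all_iff by blast+
next
  fix e f assume e: "e \<in> set (map (draw P) es)" and f: "f \<in> set (map (draw P) es)" and ne: "e \<noteq> f"
  have *: "arcs_apart H e f" if "(e, f) \<in> set (pairs (map (draw P) es))" "e \<noteq> f" for e f
    using apart that unfolding list_all_iff by fastforce
  have "arcs_apart H e f \<or> arcs_apart H f e"
    using pairs_cover[OF e f ne] * ne by metis
  then show "ends e \<noteq> ends f \<and>
      ((\<forall>s \<in> set (pieces e). \<forall>t \<in> set (pieces f). apart H s t) \<or>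
       (\<forall>s \<in> set (pieces f). \<forall>t \<in> set (pieces e). apart H s t))"
    unfolding arcs_apart_def list_all_iff by metis
qed

lemma hex_local_ok:
  "list_all (\<lambda>e. fst e \<noteq> snd e) hex_edges"
  "list_all (\<lambda>e. nondegenerate e \<and> list_all tame_piece (pieces e)) (map (draw hex_place) hex_edges)"
  by code_simp+

lemma hex_apart_ok: "list_all (\<lambda>(e, f). e = f \<or> arcs_apart planes e f) (pairs (map (draw hex_place) hex_edges))"
  by code_simp

lemma hex_certs_ok: "list_all (separates (map (draw hex_place) hex_edges)) hex_certs"
  by code_simp

lemma glued_local_ok:
  "list_all (\<lambda>e. fst e \<noteq> snd e) glued_edges"
  "list_all (\<lambda>e. nondegenerate e \<and> list_all tame_piece (pieces e)) (map (draw glued_place) glued_edges)"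
  by code_simp+

lemma glued_apart_ok: "list_all (\<lambda>(e, f). e = f \<or> arcs_apart planes e f) (pairs (map (draw glued_place) glued_edges))"
  by code_simp

lemma glued_certs_ok: "list_all (separates (map (draw glued_place) glued_edges)) glued_certs"
  by code_simp

lemma hex_vertices: "fst K6_K6_hexagon = \<Union> (snd K6_K6_hexagon)"
proof -
  have "(\<Union>e \<in> set hex_edges. {fst e, snd e}) = set left \<union> set right" by code_simp
  then show ?thesis by (simp add: hexagon_graph hex_edges_def case_prod_beta)
qed

lemma glued_vertices: "fst K7_K7_edge = \<Union> (snd K7_K7_edge)"
proof -
  have "(\<Union>e \<in> set glued_edges. {fst e, snd e}) = set lo \<union> set hi \<union> {Num 6, Num 7}" by code_simp
  then show ?thesis unfolding K7_K7_graph fst_conv snd_conv glued_edges_def[symmetric]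
    by (simp add: case_prod_beta)
qed

lemma sorted_by_lists:
  assumes "sorted_by (set ` fst ` set Cs) (set c1) (set c2) (set c3)"
  shows "\<exists>S \<in> fst ` set Cs. (\<forall>c \<in> {c1, c2, c3}. set c \<subseteq> set S \<or> set c \<inter> set S = {}) \<and>
    (\<exists>c \<in> {c1, c2, c3}. set c \<subseteq> set S) \<and> (\<exists>c \<in> {c1, c2, c3}. set c \<inter> set S = {})"
  using assms unfolding sorted_by_def by simp

theorem hexagon_linkless: "three_linklessly_embeddable K6_K6_hexagon"
proof -
  interpret drawing K6_K6_hexagon hex_place "map (draw hex_place) hex_edges" planes
    by (rule drawing_draw[OF _ hex_vertices hex_local_ok hex_apart_ok])
       (simp only: hexagon_graph snd_conv hex_edges_def)
  show ?thesis
  proof (rule three_linkless_criterion[of hex_certs])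
    show "separates (map (draw hex_place) hex_edges) C" if "C \<in> set hex_certs" for C
      using hex_certs_ok that unfolding list_all_iff by (rule bspec)
  next
    fix c1 c2 c3
    assume c: "is_cycle K6_K6_hexagon c1" "is_cycle K6_K6_hexagon c2" "is_cycle K6_K6_hexagon c3"
      and d: "set c1 \<inter> set c2 = {}" "set c1 \<inter> set c3 = {}" "set c2 \<inter> set c3 = {}"
    have "hex_cycle (set c1)" "hex_cycle (set c2)" "hex_cycle (set c3)"
      using c unfolding hex_cycle_def by blast+
    from hex_sorted[OF this d]
    show "\<exists>S \<in> fst ` set hex_certs. (\<forall>c \<in> {c1, c2, c3}. set c \<subseteq> set S \<or> set c \<inter> set S = {}) \<and>
      (\<exists>c \<in> {c1, c2, c3}. set c \<subseteq> set S) \<and> (\<exists>c \<in> {c1, c2, c3}. set c \<inter> set S = {})"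
      unfolding hex_family_def by (rule sorted_by_lists)
  qed
qed

theorem glued_linkless: "three_linklessly_embeddable K7_K7_edge"
proof -
  interpret drawing K7_K7_edge glued_place "map (draw glued_place) glued_edges" planes
    by (rule drawing_draw[OF _ glued_vertices glued_local_ok glued_apart_ok])
       (simp only: K7_K7_graph snd_conv glued_edges_def)
  show ?thesis
  proof (rule three_linkless_criterion[of glued_certs])
    show "separates (map (draw glued_place) glued_edges) C" if "C \<in> set glued_certs" for C
      using glued_certs_ok that unfolding list_all_iff by (rule bspec)
  next
    fix c1 c2 c3
    assume c: "is_cycle K7_K7_edge c1" "is_cycle K7_K7_edge c2" "is_cycle K7_K7_edge c3"
      and d: "set c1 \<inter> set c2 = {}" "set c1 \<inter> set c3 = {}" "set c2 \<inter> set c3 = {}"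
    have "glued_cycle (set c1)" "glued_cycle (set c2)" "glued_cycle (set c3)"
      using c unfolding glued_cycle_def by blast+
    from glued_sorted[OF this d]
    show "\<exists>S \<in> fst ` set glued_certs. (\<forall>c \<in> {c1, c2, c3}. set c \<subseteq> set S \<or> set c \<inter> set S = {}) \<and>
      (\<exists>c \<in> {c1, c2, c3}. set c \<subseteq> set S) \<and> (\<exists>c \<in> {c1, c2, c3}. set c \<inter> set S = {})"
      unfolding glued_family_def by (rule sorted_by_lists)
  qed
qed

theorem mainTheorem4:
  shows "three_linklessly_embeddable K6_K6_hexagon \<and> three_linklessly_embeddable K7_K7_edge"
  using hexagon_linkless glued_linkless by blast

end
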